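(* Fix two integers $\Delta\ge\delta\ge 3$. If $\mathcal{L}$ is a unimodular network concentrated on trees with degrees in $\{\delta,\ldots,\Delta\}$, then $\mu_{\mathcal{L}}$ has only finitely many atoms. More precisely, $$\Sigma_{p.p.}(\mathcal{L})\;\subseteq\;\left\{\lambda\in\mathbb{A}\colon\tau(\lambda)<\frac{\Delta-2}{\delta-2}\right\}.$$
   Context: Unimodular networks. Let $\mathcal{G}_\star$ be the set of isomorphism classes of connected, locally finite, countable rooted graphs $(G,o)$ (isomorphisms preserve the root). It is a Polish space under the distance $1/(1+R)$, where $R$ is the supremum of the $r\ge 0$ such that the balls of radius $r$ around the two roots are isomorphic as rooted graphs. Let $\mathcal{G}_{\star\star}$ be the analogous space of doubly rooted graphs $(G,x,y)$. A probability measure $\mathcal{L}$ on $\mathcal{G}_\star$ (or a random rooted graph $(G,o)\sim\mathcal{L}$) is called unimodular, or a unimodular network, if for every Borel $f\colon\mathcal{G}_{\star\star}\to[0,\infty]$, $\mathbb{E}[\sum_{x\in V(G)}f(G,o,x)]=\mathbb{E}[\sum_{x\in V(G)}f(G,x,o)]$. It is concentrated on trees with degrees in a set $D$ if almost surely $G$ is a tree all of whose vertices have degree in $D$. Spectral measures. For a countable locally finite graph $G=(V,E)$, the adjacency operator $A$ acts on finitely supported functions in $\ell^2_{\mathbb{C}}(V)$, with $\langle \mathfrak{e}_x|A\mathfrak{e}_y\rangle=1$ if $\{x,y\}\in E$ and $0$ otherwise, where $(\mathfrak{e}_x)_{x\in V}$ is the canonical basis. $G$ is called self-adjoint if $A$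 is essentially self-adjoint. In that case, for $o\in V$, $\mu_{(G,o)}$ is the unique Borel probability measure on $\mathbb{R}$ such that $\langle \mathfrak{e}_o|(A-z)^{-1}\mathfrak{e}_o\rangle=\int_{\mathbb{R}}\frac{1}{\xi-z}\,\mu_{(G,o)}(d\xi)$ for all $z\in\mathbb{C}\setminus\mathbb{R}$. It is known that under any unimodular network, $G$ is almost surely self-adjoint; one sets $\mu_{\mathcal{L}}(\cdot):=\mathbb{E}[\mu_{(G,o)}(\cdot)]$ with $(G,o)\sim\mathcal{L}$. The pure-point support is $\Sigma_{p.p.}(\mathcal{L}):=\{\lambda\in\mathbb{R}\colon\mu_{\mathcal{L}}(\{\lambda\})>0\}$. $\mathbb{A}$ is the set of totally real algebraic integers, i.e. roots of monic polynomials with integer coefficients all of whose complex roots are real. For $\lambda\in\mathbb{A}$, the tree-complexity $\tau(\lambda)$ is the minimum possible number of vertices of a finite tree whose adjacency matrix has $\lambda$ as an eigenvalue (it is known that such a tree exists for every $\lambda\in\mathbb{A}$). *)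

theory Defs
  imports "HOL-Probability.Probability" "Jordan_Normal_Form.Char_Poly"
begin

section \<open>Graphs\<close>

datatype 'v graph = Graph (verts: "'v set") (edges: "'v set set")

definition simple_graph :: "'v graph \<Rightarrow> bool" where
  "simple_graph G \<longleftrightarrow> (\<forall>e\<in>edges G. \<exists>x\<in>verts G. \<exists>y\<in>verts G. x \<noteq> y \<and> e = {x, y})"

definition adj_rel :: "'v graph \<Rightarrow> 'v rel" where
  "adj_rel G = {(x, y). {x, y} \<in> edges G}"

definition neighbours :: "'v graph \<Rightarrow> 'v \<Rightarrow> 'v set" where
  "neighbours G x = {y. {x, y} \<in> edges G}"

definition vertex_degree :: "'v graph \<Rightarrow> 'v \<Rightarrow> nat" where
  "vertex_degree G x = card (neighbours G x)"

definition locally_finite_graph :: "'v graph \<Rightarrow> bool" where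
  "locally_finite_graph G \<longleftrightarrow> (\<forall>x\<in>verts G. finite (neighbours G x))"

definition connected_graph :: "'v graph \<Rightarrow> bool" where
  "connected_graph G \<longleftrightarrow> verts G \<noteq> {} \<and> (\<forall>x\<in>verts G. \<forall>y\<in>verts G. (x, y) \<in> (adj_rel G)\<^sup>*)"

definition is_cycle :: "'v graph \<Rightarrow> 'v list \<Rightarrow> bool" where
  "is_cycle G xs \<longleftrightarrow> 3 \<le> length xs \<and> distinct xs \<and>
     (\<forall>i<length xs. {xs ! i, xs ! (Suc i mod length xs)} \<in> edges G)"

definition tree_graph :: "'v graph \<Rightarrow> bool" where
  "tree_graph G \<longleftrightarrow> simple_graph G \<and> connected_graph G \<and> (\<nexists>xs. is_cycle G xs)"

definition adj_entry :: "'v graph \<Rightarrow> 'v \<Rightarrow> 'v \<Rightarrow> 'a::zero_neq_one" where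
  "adj_entry G x y = (if {x, y} \<in> edges G then 1 else 0)"


section \<open>The spaces of rooted and doubly rooted graphs\<close>

text \<open>
  A graph carries a list of roots, so that rooted graphs (one root) and doubly rooted graphs
  (two roots) are treated alike. Every countable graph is isomorphic to one whose vertex set is
  a set of natural numbers, so the isomorphism classes are formed over \<^typ>\<open>nat\<close>.
\<close>

type_synonym 'v rooted = "'v graph \<times> 'v list"

definition rooted_iso :: "'v rooted \<Rightarrow> 'w rooted \<Rightarrow> bool" where
  "rooted_iso P Q \<longleftrightarrow> (case (P, Q) of ((G, os), (H, ps)) \<Rightarrow>
     set os \<subseteq> verts G \<and>
     (\<exists>\<phi>. bij_betw \<phi> (verts G) (verts H) \<and>
          (\<forall>x\<in>verts G. \<forall>y\<in>verts G. {x, y} \<in> edges G \<longleftrightarrow> {\<phi> x, \<phi> y} \<in> edges H) \<and>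
          map \<phi> os = ps))"

definition ball_verts :: "real \<Rightarrow> 'v rooted \<Rightarrow> 'v set" where
  "ball_verts r P = {v \<in> verts (fst P). \<exists>u\<in>set (snd P). \<exists>n. real n \<le> r \<and> (u, v) \<in> adj_rel (fst P) ^^ n}"

text \<open>The ball of radius \<open>r\<close> is induced by the vertices at distance at most \<open>r\<close> from some root.\<close>

definition rooted_ball :: "real \<Rightarrow> 'v rooted \<Rightarrow> 'v rooted" where
  "rooted_ball r P =
     (Graph (ball_verts r P) {e \<in> edges (fst P). e \<subseteq> ball_verts r P}, snd P)"

definition rooted_graphs :: "nat \<Rightarrow> nat rooted set" where
  "rooted_graphs k = {(G, os). simple_graph G \<and> connected_graph G \<and> locally_finite_graph G \<and>
     length os = k \<and> set os \<subseteq> verts G}"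

definition iso_rel :: "nat \<Rightarrow> nat rooted rel" where
  "iso_rel k = {(P, Q). P \<in> rooted_graphs k \<and> Q \<in> rooted_graphs k \<and> rooted_iso P Q}"

definition rooted_classes :: "nat \<Rightarrow> nat rooted set set" where
  "rooted_classes k = rooted_graphs k // iso_rel k"

definition iso_class :: "nat rooted \<Rightarrow> nat rooted set" where
  "iso_class P = iso_rel (length (snd P)) `` {P}"

definition representative :: "nat rooted set \<Rightarrow> nat rooted" where
  "representative c = (SOME P. P \<in> c)"

text \<open>
  The supremum is taken in \<^typ>\<open>ennreal\<close>: it is \<open>0\<close> when no radius qualifies, for instance for
  double roots that coincide in only one of the two graphs.
\<close>

definition agreement_radius :: "nat rooted \<Rightarrow> nat rooted \<Rightarrow> ennreal" where
  "agreement_radius P Q = (SUP r\<in>{r. 0 \<le> r \<and> rooted_iso (rooted_ball r P) (rooted_ball r Q)}. ennreal r)"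

definition class_dist :: "nat rooted set \<Rightarrow> nat rooted set \<Rightarrow> real" where
  "class_dist c d = enn2real (1 / (1 + agreement_radius (representative c) (representative d)))"

definition rooted_borel :: "nat \<Rightarrow> nat rooted set measure" where
  "rooted_borel k = sigma (rooted_classes k)
     {U. openin (Metric_space.mtopology (rooted_classes k) class_dist) U}"


subsection \<open>The distance is a metric\<close>

definition iso_map :: "('v \<Rightarrow> 'w) \<Rightarrow> 'v rooted \<Rightarrow> 'w rooted \<Rightarrow> bool" where
  "iso_map \<phi> P Q \<longleftrightarrow> bij_betw \<phi> (verts (fst P)) (verts (fst Q)) \<and>
     (\<forall>x\<in>verts (fst P). \<forall>y\<in>verts (fst P). {x, y} \<in> edges (fst P) \<longleftrightarrow> {\<phi> x, \<phi> y} \<in> edges (fst Q)) \<and>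
     map \<phi> (snd P) = snd Q"

definition wf_rooted :: "'v rooted \<Rightarrow> bool" where
  "wf_rooted P \<longleftrightarrow> (\<forall>e\<in>edges (fst P). e \<subseteq> verts (fst P)) \<and> set (snd P) \<subseteq> verts (fst P)"

lemma rooted_iso_iff:
  "rooted_iso P Q \<longleftrightarrow> set (snd P) \<subseteq> verts (fst P) \<and> (\<exists>\<phi>. iso_map \<phi> P Q)"
  by (cases P; cases Q) (simp add: rooted_iso_def iso_map_def)

lemma wf_rooted_graphs: "P \<in> rooted_graphs k \<Longrightarrow> wf_rooted P"
  unfolding rooted_graphs_def wf_rooted_def simple_graph_def by fastforce

lemma iso_map_id: "iso_map (\<lambda>x. x) P P"
  by (simp add: iso_map_def bij_betw_def)

lemma iso_map_inv:
  assumes "iso_map \<phi> P Q" and "set (snd P) \<subseteq> verts (fst P)"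
  shows "iso_map (inv_into (verts (fst P)) \<phi>) Q P" and "set (snd Q) \<subseteq> verts (fst Q)"
proof -
  let ?V = "verts (fst P)" and ?W = "verts (fst Q)" and ?\<psi> = "inv_into (verts (fst P)) \<phi>"
  have b: "bij_betw \<phi> ?V ?W" and m: "map \<phi> (snd P) = snd Q"
    using assms(1) by (auto simp: iso_map_def)
  have b': "bij_betw ?\<psi> ?W ?V" using b by (rule bij_betw_inv_into)
  have "{x, y} \<in> edges (fst Q) \<longleftrightarrow> {?\<psi> x, ?\<psi> y} \<in> edges (fst P)" if "x \<in> ?W" "y \<in> ?W" for x y
  proof -
    have "?\<psi> x \<in> ?V" "?\<psi> y \<in> ?V" "\<phi> (?\<psi> x) = x" "\<phi> (?\<psi> y) = y"
      using that b b' by (auto simp: bij_betw_def f_inv_into_f inv_into_into)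
    then show ?thesis using assms(1) unfolding iso_map_def by metis
  qed
  moreover have "map ?\<psi> (snd Q) = snd P"
  proof -
    have "map ?\<psi> (snd Q) = map (\<lambda>x. ?\<psi> (\<phi> x)) (snd P)" by (simp flip: m)
    also have "\<dots> = snd P"
      by (rule map_idI) (use assms(2) b in \<open>auto simp: bij_betw_def inv_into_f_f\<close>)
    finally show ?thesis .
  qed
  ultimately show "iso_map ?\<psi> Q P" using b' by (simp add: iso_map_def)
  show "set (snd Q) \<subseteq> ?W" using b assms(2) by (auto simp flip: m simp: bij_betw_def)
qed

lemma rooted_iso_refl: "set (snd P) \<subseteq> verts (fst P) \<Longrightarrow> rooted_iso P P"
  using iso_map_id rooted_iso_iff by blast

lemma rooted_iso_sym: "rooted_iso P Q \<Longrightarrow> rooted_iso Q P"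
  unfolding rooted_iso_iff using iso_map_inv by blast

lemma rooted_iso_trans:
  assumes "rooted_iso P Q" "rooted_iso Q R" shows "rooted_iso P R"
proof -
  obtain \<phi> \<psi> where "iso_map \<phi> P Q" "iso_map \<psi> Q R" and s: "set (snd P) \<subseteq> verts (fst P)"
    using assms unfolding rooted_iso_iff by blast
  then have "iso_map (\<psi> \<circ> \<phi>) P R"
    unfolding iso_map_def
    by (auto simp: bij_betw_apply intro: bij_betw_trans simp flip: list.map_comp)
  then show ?thesis using s rooted_iso_iff by blast
qed

lemma equiv_iso_rel: "equiv (rooted_graphs k) (iso_rel k)"
proof (rule equivI)
  show "iso_rel k \<subseteq> rooted_graphs k \<times> rooted_graphs k" by (auto simp: iso_rel_def)
  show "refl_on (rooted_graphs k) (iso_rel k)"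
  proof (rule refl_onI)
    fix P assume "P \<in> rooted_graphs k"
    then show "(P, P) \<in> iso_rel k"
      using wf_rooted_graphs[of P k] rooted_iso_refl[of P] by (simp add: wf_rooted_def iso_rel_def)
  qed
  show "sym (iso_rel k)" by (auto simp: sym_def iso_rel_def intro: rooted_iso_sym)
  show "trans (iso_rel k)"
  proof (rule transI)
    fix P Q R assume "(P, Q) \<in> iso_rel k" "(Q, R) \<in> iso_rel k"
    then show "(P, R) \<in> iso_rel k" using rooted_iso_trans[of P Q R] by (simp add: iso_rel_def)
  qed
qed

lemma representative_props:
  assumes "c \<in> rooted_classes k"
  shows "representative c \<in> c" "representative c \<in> rooted_graphs k"
    "c = iso_rel k `` {representative c}"
proof -
  obtain P where P: "P \<in> rooted_graphs k" "c = iso_rel k `` {P}"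
    using assms unfolding rooted_classes_def by (rule quotientE)
  have "P \<in> c" using P equiv_iso_rel by (metis equiv_class_self)
  then show r: "representative c \<in> c" unfolding representative_def by (rule someI)
  then show "representative c \<in> rooted_graphs k" using P by (auto simp: iso_rel_def)
  show "c = iso_rel k `` {representative c}"
    using r P equiv_iso_rel by (metis Image_singleton_iff equiv_class_eq)
qed

lemma relpow_mono_rel: "(R :: 'a rel) \<subseteq> S \<Longrightarrow> R ^^ n \<subseteq> S ^^ n"
proof (induction n)
  case (Suc n)
  then show ?case by (simp add: relcomp_mono)
qed simp

lemma walk_map:
  assumes "iso_map \<phi> P Q" and "wf_rooted P" and "u \<in> verts (fst P)"
    and "(u, v) \<in> adj_rel (fst P) ^^ n"
  shows "v \<in> verts (fst P) \<and> (\<phi> u, \<phi> v) \<in> adj_rel (fst Q) ^^ n"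
  using assms(4)
proof (induction n arbitrary: v)
  case 0
  then show ?case using assms(3) by simp
next
  case (Suc n)
  then obtain w where w: "(u, w) \<in> adj_rel (fst P) ^^ n" "{w, v} \<in> edges (fst P)"
    by (auto simp: adj_rel_def)
  then have "w \<in> verts (fst P)" "v \<in> verts (fst P)" "(\<phi> u, \<phi> w) \<in> adj_rel (fst Q) ^^ n"
    using Suc.IH assms(2) by (auto simp: wf_rooted_def)
  moreover from this w have "(\<phi> w, \<phi> v) \<in> adj_rel (fst Q)"
    using assms(1) by (auto simp: adj_rel_def iso_map_def)
  ultimately show ?case by auto
qed

lemma ball_verts_image:
  assumes "iso_map \<phi> P Q" and "wf_rooted P" and "wf_rooted Q"
  shows "\<phi> ` ball_verts r P = ball_verts r Q"
proof -
  have sub: "\<phi> ` ball_verts r P \<subseteq> ball_verts r Q"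
    if "iso_map \<phi> P Q" "wf_rooted P" for \<phi> :: "'c \<Rightarrow> 'd" and P Q
  proof
    fix y assume "y \<in> \<phi> ` ball_verts r P"
    then obtain v u n where *: "y = \<phi> v" "v \<in> verts (fst P)" "u \<in> set (snd P)" "real n \<le> r"
      "(u, v) \<in> adj_rel (fst P) ^^ n"
      by (auto simp: ball_verts_def)
    have "u \<in> verts (fst P)" using * that by (auto simp: wf_rooted_def)
    then have "v \<in> verts (fst P)" "(\<phi> u, \<phi> v) \<in> adj_rel (fst Q) ^^ n"
      using walk_map[OF that _ *(5)] by auto
    moreover have "\<phi> u \<in> set (snd Q)"
    proof -
      have "snd Q = map \<phi> (snd P)" using that(1) by (simp add: iso_map_def)
      then show ?thesis using *(3) by simp
    qed
    moreover have "\<phi> v \<in> verts (fst Q)" using that(1) *(2) by (auto simp: iso_map_def bij_betw_def)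
    ultimately show "y \<in> ball_verts r Q" unfolding ball_verts_def using * by blast
  qed
  have s: "set (snd P) \<subseteq> verts (fst P)" using assms by (simp add: wf_rooted_def)
  let ?\<psi> = "inv_into (verts (fst P)) \<phi>"
  have "ball_verts r Q \<subseteq> \<phi> ` ball_verts r P"
  proof
    fix y assume y: "y \<in> ball_verts r Q"
    then have "?\<psi> y \<in> ball_verts r P" using sub[OF iso_map_inv(1)[OF assms(1) s] assms(3)] by auto
    moreover have "\<phi> (?\<psi> y) = y"
      using y assms(1) by (auto simp: ball_verts_def iso_map_def bij_betw_def f_inv_into_f)
    ultimately show "y \<in> \<phi> ` ball_verts r P" by (metis imageI)
  qed
  with sub[OF assms(1,2)] show ?thesis by auto
qed

lemma rooted_ball_simps [simp]:
  "verts (fst (rooted_ball r P)) = ball_verts r P" "snd (rooted_ball r P) = snd P"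
  "edges (fst (rooted_ball r P)) = {e \<in> edges (fst P). e \<subseteq> ball_verts r P}"
  by (simp_all add: rooted_ball_def)

lemma ball_verts_subset: "ball_verts r P \<subseteq> verts (fst P)"
  by (auto simp: ball_verts_def)

lemma roots_in_ball: 
  assumes "wf_rooted P" "0 \<le> r" shows "set (snd P) \<subseteq> ball_verts r P"
proof
  fix u assume "u \<in> set (snd P)"
  moreover have "real 0 \<le> r" "(u, u) \<in> adj_rel (fst P) ^^ 0" using assms(2) by auto
  ultimately show "u \<in> ball_verts r P"
    using assms(1) unfolding ball_verts_def wf_rooted_def by blast
qed

lemma iso_map_ball:
  assumes "iso_map \<phi> P Q" and "wf_rooted P" and "wf_rooted Q"
  shows "iso_map \<phi> (rooted_ball r P) (rooted_ball r Q)"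
proof -
  have im: "\<phi> ` ball_verts r P = ball_verts r Q" by (rule ball_verts_image[OF assms])
  have sub: "ball_verts r P \<subseteq> verts (fst P)" by (rule ball_verts_subset)
  have "inj_on \<phi> (ball_verts r P)"
    using assms(1) sub by (auto simp: iso_map_def bij_betw_def inj_on_subset)
  then have "bij_betw \<phi> (ball_verts r P) (ball_verts r Q)" using im by (simp add: bij_betw_def)
  moreover have "\<forall>x\<in>ball_verts r P. \<forall>y\<in>ball_verts r P.
      {x, y} \<in> edges (fst P) \<longleftrightarrow> {\<phi> x, \<phi> y} \<in> edges (fst Q)"
    using assms(1) sub unfolding iso_map_def by blast
  ultimately show ?thesis using assms(1) im by (auto simp: iso_map_def)
qed

lemma wf_rooted_ball: "wf_rooted P \<Longrightarrow> 0 \<le> r \<Longrightarrow> wf_rooted (rooted_ball r P)"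
  using roots_in_ball[of P r] by (auto simp: wf_rooted_def)

lemma rooted_iso_ball:
  assumes "rooted_iso P Q" "wf_rooted P" "wf_rooted Q" "0 \<le> r"
  shows "rooted_iso (rooted_ball r P) (rooted_ball r Q)"
proof -
  obtain \<phi> where "iso_map \<phi> P Q" using assms(1) by (auto simp: rooted_iso_iff)
  then have "iso_map \<phi> (rooted_ball r P) (rooted_ball r Q)" by (rule iso_map_ball[OF _ assms(2,3)])
  moreover have "set (snd (rooted_ball r P)) \<subseteq> verts (fst (rooted_ball r P))"
    using roots_in_ball[OF assms(2,4)] by simp
  ultimately show ?thesis unfolding rooted_iso_iff by (intro conjI exI)
qed

lemma ball_of_ball:
  assumes "wf_rooted P" and "0 \<le> r" and "r \<le> s"
  shows "rooted_ball r (rooted_ball s P) = rooted_ball r P"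
proof -
  have walk: "(u, v) \<in> adj_rel (fst (rooted_ball s P)) ^^ n"
    if "u \<in> set (snd P)" "real n \<le> s" "(u, v) \<in> adj_rel (fst P) ^^ n" for u v n
    using that(2,3)
  proof (induction n arbitrary: v)
    case (Suc n)
    then obtain w where w: "(u, w) \<in> adj_rel (fst P) ^^ n" "{w, v} \<in> edges (fst P)"
      by (auto simp: adj_rel_def)
    have "w \<in> verts (fst P)" "v \<in> verts (fst P)" using w assms(1) by (auto simp: wf_rooted_def)
    moreover have "real n \<le> s" using Suc.prems by simp
    ultimately have "w \<in> ball_verts s P" "v \<in> ball_verts s P"
      using that(1) w(1) Suc.prems unfolding ball_verts_def by blast+
    then have "(w, v) \<in> adj_rel (fst (rooted_ball s P))" using w by (auto simp: adj_rel_def)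
    then show ?case using Suc.IH[OF \<open>real n \<le> s\<close> w(1)] by auto
  qed simp
  have mono: "adj_rel (fst (rooted_ball s P)) \<subseteq> adj_rel (fst P)" by (auto simp: adj_rel_def)
  have "ball_verts r (rooted_ball s P) = ball_verts r P"
  proof (intro equalityI subsetI)
    fix v assume "v \<in> ball_verts r (rooted_ball s P)"
    then obtain u n where *: "u \<in> set (snd P)" "v \<in> ball_verts s P" "real n \<le> r"
      "(u, v) \<in> adj_rel (fst (rooted_ball s P)) ^^ n"
      unfolding ball_verts_def[of r] by auto
    then have "(u, v) \<in> adj_rel (fst P) ^^ n" using relpow_mono_rel[OF mono] by blast
    then show "v \<in> ball_verts r P" using * unfolding ball_verts_def by blast
  next
    fix v assume v: "v \<in> ball_verts r P"
    then obtain u n where *: "u \<in> set (snd P)" "v \<in> verts (fst P)" "real n \<le> r"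
      "(u, v) \<in> adj_rel (fst P) ^^ n" unfolding ball_verts_def by blast
    then have "v \<in> ball_verts s P" using assms(3) unfolding ball_verts_def by force
    moreover have "(u, v) \<in> adj_rel (fst (rooted_ball s P)) ^^ n" using walk * assms(3) by force
    ultimately show "v \<in> ball_verts r (rooted_ball s P)"
      using * unfolding ball_verts_def[of r] by auto
  qed
  moreover have "ball_verts r P \<subseteq> ball_verts s P"
    using assms(3) unfolding ball_verts_def by force
  ultimately show ?thesis by (auto simp: rooted_ball_def)
qed

lemma ball_iso_mono:
  assumes "wf_rooted P" "wf_rooted Q" "0 \<le> r" "r \<le> s"
    and "rooted_iso (rooted_ball s P) (rooted_ball s Q)"
  shows "rooted_iso (rooted_ball r P) (rooted_ball r Q)"
proof -
  have "0 \<le> s" using assms by simp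
  then show ?thesis
    using rooted_iso_ball[OF assms(5) wf_rooted_ball[OF assms(1)] wf_rooted_ball[OF assms(2)] assms(3)]
    by (simp only: ball_of_ball[OF assms(1,3,4)] ball_of_ball[OF assms(2,3,4)])
qed

lemma finite_ball:
  assumes "P \<in> rooted_graphs k"
  shows "finite (ball_verts r P)"
proof -
  have wf: "wf_rooted P" using assms by (rule wf_rooted_graphs)
  have lf: "finite (neighbours (fst P) x)" if "x \<in> verts (fst P)" for x
    using assms that by (auto simp: rooted_graphs_def locally_finite_graph_def)
  have fin: "finite {v. (u, v) \<in> adj_rel (fst P) ^^ n} \<and> {v. (u, v) \<in> adj_rel (fst P) ^^ n} \<subseteq> verts (fst P)"
    if "u \<in> verts (fst P)" for u n
  proof (induction n)
    case 0
    then show ?case using that by auto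
  next
    case (Suc n)
    have "{v. (u, v) \<in> adj_rel (fst P) ^^ Suc n} =
        (\<Union>w\<in>{w. (u, w) \<in> adj_rel (fst P) ^^ n}. neighbours (fst P) w)"
      by (auto simp: adj_rel_def neighbours_def)
    moreover have "neighbours (fst P) w \<subseteq> verts (fst P)" for w
      using wf by (auto simp: neighbours_def wf_rooted_def)
    ultimately show ?case using Suc lf by auto
  qed
  have "ball_verts r P \<subseteq> (\<Union>u\<in>set (snd P). \<Union>n\<in>{..nat \<lfloor>r\<rfloor>}. {v. (u, v) \<in> adj_rel (fst P) ^^ n})"
  proof
    fix v assume "v \<in> ball_verts r P"
    then obtain u n where *: "u \<in> set (snd P)" "real n \<le> r" "(u, v) \<in> adj_rel (fst P) ^^ n"
      unfolding ball_verts_def by blast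
    then have "n \<in> {..nat \<lfloor>r\<rfloor>}" by (simp add: le_nat_floor)
    then show "v \<in> (\<Union>u\<in>set (snd P). \<Union>n\<in>{..nat \<lfloor>r\<rfloor>}. {v. (u, v) \<in> adj_rel (fst P) ^^ n})"
      using * by blast
  qed
  moreover have "finite (\<Union>u\<in>set (snd P). \<Union>n\<in>{..nat \<lfloor>r\<rfloor>}. {v. (u, v) \<in> adj_rel (fst P) ^^ n})"
    using fin wf by (auto simp: wf_rooted_def)
  ultimately show ?thesis by (rule finite_subset)
qed

lemma balls_exhaust:
  assumes "P \<in> rooted_graphs k" "0 < k" "v \<in> verts (fst P)"
  shows "\<exists>n. v \<in> ball_verts (real n) P"
proof -
  have "snd P \<noteq> []" "set (snd P) \<subseteq> verts (fst P)" using assms by (auto simp: rooted_graphs_def)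
  then have "hd (snd P) \<in> set (snd P)" "hd (snd P) \<in> verts (fst P)" using hd_in_set by blast+
  moreover from this have "(hd (snd P), v) \<in> (adj_rel (fst P))\<^sup>*"
    using assms by (auto simp: rooted_graphs_def connected_graph_def)
  then obtain n where "(hd (snd P), v) \<in> adj_rel (fst P) ^^ n" using rtrancl_imp_relpow by blast
  ultimately show ?thesis using assms(3) unfolding ball_verts_def by blast
qed

lemma ball_verts_mono: "r \<le> s \<Longrightarrow> ball_verts r P \<subseteq> ball_verts s P"
  unfolding ball_verts_def by force

lemma iso_map_cong:
  assumes "iso_map \<phi> P Q" "\<And>x. x \<in> verts (fst P) \<Longrightarrow> \<psi> x = \<phi> x" "set (snd P) \<subseteq> verts (fst P)"
  shows "iso_map \<psi> P Q"
proof -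
  have "bij_betw \<psi> (verts (fst P)) (verts (fst Q))"
    using assms(1,2) bij_betw_cong[of "verts (fst P)" \<psi> \<phi>] by (auto simp: iso_map_def)
  moreover have "map \<psi> (snd P) = map \<phi> (snd P)" using assms(2,3) by auto
  moreover have "map \<phi> (snd P) = snd Q" using assms(1) by (simp add: iso_map_def)
  ultimately show ?thesis using assms(1,2) by (simp add: iso_map_def)
qed

lemma iso_from_balls:
  assumes P: "P \<in> rooted_graphs k" and Q: "Q \<in> rooted_graphs k" and k: "0 < k"
    and iso: "\<And>n::nat. rooted_iso (rooted_ball (real n) P) (rooted_ball (real n) Q)"
  shows "rooted_iso P Q"
proof -
  have wf: "wf_rooted P" "wf_rooted Q" using P Q wf_rooted_graphs by blast+
  define B where "B n = ball_verts (real n) P" for n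
  define C where "C n = ball_verts (real n) Q" for n
  define I where "I n = {\<phi> \<in> B n \<rightarrow>\<^sub>E C n. iso_map \<phi> (rooted_ball (real n) P) (rooted_ball (real n) Q)}" for n
  have roots: "set (snd P) \<subseteq> B n" for n using roots_in_ball[OF wf(1)] unfolding B_def by simp
  have Bmono: "B n \<subseteq> B m" and Cmono: "C n \<subseteq> C m" if "n \<le> m" for n m
    using that unfolding B_def C_def by (simp_all add: ball_verts_mono)
  have restr: "restrict \<phi> (B n) \<in> I n"
    if "iso_map \<phi> (rooted_ball (real n) P) (rooted_ball (real n) Q)" for \<phi> n
  proof -
    have "iso_map (restrict \<phi> (B n)) (rooted_ball (real n) P) (rooted_ball (real n) Q)"
      by (rule iso_map_cong[OF that]) (use roots in \<open>auto simp: B_def\<close>)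
    moreover have "\<phi> \<in> B n \<rightarrow> C n"
      using that by (auto simp: iso_map_def bij_betw_def B_def C_def)
    ultimately show ?thesis unfolding I_def by auto
  qed
  have restr': "restrict \<phi> (B n) \<in> I n" if "\<phi> \<in> I m" "n \<le> m" for \<phi> n m
  proof (rule restr)
    have "iso_map \<phi> (rooted_ball (real m) P) (rooted_ball (real m) Q)" using that by (simp add: I_def)
    from iso_map_ball[OF this, of "real n"] wf that(2)
    show "iso_map \<phi> (rooted_ball (real n) P) (rooted_ball (real n) Q)"
      by (simp add: wf_rooted_ball ball_of_ball)
  qed
  have finI: "finite (I n)" for n
    unfolding I_def B_def C_def Collect_conj_eq Collect_mem_eq
    by (intro finite_Int disjI1 finite_PiE finite_ball[OF P] finite_ball[OF Q])
  have neI: "\<exists>\<phi>. \<phi> \<in> I n" for n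
    using iso[of n] restr unfolding rooted_iso_iff by blast
  define good where "good n \<phi> \<longleftrightarrow> \<phi> \<in> I n \<and> (\<forall>m\<ge>n. \<exists>\<psi>\<in>I m. restrict \<psi> (B n) = \<phi>)" for n \<phi>
  have select: "\<exists>\<phi>\<in>S. good n \<phi>"
    if S: "S \<subseteq> I n" and ext: "\<And>m. m \<ge> n \<Longrightarrow> \<exists>\<psi>\<in>I m. restrict \<psi> (B n) \<in> S" for S n
  proof (rule ccontr)
    assume "\<not> ?thesis"
    then have "\<forall>\<phi>\<in>S. \<exists>m\<ge>n. \<forall>\<psi>\<in>I m. restrict \<psi> (B n) \<noteq> \<phi>"
      using S unfolding good_def by blast
    then obtain h where h: "\<And>\<phi>. \<phi> \<in> S \<Longrightarrow> h \<phi> \<ge> n \<and> (\<forall>\<psi>\<in>I (h \<phi>). restrict \<psi> (B n) \<noteq> \<phi>)"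
      by metis
    define m where "m = Max (insert n (h ` S))"
    have fS: "finite S" using S finI finite_subset by blast
    then have m: "n \<le> m" "\<And>\<phi>. \<phi> \<in> S \<Longrightarrow> h \<phi> \<le> m" by (auto simp: m_def)
    obtain \<psi> where \<psi>: "\<psi> \<in> I m" "restrict \<psi> (B n) \<in> S" using ext m(1) by blast
    let ?\<phi> = "restrict \<psi> (B n)"
    have "restrict \<psi> (B (h ?\<phi>)) \<in> I (h ?\<phi>)" using restr' \<psi> m(2) by blast
    moreover have "restrict (restrict \<psi> (B (h ?\<phi>))) (B n) = ?\<phi>"
      using Bmono[of n "h ?\<phi>"] h[OF \<psi>(2)] by (auto simp: restrict_def fun_eq_iff)
    ultimately show False using h[OF \<psi>(2)] by blast
  qed
  have "\<exists>f. \<forall>n. good n (f n) \<and> restrict (f (Suc n)) (B n) = f n"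
  proof (rule dependent_nat_choice)
    show "\<exists>\<phi>. good 0 \<phi>"
      using select[of "I 0" 0] neI restr' by (meson order_refl zero_le)
  next
    fix \<phi> n assume g: "good n \<phi>"
    let ?S = "{\<phi>' \<in> I (Suc n). restrict \<phi>' (B n) = \<phi>}"
    have "\<exists>\<psi>\<in>I m. restrict \<psi> (B (Suc n)) \<in> ?S" if m: "m \<ge> Suc n" for m
    proof -
      obtain \<psi> where \<psi>: "\<psi> \<in> I m" "restrict \<psi> (B n) = \<phi>"
        using g m unfolding good_def by (meson Suc_leD)
      have "restrict (restrict \<psi> (B (Suc n))) (B n) = \<phi>"
        using Bmono[of n "Suc n"] unfolding \<psi>(2)[symmetric] by (auto simp: restrict_def fun_eq_iff)
      then show ?thesis using \<psi>(1) restr'[OF \<psi>(1) m] by blast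
    qed
    then show "\<exists>\<phi>'. good (Suc n) \<phi>' \<and> restrict \<phi>' (B n) = \<phi>"
      using select[of ?S "Suc n"] by blast
  qed
  then obtain f where f: "\<And>n. f n \<in> I n" "\<And>n. restrict (f (Suc n)) (B n) = f n"
    unfolding good_def by blast
  have step: "f (n + j) x = f n x" if "x \<in> B n" for n j x
  proof (induction j)
    case (Suc j)
    have "x \<in> B (n + j)" using that Bmono[of n "n + j"] by auto
    then show ?case using Suc f(2)[of "n + j"] by (metis add_Suc_right restrict_apply')
  qed simp
  define \<Phi> where "\<Phi> x = f (LEAST n. x \<in> B n) x" for x
  have \<Phi>: "\<Phi> x = f n x" if "x \<in> B n" for x n
  proof -
    have "(LEAST n. x \<in> B n) \<le> n" "x \<in> B (LEAST n. x \<in> B n)"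
      using that by (auto intro: Least_le LeastI)
    then show ?thesis using step unfolding \<Phi>_def by (metis le_Suc_ex)
  qed
  have isoB: "iso_map \<Phi> (rooted_ball (real n) P) (rooted_ball (real n) Q)" for n
    by (rule iso_map_cong[of "f n"]) (use f(1) \<Phi> roots in \<open>auto simp: I_def B_def\<close>)
  have common: "\<exists>n. x \<in> B n \<and> y \<in> B n" if xy: "x \<in> verts (fst P)" "y \<in> verts (fst P)" for x y
  proof -
    obtain i j where "x \<in> B i" "y \<in> B j" using balls_exhaust[OF P k] xy unfolding B_def by blast
    then show ?thesis using Bmono[of i "max i j"] Bmono[of j "max i j"] by auto
  qed
  have bijB: "bij_betw \<Phi> (B n) (C n)" for n using isoB[of n] by (simp add: iso_map_def B_def C_def)
  have "inj_on \<Phi> (verts (fst P))"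
  proof (rule inj_onI)
    fix x y assume *: "x \<in> verts (fst P)" "y \<in> verts (fst P)" "\<Phi> x = \<Phi> y"
    then obtain n where "x \<in> B n" "y \<in> B n" using common by blast
    then show "x = y" using bijB[of n] * by (auto simp: bij_betw_def inj_on_def)
  qed
  moreover have "\<Phi> ` verts (fst P) = verts (fst Q)"
  proof (intro equalityI subsetI)
    fix y assume "y \<in> \<Phi> ` verts (fst P)"
    then obtain x n where "y = \<Phi> x" "x \<in> B n" using common by blast
    then have "y \<in> C n" using bijB by (auto simp: bij_betw_def)
    then show "y \<in> verts (fst Q)" using ball_verts_subset[of "real n" Q] unfolding C_def by blast
  next
    fix y assume "y \<in> verts (fst Q)"
    then obtain n where "y \<in> C n" using balls_exhaust[OF Q k] unfolding C_def by blast
    then obtain x where "x \<in> B n" "y = \<Phi> x" using bijB[of n] by (auto simp: bij_betw_def)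
    then show "y \<in> \<Phi> ` verts (fst P)" using \<open>x \<in> B n\<close> ball_verts_subset[of "real n" P] unfolding B_def by blast
  qed
  moreover have "{x, y} \<in> edges (fst P) \<longleftrightarrow> {\<Phi> x, \<Phi> y} \<in> edges (fst Q)"
    if xy: "x \<in> verts (fst P)" "y \<in> verts (fst P)" for x y
  proof -
    obtain n where n: "x \<in> B n" "y \<in> B n" using common xy by blast
    then have "\<Phi> x \<in> C n" "\<Phi> y \<in> C n" using bijB by (auto simp: bij_betw_def)
    then show ?thesis using n isoB[of n] by (simp add: iso_map_def B_def C_def)
  qed
  moreover have "map \<Phi> (snd P) = snd Q" using isoB[of 0] by (simp add: iso_map_def)
  ultimately have "iso_map \<Phi> P Q" by (simp add: iso_map_def bij_betw_def)
  moreover have "set (snd P) \<subseteq> verts (fst P)" using wf(1) by (simp add: wf_rooted_def)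
  ultimately show ?thesis unfolding rooted_iso_iff by blast
qed

lemma agreement_radius_commute: "agreement_radius P Q = agreement_radius Q P"
  unfolding agreement_radius_def by (metis (lifting) rooted_iso_sym)

lemma agreement_radius_triangle:
  assumes "wf_rooted P" "wf_rooted Q" "wf_rooted R"
  shows "min (agreement_radius P Q) (agreement_radius Q R) \<le> agreement_radius P R"
proof (rule ccontr)
  assume "\<not> ?thesis"
  then have "agreement_radius P R < agreement_radius P Q" "agreement_radius P R < agreement_radius Q R"
    by (simp_all add: not_le)
  then obtain r s where rs: "agreement_radius P R < ennreal r" "0 \<le> r"
      "rooted_iso (rooted_ball r P) (rooted_ball r Q)"
      "agreement_radius P R < ennreal s" "0 \<le> s" "rooted_iso (rooted_ball s Q) (rooted_ball s R)"
    unfolding agreement_radius_def[of P Q] agreement_radius_def[of Q R] less_SUP_iff by blast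
  have "rooted_iso (rooted_ball (min r s) P) (rooted_ball (min r s) R)"
    using rs assms ball_iso_mono[of P Q "min r s" r] ball_iso_mono[of Q R "min r s" s]
      rooted_iso_trans by (metis min.cobounded1 min.cobounded2 min_def)
  then have "ennreal (min r s) \<le> agreement_radius P R"
    unfolding agreement_radius_def using rs by (intro SUP_upper) auto
  then show False using rs by (auto simp: min_def split: if_splits)
qed

lemma agreement_radius_top_iff:
  assumes "P \<in> rooted_graphs k" "Q \<in> rooted_graphs k" "0 < k"
  shows "agreement_radius P Q = top_class.top \<longleftrightarrow> rooted_iso P Q"
proof
  have wf: "wf_rooted P" "wf_rooted Q" using assms wf_rooted_graphs by blast+
  {
    assume top: "agreement_radius P Q = top_class.top"
    show "rooted_iso P Q"
    proof (rule iso_from_balls[OF assms])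
      fix n :: nat
      have "ennreal (real n) < agreement_radius P Q" by (simp add: top)
      then obtain r where "ennreal (real n) < ennreal r" "0 \<le> r"
        "rooted_iso (rooted_ball r P) (rooted_ball r Q)"
        unfolding agreement_radius_def less_SUP_iff by blast
      then show "rooted_iso (rooted_ball (real n) P) (rooted_ball (real n) Q)"
        using ball_iso_mono[OF wf, of "real n" r] by (simp add: ennreal_less_iff)
    qed
  next
    assume "rooted_iso P Q"
    then have ball: "rooted_iso (rooted_ball (real n) P) (rooted_ball (real n) Q)" for n
      using rooted_iso_ball[OF _ wf, of "real n"] by simp
    have "of_nat n \<le> agreement_radius P Q" for n
      unfolding agreement_radius_def ennreal_of_nat_eq_real_of_nat
      using ball by (intro SUP_upper) auto
    then show "agreement_radius P Q = top_class.top"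
      by (metis ennreal_Ex_less_of_nat linorder_not_less top.not_eq_extremum)
  }
qed

lemma Metric_space_rooted_classes:
  assumes "0 < k"
  shows "Metric_space (rooted_classes k) class_dist"
proof
  define g :: "ennreal \<Rightarrow> real" where "g a = enn2real (1 / (1 + a))" for a
  have dist: "class_dist c d = g (agreement_radius (representative c) (representative d))" for c d
    by (simp add: class_dist_def g_def)
  have le1: "1 / (1 + a) \<le> (1::ennreal)" for a :: ennreal
    by (rule divide_le_posI_ennreal) (auto simp: add_pos_nonneg)
  have fin: "1 / (1 + a) < (top_class.top::ennreal)" for a :: ennreal
    using le1[of a] by (meson ennreal_one_less_top le_less_trans)
  have anti: "g b \<le> g a" if ab: "a \<le> b" for a b
  proof (cases "b = top_class.top")
    case True
    then show ?thesis by (simp add: g_def)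
  next
    case False
    then obtain x y where xy: "a = ennreal x" "b = ennreal y" "0 \<le> x" "0 \<le> y"
      using ab by (cases a; cases b) (auto simp: top_unique)
    have g: "g (ennreal t) = 1 / (1 + t)" if "0 \<le> t" for t
    proof -
      have "1 / (1 + ennreal t) = ennreal 1 / ennreal (1 + t)"
        using that by (simp add: ennreal_plus)
      also have "\<dots> = ennreal (1 / (1 + t))" by (rule divide_ennreal) (use that in auto)
      finally show ?thesis using that by (simp add: g_def)
    qed
    show ?thesis using ab xy by (simp add: g frac_le)
  qed
  have zero: "g a = 0 \<longleftrightarrow> a = top_class.top" for a
    unfolding g_def using fin[of a] by (auto simp: enn2real_eq_0_iff ennreal_divide_eq_0_iff)
  show "0 \<le> class_dist c d" for c d by (simp add: class_dist_def)
  show "class_dist c d = class_dist d c" for c d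
    by (simp add: class_dist_def agreement_radius_commute)
  show "class_dist c d = 0 \<longleftrightarrow> c = d" if c: "c \<in> rooted_classes k" and d: "d \<in> rooted_classes k" for c d
  proof -
    have "class_dist c d = 0 \<longleftrightarrow> rooted_iso (representative c) (representative d)"
      using representative_props(2)[OF c] representative_props(2)[OF d] assms
      by (simp add: dist zero agreement_radius_top_iff)
    also have "\<dots> \<longleftrightarrow> (representative c, representative d) \<in> iso_rel k"
      using representative_props(2)[OF c] representative_props(2)[OF d] by (simp add: iso_rel_def)
    also have "\<dots> \<longleftrightarrow> c = d"
      using eq_equiv_class_iff[OF equiv_iso_rel representative_props(2)[OF c] representative_props(2)[OF d]]
        representative_props(3)[OF c] representative_props(3)[OF d] by simp
    finally show ?thesis .
  qed
  show "class_dist c e \<le> class_dist c d + class_dist d e"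
    if "c \<in> rooted_classes k" "d \<in> rooted_classes k" "e \<in> rooted_classes k" for c d e
  proof -
    let ?R = "\<lambda>c d. agreement_radius (representative c) (representative d)"
    have "min (?R c d) (?R d e) \<le> ?R c e"
      by (intro agreement_radius_triangle; rule wf_rooted_graphs; rule representative_props(2)) (fact that)+
    then have "class_dist c e \<le> class_dist c d \<or> class_dist c e \<le> class_dist d e"
      unfolding dist using anti by (auto simp: min_def split: if_splits)
    moreover have "0 \<le> class_dist c d" "0 \<le> class_dist d e" by (simp_all add: class_dist_def)
    ultimately show ?thesis by linarith
  qed
qed

lemma space_rooted_borel:
  assumes "0 < k" shows "space (rooted_borel k) = rooted_classes k"
  and "sets (rooted_borel k) =
    sigma_sets (rooted_classes k) {U. openin (Metric_space.mtopology (rooted_classes k) class_dist) U}"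
proof -
  interpret Metric_space "rooted_classes k" class_dist
    using assms by (rule Metric_space_rooted_classes)
  have "{U. openin mtopology U} \<subseteq> Pow (rooted_classes k)"
    using openin_mtopology by auto
  then show "space (rooted_borel k) = rooted_classes k"
    "sets (rooted_borel k) = sigma_sets (rooted_classes k) {U. openin mtopology U}"
    unfolding rooted_borel_def by (simp_all add: space_measure_of_conv sets_measure_of)
qed

lemma iso_class_props:
  assumes "P \<in> rooted_graphs k"
  shows "iso_class P \<in> rooted_classes k" "rooted_iso P (representative (iso_class P))"
proof -
  have c: "iso_class P = iso_rel k `` {P}"
    using assms by (auto simp: iso_class_def rooted_graphs_def)
  then show "iso_class P \<in> rooted_classes k"
    using assms by (auto simp: rooted_classes_def intro: quotientI)
  from representative_props(1)[OF this] show "rooted_iso P (representative (iso_class P))"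
    unfolding c by (auto simp: iso_rel_def)
qed


section \<open>Unimodular networks\<close>

text \<open>
  Sums over the vertices are integrals against counting measure. Passing to a representative
  of a class is harmless, as the sums only depend on the class.
\<close>

definition mass_sent :: "(nat rooted set \<Rightarrow> ennreal) \<Rightarrow> nat rooted \<Rightarrow> ennreal" where
  "mass_sent f P = (\<integral>\<^sup>+x. f (iso_class (fst P, [hd (snd P), x])) \<partial>count_space (verts (fst P)))"

definition mass_received :: "(nat rooted set \<Rightarrow> ennreal) \<Rightarrow> nat rooted \<Rightarrow> ennreal" where
  "mass_received f P = (\<integral>\<^sup>+x. f (iso_class (fst P, [x, hd (snd P)])) \<partial>count_space (verts (fst P)))"

definition unimodular_network :: "nat rooted set measure \<Rightarrow> bool" where
  "unimodular_network L \<longleftrightarrow> prob_space L \<and> sets L = sets (rooted_borel 1) \<and>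
     (\<forall>f\<in>borel_measurable (rooted_borel 2).
        (\<integral>\<^sup>+c. mass_sent f (representative c) \<partial>L) = (\<integral>\<^sup>+c. mass_received f (representative c) \<partial>L))"

definition concentrated_on_trees :: "nat set \<Rightarrow> nat rooted set measure \<Rightarrow> bool" where
  "concentrated_on_trees D L \<longleftrightarrow>
     (AE c in L. tree_graph (fst (representative c)) \<and>
        (\<forall>x\<in>verts (fst (representative c)). vertex_degree (fst (representative c)) x \<in> D))"


section \<open>Operators on square-summable functions\<close>

text \<open>
  The Hilbert space over the index set \<open>V\<close> consists of the square-summable functions vanishing
  outside \<open>V\<close>. An unbounded operator is represented by its graph, a set of pairs of vectors.
\<close>

definition l2_space :: "'v set \<Rightarrow> ('v \<Rightarrow> complex) set" where
  "l2_space V = {f. (\<forall>x. x \<notin> V \<longrightarrow> f x = 0) \<and> (\<lambda>x. (cmod (f x))\<^sup>2) summable_on V}"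

definition l2_inner :: "('v \<Rightarrow> complex) \<Rightarrow> ('v \<Rightarrow> complex) \<Rightarrow> complex" where
  "l2_inner f g = (\<Sum>\<^sub>\<infinity>x. cnj (f x) * g x)"

definition l2_norm :: "('v \<Rightarrow> complex) \<Rightarrow> real" where
  "l2_norm f = sqrt (\<Sum>\<^sub>\<infinity>x. (cmod (f x))\<^sup>2)"

definition basis_vec :: "'v \<Rightarrow> 'v \<Rightarrow> complex" where
  "basis_vec x y = (if y = x then 1 else 0)"

type_synonym 'v operator = "(('v \<Rightarrow> complex) \<times> ('v \<Rightarrow> complex)) set"

definition op_closure :: "'v set \<Rightarrow> 'v operator \<Rightarrow> 'v operator" where
  "op_closure V T = {(f, g). f \<in> l2_space V \<and> g \<in> l2_space V \<and>
     (\<forall>\<epsilon>>0. \<exists>(f', g')\<in>T. l2_norm (\<lambda>x. f' x - f x) < \<epsilon> \<and> l2_norm (\<lambda>x. g' x - g x) < \<epsilon>)}"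

definition op_adjoint :: "'v set \<Rightarrow> 'v operator \<Rightarrow> 'v operator" where
  "op_adjoint V T = {(g, h). g \<in> l2_space V \<and> h \<in> l2_space V \<and>
     (\<forall>(f, k)\<in>T. l2_inner g k = l2_inner h f)}"

definition self_adjoint_op :: "'v set \<Rightarrow> 'v operator \<Rightarrow> bool" where
  "self_adjoint_op V T \<longleftrightarrow> op_adjoint V T = T"

definition essentially_self_adjoint :: "'v set \<Rightarrow> 'v operator \<Rightarrow> bool" where
  "essentially_self_adjoint V T \<longleftrightarrow> self_adjoint_op V (op_closure V T)"

text \<open>The value \<open>(T - z)\<^sup>-\<^sup>1 g\<close> is the vector \<open>f\<close> in the domain of \<open>T\<close> with \<open>T f = g + z f\<close>.\<close>

definition op_resolvent :: "'v operator \<Rightarrow> complex \<Rightarrow> ('v \<Rightarrow> complex) \<Rightarrow> 'v \<Rightarrow> complex" where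
  "op_resolvent T z g = (THE f. (f, \<lambda>x. g x + z * f x) \<in> T)"


section \<open>Spectral measures\<close>

definition adjacency_op :: "'v graph \<Rightarrow> 'v operator" where
  "adjacency_op G = {(f, \<lambda>x. \<Sum>y | f y \<noteq> 0. adj_entry G x y * f y) | f.
     finite {x. f x \<noteq> 0} \<and> {x. f x \<noteq> 0} \<subseteq> verts G}"

definition self_adjoint_graph :: "'v graph \<Rightarrow> bool" where
  "self_adjoint_graph G \<longleftrightarrow> essentially_self_adjoint (verts G) (adjacency_op G)"

text \<open>For a self-adjoint graph, the resolvent is that of the self-adjoint closure.\<close>

definition is_spectral_measure :: "'v graph \<Rightarrow> 'v \<Rightarrow> real measure \<Rightarrow> bool" where
  "is_spectral_measure G v \<mu> \<longleftrightarrow> prob_space \<mu> \<and> sets \<mu> = sets borel \<and>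
     (\<forall>z. Im z \<noteq> 0 \<longrightarrow>
        l2_inner (basis_vec v) (op_resolvent (op_closure (verts G) (adjacency_op G)) z (basis_vec v))
          = (\<integral>\<xi>. 1 / (complex_of_real \<xi> - z) \<partial>\<mu>))"

text \<open>Graphs that are not self-adjoint have probability zero and get the null measure.\<close>

definition spectral_measure :: "'v graph \<Rightarrow> 'v \<Rightarrow> real measure" where
  "spectral_measure G v =
     (if self_adjoint_graph G then (THE \<mu>. is_spectral_measure G v \<mu>) else null_measure borel)"

definition mean_spectral_measure :: "nat rooted set measure \<Rightarrow> real set \<Rightarrow> ennreal" where
  "mean_spectral_measure L B =
     (\<integral>\<^sup>+c. emeasure (spectral_measure (fst (representative c)) (hd (snd (representative c)))) B \<partial>L)"

definition pp_support :: "nat rooted set measure \<Rightarrow> real set" where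
  "pp_support L = {t. 0 < mean_spectral_measure L {t}}"


section \<open>Totally real algebraic integers and tree-complexity\<close>

definition totally_real_algebraic_integers :: "real set" where
  "totally_real_algebraic_integers = {t. \<exists>p::int poly. lead_coeff p = 1 \<and>
     poly (map_poly real_of_int p) t = 0 \<and>
     (\<forall>z::complex. poly (map_poly of_int p) z = 0 \<longrightarrow> z \<in> \<real>)}"

definition adjacency_matrix :: "nat \<Rightarrow> nat graph \<Rightarrow> real mat" where
  "adjacency_matrix n G = mat n n (\<lambda>(i, j). adj_entry G i j)"

definition tree_complexity :: "real \<Rightarrow> nat" where
  "tree_complexity t =
     (LEAST n. \<exists>G. tree_graph G \<and> verts G = {..<n} \<and> eigenvalue (adjacency_matrix n G) t)"

end

theory Submission
  imports Defs
begin

text \<open>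
  Fix \<open>t\<close> and let \<open>P\<close> be the projection onto the eigenspace of \<open>A\<close> at \<open>t\<close>, so that the atom of the
  spectral measure at \<open>o\<close> has mass \<open>P\<^sub>o\<^sub>o\<close>. Cutting an edge of the tree shows that the eigenspace
  restricts to a line on every component (block) of \<open>S = {x. P\<^sub>x\<^sub>x > 0}\<close>, and that every vertex \<open>y\<close> of the
  outer boundary \<open>\<partial>S\<close> carries a vector \<open>s\<^sub>y\<close> orthogonal to the eigenspace with \<open>(A - t) s\<^sub>y = e\<^sub>y\<close>. It
  is nonnegative on the neighbours of \<open>y\<close>, where it sums up to \<open>1\<close>, and every finite block \<open>K\<close> satisfies
  \<open>\<Sum>\<^sub>x\<^sub>\<in>\<^sub>K P\<^sub>x\<^sub>x + \<Sum>\<^sub>x\<^sub>\<in>\<^sub>K \<Sum>\<^sub>y s\<^sub>y(x) = 1\<close>, with \<open>y\<close> ranging over the neighbours of \<open>x\<close> in \<open>\<partial>S\<close>.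

  By mass transport almost all blocks are finite. A finite block has at least \<open>(\<delta> - 2) |K| + 2\<close>
  boundary edges. If this were always at least \<open>\<Delta>\<close>, transporting masses from blocks to their
  boundaries would give \<open>\<Delta> \<E>[P\<^sub>o\<^sub>o + 1\<^sub>o\<^sub>\<in>\<^sub>\<partial>\<^sub>S] \<le> \<Delta> \<E>[1\<^sub>o\<^sub>\<in>\<^sub>\<partial>\<^sub>S]\<close>, so \<open>t\<close> would not be an atom. Hence some block
  satisfies \<open>(\<delta> - 2) |K| + 2 < \<Delta>\<close>; it is a finite tree with eigenvalue \<open>t\<close>.
\<close>

section \<open>Real square-summable sequences\<close>

text \<open>The spectral measure enters at one point only: if \<open>P_oo = 0\<close>, then
  \<open>b\<close> times the imaginary part of the resolvent at \<open>t + i b\<close> tends to 0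
  with \<open>b\<close>, which excludes an atom. The rest concerns the kernel of
  \<open>M = A - t\<close>. \<open>P\<close> and the \<open>s_y\<close> must be Borel in the graph.
  Both come from powers of \<open>B = 1 - M^2 / C\<close>: these converge to \<open>P\<close>, and
  the sums of \<open>M B^k / C\<close> invert \<open>M\<close> off its kernel. Every finite stage
  depends on a ball only. The vector \<open>s_y\<close> is an eigenvector cut off at an edge at
  \<open>y\<close>, scaled, and made orthogonal to the eigenspace. The block identity expands a
  truncated eigenvector into its projection and the \<open>s_y\<close>, and reads the result at one
  vertex. Origin of the constant: a tree on \<open>k\<close> vertices has \<open>k - 1\<close>
  edges, so at least \<open>\<delta> k - 2 (k - 1)\<close> edges leave it, while a boundary vertex
  receives total mass 1 from the \<open>s_y\<close> but has at most \<open>\<Delta>\<close> edges.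
  No vertex of a block is distinguished. A block therefore acts through all its vertices, with
  weights proportional to \<open>P_xx\<close>; these have finite sum even on infinite
  blocks.\<close>

typedef ell2 = "{f :: nat \<Rightarrow> real. summable (\<lambda>n. (f n)\<^sup>2)}"
  morphisms coord Abs_ell2
  by (rule exI[of _ "\<lambda>_. 0"]) simp

setup_lifting type_definition_ell2

lemma summable_coord_sq: "summable (\<lambda>n. (coord u n)\<^sup>2)"
  using coord[of u] by simp

lemma summable_mult_sq:
  fixes f g :: "nat \<Rightarrow> real"
  assumes "summable (\<lambda>n. (f n)\<^sup>2)" "summable (\<lambda>n. (g n)\<^sup>2)"
  shows "summable (\<lambda>n. f n * g n)"
proof (rule summable_comparison_test')
  show "summable (\<lambda>n. (f n)\<^sup>2 + (g n)\<^sup>2)" using assms by (rule summable_add)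
  show "norm (f n * g n) \<le> (f n)\<^sup>2 + (g n)\<^sup>2" for n
  proof -
    have "2 * \<bar>f n\<bar> * \<bar>g n\<bar> \<le> (f n)\<^sup>2 + (g n)\<^sup>2"
      using sum_squares_bound[of "\<bar>f n\<bar>" "\<bar>g n\<bar>"] by simp
    moreover have "0 \<le> \<bar>f n\<bar> * \<bar>g n\<bar>" by simp
    ultimately have "\<bar>f n\<bar> * \<bar>g n\<bar> \<le> (f n)\<^sup>2 + (g n)\<^sup>2" by linarith
    then show ?thesis by (simp add: abs_mult)
  qed
qed

lemma summable_coord_mult: "summable (\<lambda>n. coord u n * coord v n)"
  by (intro summable_mult_sq summable_coord_sq)

instantiation ell2 :: real_inner
begin

lift_definition zero_ell2 :: ell2 is "\<lambda>_. 0" by simp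

lift_definition plus_ell2 :: "ell2 \<Rightarrow> ell2 \<Rightarrow> ell2" is "\<lambda>f g n. f n + g n"
proof -
  fix f g :: "nat \<Rightarrow> real"
  assume fg: "summable (\<lambda>n. (f n)\<^sup>2)" "summable (\<lambda>n. (g n)\<^sup>2)"
  have "summable (\<lambda>n. (f n)\<^sup>2 + (g n)\<^sup>2 + 2 * (f n * g n))"
    by (rule summable_add[OF summable_add[OF fg] summable_mult[OF summable_mult_sq[OF fg]]])
  then show "summable (\<lambda>n. (f n + g n)\<^sup>2)" by (simp only: power2_sum mult.assoc)
qed

lift_definition uminus_ell2 :: "ell2 \<Rightarrow> ell2" is "\<lambda>f n. - f n" by simp

lift_definition minus_ell2 :: "ell2 \<Rightarrow> ell2 \<Rightarrow> ell2" is "\<lambda>f g n. f n - g n"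
proof -
  fix f g :: "nat \<Rightarrow> real"
  assume fg: "summable (\<lambda>n. (f n)\<^sup>2)" "summable (\<lambda>n. (g n)\<^sup>2)"
  have "summable (\<lambda>n. (f n)\<^sup>2 + (g n)\<^sup>2 - 2 * (f n * g n))"
    by (rule summable_diff[OF summable_add[OF fg] summable_mult[OF summable_mult_sq[OF fg]]])
  then show "summable (\<lambda>n. (f n - g n)\<^sup>2)" by (simp only: power2_diff mult.assoc)
qed

lift_definition scaleR_ell2 :: "real \<Rightarrow> ell2 \<Rightarrow> ell2" is "\<lambda>r f n. r * f n"
  by (simp add: power_mult_distrib summable_mult)

lift_definition inner_ell2 :: "ell2 \<Rightarrow> ell2 \<Rightarrow> real" is "\<lambda>f g. \<Sum>n. f n * g n" .

definition norm_ell2 :: "ell2 \<Rightarrow> real" where "norm_ell2 u = sqrt (inner u u)"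
definition sgn_ell2 :: "ell2 \<Rightarrow> ell2" where "sgn_ell2 u = scaleR (inverse (norm u)) u"
definition dist_ell2 :: "ell2 \<Rightarrow> ell2 \<Rightarrow> real" where "dist_ell2 u v = norm (u - v)"
definition uniformity_ell2 :: "(ell2 \<times> ell2) filter" where
  "uniformity_ell2 = (INF e\<in>{0<..}. principal {(x, y). dist x y < e})"
definition open_ell2 :: "ell2 set \<Rightarrow> bool" where
  "open_ell2 U = (\<forall>x\<in>U. eventually (\<lambda>(x', y). x' = x \<longrightarrow> y \<in> U) uniformity)"

instance
proof
  fix u v w :: ell2 and a b :: real
  show "u + v + w = u + (v + w)" by transfer (simp add: add.assoc)
  show "u + v = v + u" by transfer (simp add: add.commute)
  show "0 + u = u" by transfer simp
  show "- u + u = 0" by transfer simp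
  show "u - v = u + - v" by transfer simp
  show "a *\<^sub>R (u + v) = a *\<^sub>R u + a *\<^sub>R v" by transfer (simp add: distrib_left)
  show "(a + b) *\<^sub>R u = a *\<^sub>R u + b *\<^sub>R u" by transfer (simp add: distrib_right)
  show "a *\<^sub>R b *\<^sub>R u = (a * b) *\<^sub>R u" by transfer (simp add: mult.assoc)
  show "1 *\<^sub>R u = u" by transfer simp
  show "inner u v = inner v u" by transfer (simp add: mult.commute)
  show "inner (u + v) w = inner u w + inner v w"
    by transfer (simp add: distrib_right suminf_add summable_mult_sq)
  show "inner (a *\<^sub>R u) v = a * inner u v"
    by transfer (simp add: mult.assoc suminf_mult summable_mult_sq)
  show "0 \<le> inner u u"
    by transfer (rule suminf_nonneg, auto intro: summable_mult_sq)
  show "inner u u = 0 \<longleftrightarrow> u = 0"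
    by transfer (subst suminf_eq_zero_iff, auto intro: summable_mult_sq)
  show "norm u = sqrt (inner u u)" by (rule norm_ell2_def)
  show "sgn u = inverse (norm u) *\<^sub>R u" by (rule sgn_ell2_def)
  show "dist u v = norm (u - v)" by (rule dist_ell2_def)
  show "uniformity = (INF e\<in>{0<..}. principal {(x, y). dist (x :: ell2) y < e})"
    by (rule uniformity_ell2_def)
  show "open U = (\<forall>x\<in>U. \<forall>\<^sub>F (x', y) in uniformity. x' = x \<longrightarrow> y \<in> U)" for U :: "ell2 set"
    by (rule open_ell2_def)
qed

end

lemma coord_simps [simp]:
  "coord 0 = (\<lambda>_. 0)" "coord (u + v) = (\<lambda>n. coord u n + coord v n)"
  "coord (- u) = (\<lambda>n. - coord u n)" "coord (u - v) = (\<lambda>n. coord u n - coord v n)"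
  "coord (a *\<^sub>R u) = (\<lambda>n. a * coord u n)"
  by (transfer; simp)+

lemma coord_sum: "coord (\<Sum>i\<in>I. f i) n = (\<Sum>i\<in>I. coord (f i) n)"
  by (induction I rule: infinite_finite_induct) simp_all

lemma ell2_eqI: "(\<And>n. coord u n = coord v n) \<Longrightarrow> u = v"
  by (metis coord_inject ext)

lemma inner_ell2_sums: "(\<lambda>n. coord u n * coord v n) sums inner u v"
  unfolding inner_ell2.rep_eq by (rule summable_sums[OF summable_coord_mult])

lemma norm_ell2_sums: "(\<lambda>n. (coord u n)\<^sup>2) sums (norm u)\<^sup>2"
  unfolding power2_norm_eq_inner using inner_ell2_sums[of u u] by (simp add: power2_eq_square)

lemma sum_coord_sq_le: "finite F \<Longrightarrow> (\<Sum>n\<in>F. (coord u n)\<^sup>2) \<le> (norm u)\<^sup>2"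
  unfolding sums_unique[OF norm_ell2_sums[of u]]
  by (rule sum_le_suminf[OF summable_coord_sq[of u]]) simp_all

text \<open>Bounded partial sums give membership and the norm bound at once; completeness and the
  adjacency operator are both obtained this way.\<close>

lemma ell2_boundedI:
  assumes "\<And>N. (\<Sum>n<N. (f n)\<^sup>2) \<le> c\<^sup>2" "0 \<le> c"
  shows "\<exists>u. coord u = f \<and> norm u \<le> c"
proof -
  have s: "summable (\<lambda>n. (f n)\<^sup>2)"
    using assms(1) by (intro bounded_imp_summable[of _ "c\<^sup>2"]) (auto simp only: zero_le_power2 simp flip: lessThan_Suc_atMost)
  then obtain u where u: "coord u = f" using Abs_ell2_inverse by blast
  have "(norm u)\<^sup>2 \<le> c\<^sup>2"
    using sums_unique[OF norm_ell2_sums[of u]] suminf_le_const[OF s] assms(1) u by simp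
  then show ?thesis using u assms(2) power2_le_imp_le by blast
qed

lemma abs_coord_le: "\<bar>coord u n\<bar> \<le> norm u"
proof -
  have "(\<Sum>k\<in>{n}. (coord u k)\<^sup>2) \<le> (norm u)\<^sup>2" by (rule sum_coord_sq_le) simp
  then have "sqrt ((coord u n)\<^sup>2) \<le> sqrt ((norm u)\<^sup>2)" by (intro real_sqrt_le_mono) auto
  then show ?thesis by (simp only: real_sqrt_abs abs_norm_cancel)
qed

lemma bounded_linear_coord: "bounded_linear (\<lambda>u. coord u n)"
  by (rule bounded_linear_intro[where K = 1]) (auto simp: abs_coord_le)

lemmas tendsto_coord = bounded_linear.tendsto[OF bounded_linear_coord]

instance ell2 :: complete_space
proof
  fix X :: "nat \<Rightarrow> ell2"
  assume X: "Cauchy X"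
  have "convergent (\<lambda>k. coord (X k) n)" for n
    using bounded_linear.Cauchy[OF bounded_linear_coord X] by (rule Cauchy_convergent)
  then obtain f where f: "\<And>n. (\<lambda>k. coord (X k) n) \<longlonglongrightarrow> f n" unfolding convergent_def by metis
  have close: "\<exists>u. coord u = (\<lambda>n. coord (X m) n - f n) \<and> norm u \<le> e"
    if e: "0 < e" and N: "\<And>k. k \<ge> N \<Longrightarrow> norm (X m - X k) < e" for e m N
  proof (rule ell2_boundedI)
    fix M
    have "(\<lambda>k. \<Sum>n<M. (coord (X m) n - coord (X k) n)\<^sup>2) \<longlonglongrightarrow> (\<Sum>n<M. (coord (X m) n - f n)\<^sup>2)"
      by (intro tendsto_intros f)
    moreover have "(\<Sum>n<M. (coord (X m) n - coord (X k) n)\<^sup>2) \<le> e\<^sup>2" if "k \<ge> N" for k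
    proof -
      have "(\<Sum>n<M. (coord (X m) n - coord (X k) n)\<^sup>2) \<le> (norm (X m - X k))\<^sup>2"
        using sum_coord_sq_le[of "{..<M}" "X m - X k"] by simp
      also have "\<dots> \<le> e\<^sup>2" using N[OF that] by (intro power_mono) auto
      finally show ?thesis .
    qed
    ultimately show "(\<Sum>n<M. (coord (X m) n - f n)\<^sup>2) \<le> e\<^sup>2"
      by (intro LIMSEQ_le_const2) auto
  qed (use e in simp)
  obtain N where "\<forall>m\<ge>N. \<forall>k\<ge>N. norm (X m - X k) < 1"
    using CauchyD[OF X, of 1] by force
  then have "\<exists>u. coord u = (\<lambda>n. coord (X N) n - f n) \<and> norm u \<le> 1"
    by (intro close[of 1 N N]) simp_all
  then obtain u where u: "coord u = (\<lambda>n. coord (X N) n - f n)" by blast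
  \<comment> \<open>Only differences from the sequence are known to be square-summable, so the limit
    is recovered as \<open>X N\<close> minus one of them.\<close>
  define v where "v = X N - u"
  have v: "coord v = f" by (simp add: v_def u)
  have "X \<longlonglongrightarrow> v"
  proof (rule LIMSEQ_I)
    fix e :: real assume e: "0 < e"
    then obtain N where N: "\<forall>m\<ge>N. \<forall>k\<ge>N. norm (X m - X k) < e / 2"
      using CauchyD[OF X half_gt_zero[OF e]] by blast
    have "norm (X m - v) < e" if m: "m \<ge> N" for m
    proof -
      have "\<exists>w. coord w = (\<lambda>n. coord (X m) n - f n) \<and> norm w \<le> e / 2"
        by (rule close[of "e / 2" N m]) (use N m e in simp_all)
      then obtain w where w: "coord w = (\<lambda>n. coord (X m) n - f n)" "norm w \<le> e / 2"
        by blast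
      have "w = X m - v" by (rule ell2_eqI) (simp add: w v)
      then show ?thesis using w e by simp
    qed
    then show "\<exists>N. \<forall>m\<ge>N. norm (X m - v) < e" by blast
  qed
  then show "convergent X" by (auto simp: convergent_def)
qed

lift_definition delta_vec :: "nat \<Rightarrow> ell2" is "\<lambda>x n. if n = x then 1 else 0"
  by (rule summable_finite[of "{x}" for x]) auto

lemma coord_delta_vec [simp]: "coord (delta_vec x) n = (if n = x then 1 else 0)"
  by transfer simp

lemma inner_delta_vec [simp]: "inner (delta_vec x) u = coord u x" "inner u (delta_vec x) = coord u x"
proof -
  have "(\<lambda>n. coord (delta_vec x) n * coord u n) sums coord u x"
    using sums_single[of x "coord u"] by (simp add: if_distrib if_distribR cong: if_cong)
  then show "inner (delta_vec x) u = coord u x" using inner_ell2_sums sums_unique2 by blast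
  then show "inner u (delta_vec x) = coord u x" by (simp add: inner_commute)
qed

lemma norm_delta_vec [simp]: "norm (delta_vec x) = 1"
  by (simp add: norm_eq_sqrt_inner)

lift_definition restr :: "nat set \<Rightarrow> ell2 \<Rightarrow> ell2" is "\<lambda>S f n. if n \<in> S then f n else 0"
  by (rule summable_comparison_test', assumption) auto

lemma coord_restr [simp]: "coord (restr S u) n = (if n \<in> S then coord u n else 0)"
  by transfer simp

lemma norm_restr_le: "norm (restr S u) \<le> norm u"
proof -
  have "(norm (restr S u))\<^sup>2 \<le> (norm u)\<^sup>2"
    by (rule sums_le[OF _ norm_ell2_sums norm_ell2_sums]) auto
  then show ?thesis by (simp add: abs_le_square_iff)
qed

lemma bounded_linear_restr: "bounded_linear (restr S)"
  by (rule bounded_linear_intro[where K = 1]) (auto intro!: ell2_eqI simp: norm_restr_le)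

lemma inner_restr: "inner (restr S u) v = inner u (restr S v)"
proof -
  have "(\<lambda>n. coord (restr S u) n * coord v n) = (\<lambda>n. coord u n * coord (restr S v) n)" by auto
  then show ?thesis using inner_ell2_sums sums_unique2 by metis
qed

lemma restr_finite: "finite S \<Longrightarrow> restr S u = (\<Sum>x\<in>S. coord u x *\<^sub>R delta_vec x)"
  by (rule ell2_eqI) (simp add: coord_sum if_distrib cong: if_cong)

text \<open>Pythagoras: the squared error is the tail of the series for
  \<open>(norm u)^2\<close>.\<close>

lemma restr_tendsto:
  shows "(\<lambda>n. restr {..<n} u) \<longlonglongrightarrow> u"
proof -
  have "(norm (u - restr {..<n} u))\<^sup>2 = (norm u)\<^sup>2 - (\<Sum>k<n. (coord u k)\<^sup>2)" for n
  proof -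
    have "inner u (restr {..<n} u) = (\<Sum>k<n. (coord u k)\<^sup>2)"
      by (simp add: restr_finite inner_sum_right power2_eq_square)
    moreover have "inner (restr {..<n} u) (restr {..<n} u) = inner u (restr {..<n} u)"
      by (subst inner_restr) (rule arg_cong[where f = "inner u"], rule ell2_eqI, simp)
    ultimately show ?thesis
      by (simp add: power2_norm_eq_inner inner_diff_left inner_diff_right inner_commute)
  qed
  moreover have "(\<lambda>n. (norm u)\<^sup>2 - (\<Sum>k<n. (coord u k)\<^sup>2)) \<longlonglongrightarrow> (norm u)\<^sup>2 - (norm u)\<^sup>2"
    using norm_ell2_sums[of u] unfolding sums_def by (intro tendsto_intros)
  ultimately have "(\<lambda>n. (norm (u - restr {..<n} u))\<^sup>2) \<longlonglongrightarrow> 0" by simp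
  then have "(\<lambda>n. sqrt ((norm (u - restr {..<n} u))\<^sup>2)) \<longlonglongrightarrow> sqrt 0" by (rule tendsto_real_sqrt)
  then have "(\<lambda>n. norm (u - restr {..<n} u)) \<longlonglongrightarrow> 0" by simp
  then have "(\<lambda>n. norm (restr {..<n} u - u)) \<longlonglongrightarrow> 0" by (simp add: norm_minus_commute)
  then show ?thesis using LIM_zero_iff tendsto_norm_zero_iff by blast
qed

section \<open>Bounded self-adjoint operators\<close>

text \<open>\<open>M\<close> stands for \<open>A - t\<close> and \<open>C\<close> for a bound on the
  squared operator norm. Scalars stay real throughout; complex resolvents appear as pairs of real
  vectors.\<close>

locale self_adjoint_operator =
  fixes M :: "'a :: {real_inner, complete_space} \<Rightarrow> 'a" and C :: real
  assumes linear_M: "linear M"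
    and self_adjoint: "inner (M u) v = inner u (M v)"
    and norm_M_le: "(norm (M u))\<^sup>2 \<le> C * (norm u)\<^sup>2"
    and C_pos: "0 < C"
begin

lemmas M_simps = linear_add[OF linear_M] linear_diff[OF linear_M] linear_scale[OF linear_M] linear_0[OF linear_M]

lemma bounded_linear_M: "bounded_linear M"
proof (rule bounded_linear_intro[where K = "sqrt C"])
  show "norm (M u) \<le> norm u * sqrt C" for u
  proof (rule power2_le_imp_le)
    show "(norm (M u))\<^sup>2 \<le> (norm u * sqrt C)\<^sup>2"
      using norm_M_le[of u] C_pos by (simp add: power_mult_distrib mult.commute)
  qed (use C_pos in simp)
qed (simp_all add: M_simps)

lemmas tendsto_M = bounded_linear.tendsto[OF bounded_linear_M]

text \<open>The function \<open>1 - x^2 / C\<close> maps the interval from \<open>- sqrt C\<close>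
  to \<open>sqrt C\<close> into that from 0 to 1 and equals 1 only at 0. Its powers therefore tend
  to the indicator of 0, and \<open>B ^^ n\<close> tends to the projection onto the kernel of
  \<open>M\<close>.\<close>

definition B :: "'a \<Rightarrow> 'a" where "B u = u - (1 / C) *\<^sub>R M (M u)"

lemma M_B: "M (B u) = B (M u)"
  by (simp add: B_def M_simps)

text \<open>In the expanded square, half of the cross term absorbs the last term. The half that
  remains later forces \<open>M\<close> to vanish on limits of \<open>B ^^ n\<close>.\<close>

lemma norm_B_le: "(norm (B u))\<^sup>2 + (norm (M u))\<^sup>2 / C \<le> (norm u)\<^sup>2"
proof -
  have "(norm (B u))\<^sup>2 = (norm u)\<^sup>2 - 2 * (norm (M u))\<^sup>2 / C + (norm (M (M u)))\<^sup>2 / C\<^sup>2"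
  proof -
    have "(norm (u - r *\<^sub>R w))\<^sup>2 = (norm u)\<^sup>2 - 2 * r * inner u w + r\<^sup>2 * (norm w)\<^sup>2" for r and w :: 'a
      unfolding power2_norm_eq_inner
      by (simp add: inner_diff_left inner_diff_right inner_commute[of w u] power2_eq_square algebra_simps)
    from this[of "1 / C" "M (M u)"] show ?thesis
      by (simp add: B_def power_divide power2_norm_eq_inner[of "M u"] self_adjoint)
  qed
  moreover have "(norm (M (M u)))\<^sup>2 / C\<^sup>2 \<le> (norm (M u))\<^sup>2 / C"
    using divide_right_mono[OF norm_M_le[of "M u"], of "C\<^sup>2"] C_pos by (simp add: power2_eq_square)
  ultimately show ?thesis by simp
qed

lemma self_adjoint_B: "inner (B u) v = inner u (B v)"
  by (simp add: B_def inner_diff_left inner_diff_right self_adjoint)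

abbreviation Bn :: "nat \<Rightarrow> 'a \<Rightarrow> 'a" where "Bn n \<equiv> B ^^ n"

lemma M_Bn: "M (Bn n u) = Bn n (M u)"
  by (induction n) (simp_all add: M_B)

lemma self_adjoint_Bn: "inner (Bn n u) v = inner u (Bn n v)"
proof (induction n arbitrary: v)
  case (Suc n)
  have "inner (Bn (Suc n) u) v = inner (Bn n u) (B v)" by (simp add: self_adjoint_B)
  also have "\<dots> = inner u (Bn n (B v))" by (rule Suc)
  also have "Bn n (B v) = Bn (Suc n) v" by (simp add: funpow_swap1)
  finally show ?case .
qed simp

lemma inner_Bn_Bn: "inner (Bn n u) (Bn m u) = inner (Bn (n + m) u) u"
proof -
  have "inner (Bn n u) (Bn m u) = inner (Bn m (Bn n u)) u"
    by (simp add: self_adjoint_Bn[of m])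
  also have "Bn m (Bn n u) = Bn (n + m) u"
    by (simp only: add.commute[of n m] funpow_add o_apply)
  finally show ?thesis .
qed

lemma Bn_kernel: "M h = 0 \<Longrightarrow> Bn n h = h"
  by (induction n) (simp_all add: B_def M_simps)

lemma diff_B: "u - B u = (1 / C) *\<^sub>R M (M u)"
  by (simp add: B_def)

text \<open>Positivity of \<open>B\<close> and of \<open>1 - B\<close> is expressed by parity: an
  even moment is a squared norm, and the next odd one falls short of it by
  \<open>(norm (M (Bn j u)))^2 / C\<close>.\<close>

lemma inner_Bn_decseq: "decseq (\<lambda>k. inner (Bn k u) u)"
proof (rule decseq_SucI)
  fix k
  have even: "inner (Bn (2 * j) u) u = (norm (Bn j u))\<^sup>2" for j
    using inner_Bn_Bn[of j u j] by (simp add: power2_norm_eq_inner mult_2)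
  have odd: "inner (Bn (Suc (2 * j)) u) u = (norm (Bn j u))\<^sup>2 - (norm (M (Bn j u)))\<^sup>2 / C" for j
  proof -
    have "inner (Bn (Suc (2 * j)) u) u = inner (Bn (Suc j + j) u) u" by (simp add: mult_2)
    also have "\<dots> = inner (B (Bn j u)) (Bn j u)" by (subst inner_Bn_Bn[symmetric]) simp
    finally show ?thesis
      by (simp add: B_def inner_diff_left self_adjoint power2_norm_eq_inner)
  qed
  show "inner (Bn (Suc k) u) u \<le> inner (Bn k u) u"
  proof (cases "even k")
    case True
    then obtain j where "k = 2 * j" by blast
    then show ?thesis using even[of j] odd[of j] C_pos by simp
  next
    case False
    then obtain j where k: "k = Suc (2 * j)" by (auto elim: oddE)
    have "inner (Bn (2 * Suc j) u) u \<le> inner (Bn (Suc (2 * j)) u) u"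
      unfolding even odd using norm_B_le[of "Bn j u"] by simp
    then show ?thesis using k by simp
  qed
qed

text \<open>The squared distance of two iterates is a combination of the moments of orders
  \<open>2 m\<close>, \<open>m + n\<close> and \<open>2 n\<close>, and the moments form a bounded
  monotone sequence.\<close>

lemma convergent_Bn: "convergent (\<lambda>n. Bn n u)"
proof (rule Cauchy_convergent, rule CauchyI)
  define a where "a k = inner (Bn k u) u" for k
  fix e :: real assume e: "0 < e"
  have nonneg: "0 \<le> a k" for k
  proof -
    have "a (2 * k) \<le> a k" unfolding a_def by (rule decseqD[OF inner_Bn_decseq]) simp
    moreover have "0 \<le> a (2 * k)" unfolding a_def using inner_Bn_Bn[of k u k] by (simp add: mult_2 flip: inner_Bn_Bn)
    ultimately show ?thesis by simp
  qed
  obtain l where "a \<longlonglongrightarrow> l"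
    using decseq_convergent[of a 0] inner_Bn_decseq[of u] nonneg unfolding a_def by metis
  then have "Cauchy a" by (rule LIMSEQ_imp_Cauchy)
  then obtain N where N: "\<forall>m\<ge>N. \<forall>n\<ge>N. norm (a m - a n) < e\<^sup>2 / 2"
    using CauchyD[of a "e\<^sup>2 / 2"] e by auto
  have "norm (Bn m u - Bn n u) < e" if mn: "m \<ge> N" "n \<ge> N" for m n
  proof -
    have "(norm (Bn m u - Bn n u))\<^sup>2 = (a (m + m) - a (m + n)) + (a (n + n) - a (m + n))"
      unfolding power2_norm_eq_inner a_def
      by (simp add: inner_diff_left inner_diff_right inner_Bn_Bn add.commute)
    also have "\<dots> < e\<^sup>2 / 2 + e\<^sup>2 / 2"
    proof (rule add_strict_mono)
      show "a (m + m) - a (m + n) < e\<^sup>2 / 2" "a (n + n) - a (m + n) < e\<^sup>2 / 2"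
        by (rule le_less_trans[OF abs_ge_self], use N mn in simp)+
    qed
    finally show ?thesis using e by (intro power2_less_imp_less[of _ e]) simp_all
  qed
  then show "\<exists>N. \<forall>m\<ge>N. \<forall>n\<ge>N. norm (Bn m u - Bn n u) < e" by blast
qed

definition proj :: "'a \<Rightarrow> 'a" where "proj u = lim (\<lambda>n. Bn n u)"

lemma Bn_tendsto: "(\<lambda>n. Bn n u) \<longlonglongrightarrow> proj u"
  using convergent_Bn unfolding proj_def by (simp add: convergent_LIMSEQ_iff)

text \<open>By \<open>norm_B_le\<close>, the square of \<open>norm (M (Bn n u))\<close> is at most
  \<open>C\<close> times a drop of the convergent sequence of squared norms.\<close>

lemma M_proj: "M (proj u) = 0"
proof -
  have "(\<lambda>n. C * ((norm (Bn n u))\<^sup>2 - (norm (Bn (Suc n) u))\<^sup>2)) \<longlonglongrightarrow> C * ((norm (proj u))\<^sup>2 - (norm (proj u))\<^sup>2)"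
    by (intro tendsto_intros Bn_tendsto LIMSEQ_Suc)
  then have lim: "(\<lambda>n. C * ((norm (Bn n u))\<^sup>2 - (norm (Bn (Suc n) u))\<^sup>2)) \<longlonglongrightarrow> 0" by simp
  have "(\<lambda>n. (norm (M (Bn n u)))\<^sup>2) \<longlonglongrightarrow> 0"
  proof (rule tendsto_sandwich[of "\<lambda>_. 0" _ _ "\<lambda>n. C * ((norm (Bn n u))\<^sup>2 - (norm (Bn (Suc n) u))\<^sup>2)"])
    show "\<forall>\<^sub>F n in sequentially. (norm (M (Bn n u)))\<^sup>2 \<le> C * ((norm (Bn n u))\<^sup>2 - (norm (Bn (Suc n) u))\<^sup>2)"
    proof (rule always_eventually, rule allI)
      fix n
      have "C * ((norm (M (Bn n u)))\<^sup>2 / C) \<le> C * ((norm (Bn n u))\<^sup>2 - (norm (Bn (Suc n) u))\<^sup>2)"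
        using norm_B_le[of "Bn n u"] C_pos by (intro mult_left_mono) simp_all
      then show "(norm (M (Bn n u)))\<^sup>2 \<le> C * ((norm (Bn n u))\<^sup>2 - (norm (Bn (Suc n) u))\<^sup>2)"
        using C_pos by simp
    qed
  qed (use lim in simp_all)
  moreover have "(\<lambda>n. (norm (M (Bn n u)))\<^sup>2) \<longlonglongrightarrow> (norm (M (proj u)))\<^sup>2"
    by (intro tendsto_intros tendsto_M Bn_tendsto)
  ultimately have "(norm (M (proj u)))\<^sup>2 = 0" using LIMSEQ_unique by blast
  then show ?thesis by simp
qed

text \<open>Every iterate of \<open>B\<close> fixes the kernel. Together with \<open>M_proj\<close>
  this characterises \<open>proj\<close> as the orthogonal projection onto the kernel.\<close>

lemma inner_proj_kernel:
  assumes "M h = 0"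
  shows "inner (proj u) h = inner u h"
proof -
  have "(\<lambda>n. inner (Bn n u) h) \<longlonglongrightarrow> inner (proj u) h" by (intro tendsto_intros Bn_tendsto)
  moreover have "inner (Bn n u) h = inner u h" for n
    by (simp add: self_adjoint_Bn Bn_kernel[OF assms])
  ultimately show ?thesis by (simp add: LIMSEQ_const_iff)
qed

lemma self_adjoint_proj: "inner (proj u) v = inner u (proj v)"
  by (metis M_proj inner_commute inner_proj_kernel)

text \<open>Telescoping, since \<open>M (M v) / C = v - B v\<close>. The operators
  \<open>M B^k / C\<close> sum up to an inverse of \<open>M\<close> modulo its kernel, a geometric
  series in \<open>B\<close>; this is the source of \<open>green_kernel\<close>.\<close>

lemma sum_pseudo_inverse:
  "(\<Sum>k<n. (1 / C) *\<^sub>R M (Bn k (M s))) = s - Bn n s"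
  by (induction n) (simp_all add: M_Bn[symmetric] diff_B[of "Bn _ s", symmetric])

lemma pseudo_inverse_tendsto:
  "(\<lambda>n. \<Sum>k<n. (1 / C) *\<^sub>R M (Bn k (M s))) \<longlonglongrightarrow> s - proj s"
  unfolding sum_pseudo_inverse by (intro tendsto_intros Bn_tendsto)

text \<open>Fixed point of the relaxation \<open>v - k (M^2 v + b^2 v - e)\<close>. The step
  \<open>k = 1 / (C + b^2)\<close> makes its linear part exactly \<open>k C B\<close>, where
  \<open>B\<close> has norm at most 1 and \<open>k C < 1\<close>.\<close>

lemma resolvent_exists:
  assumes "b \<noteq> 0"
  shows "\<exists>v. M (M v) + b\<^sup>2 *\<^sub>R v = e"
proof -
  define k where "k = 1 / (C + b\<^sup>2)"
  have pos: "0 < C + b\<^sup>2" using C_pos by (simp add: add_pos_nonneg)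
  define f where "f v = v - k *\<^sub>R (M (M v) + b\<^sup>2 *\<^sub>R v - e)" for v
  have "dist (f v) (f w) \<le> (k * C) * dist v w" for v w
  proof -
    have "k * (C + b\<^sup>2) = 1" using pos by (simp add: k_def)
    then have "k * C + k * b\<^sup>2 = 1" by (simp add: distrib_left)
    then have one: "u - (k * b\<^sup>2) *\<^sub>R u = (k * C) *\<^sub>R u" for u :: 'a
      by (metis add_diff_cancel_right' scaleR_left_diff_distrib scaleR_one)
    have "f v - f w = (v - w) - (k * b\<^sup>2) *\<^sub>R (v - w) - k *\<^sub>R M (M (v - w))"
      by (simp add: f_def M_simps algebra_simps)
    also have "\<dots> = (k * C) *\<^sub>R B (v - w)"
      unfolding one using C_pos by (simp add: B_def scaleR_diff_right)
    finally have "norm (f v - f w) = k * C * norm (B (v - w))"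
      using C_pos pos by (simp add: k_def)
    moreover have "norm (B (v - w)) \<le> norm (v - w)"
    proof (rule power2_le_imp_le)
      have "0 \<le> (norm (M (v - w)))\<^sup>2 / C" using C_pos by simp
      then show "(norm (B (v - w)))\<^sup>2 \<le> (norm (v - w))\<^sup>2" using norm_B_le[of "v - w"] by linarith
    qed simp
    ultimately show ?thesis
      using C_pos pos by (simp add: dist_norm k_def) (intro divide_right_mono mult_left_mono, simp_all)
  qed
  moreover have "0 \<le> k * C" "k * C < 1" using pos C_pos assms by (simp_all add: k_def field_simps)
  ultimately have "\<exists>!x. f x = x" by (intro banach_fix_type) auto
  then obtain v where "f v = v" by blast
  then have "k *\<^sub>R (M (M v) + b\<^sup>2 *\<^sub>R v - e) = 0" by (simp add: f_def)
  then show ?thesis using pos by (auto simp: k_def intro!: exI[of _ v])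
qed

text \<open>
  With \<open>M = A - a\<close>, the vector \<open>w\<close> is \<open>b\<close> times the imaginary part of \<open>(A - (a + \<i> b))\<^sup>-\<^sup>1 e\<close>;
  the bound on \<open>\<langle>e, w\<rangle>\<close> as \<open>b\<close> tends to \<open>0\<close> excludes an atom at \<open>a\<close>.
\<close>

lemma resolvent_small:
  assumes "proj e = 0" "0 < \<eta>"
  shows "\<exists>d>0. \<forall>b w. 0 < \<bar>b\<bar> \<longrightarrow> \<bar>b\<bar> < d \<longrightarrow> M (M w) + b\<^sup>2 *\<^sub>R w = b\<^sup>2 *\<^sub>R e \<longrightarrow> inner e w < \<eta>"
proof -
  define c where "c = norm e + 1"
  have c: "0 < c" "norm e \<le> c" by (simp_all add: c_def add_nonneg_pos)
  have "(\<lambda>n. norm (Bn n e)) \<longlonglongrightarrow> 0" using tendsto_norm[OF Bn_tendsto[of e]] assms(1) by simp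
  moreover have "0 < \<eta> / (2 * c)" using assms(2) c by simp
  ultimately have "\<forall>\<^sub>F n in sequentially. norm (Bn n e) < \<eta> / (2 * c)" by (rule order_tendstoD)
  then obtain n where "norm (Bn n e) < \<eta> / (2 * c)" by (auto simp: eventually_sequentially)
  then have n: "c * norm (Bn n e) < \<eta> / 2" using c by (simp add: field_simps)
  \<comment> \<open>\<open>e\<close> is split into the small vector \<open>Bn n e\<close> and a
    vector \<open>M y\<close>. Self-adjointness moves this \<open>M\<close> onto \<open>w\<close>,
    where \<open>norm (M w)\<close> is at most \<open>|b| c\<close>.\<close>
  define y where "y = (\<Sum>k<n. (1 / C) *\<^sub>R M (Bn k e))"
  have y: "e = Bn n e + M y"
  proof -
    have "M y = (\<Sum>k<n. (1 / C) *\<^sub>R M (Bn k (M e)))"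
      by (simp add: y_def linear_sum[OF linear_M] M_simps M_Bn)
    then show ?thesis by (simp add: sum_pseudo_inverse)
  qed
  \<comment> \<open>Chosen so that \<open>|b| < d\<close> makes \<open>|b| c (norm y + 1)\<close>
    smaller than \<open>\<eta> / 2\<close>; the summand 1 guards against
    \<open>y = 0\<close>.\<close>
  define d where "d = \<eta> / (2 * c * (norm y + 1))"
  have "0 < d" using assms(2) c by (simp add: d_def add_nonneg_pos)
  moreover have "inner e w < \<eta>"
    if b: "0 < \<bar>b\<bar>" "\<bar>b\<bar> < d" and w: "M (M w) + b\<^sup>2 *\<^sub>R w = b\<^sup>2 *\<^sub>R e" for b w
  proof -
    have b2: "0 < b\<^sup>2" using b by simp
    have "inner (M (M w) + b\<^sup>2 *\<^sub>R w) w = b\<^sup>2 * inner e w" by (simp add: w)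
    then have eq: "(norm (M w))\<^sup>2 + b\<^sup>2 * (norm w)\<^sup>2 = b\<^sup>2 * inner e w"
      by (simp add: inner_add_left self_adjoint power2_norm_eq_inner)
    have "b\<^sup>2 * (norm w)\<^sup>2 \<le> b\<^sup>2 * inner e w" using eq zero_le_power2[of "norm (M w)"] by linarith
    then have "(norm w)\<^sup>2 \<le> inner e w" using b2 by simp
    also have "\<dots> \<le> norm e * norm w" by (rule norm_cauchy_schwarz)
    finally have "norm w \<le> norm e" 
      by (cases "norm w = 0") (simp_all add: power2_eq_square)
    then have wc: "norm w \<le> c" using c by simp
    have "inner e w \<le> c * c"
      using norm_cauchy_schwarz[of e w] mult_mono[OF c(2) wc] c(1) by simp
    then have "b\<^sup>2 * inner e w \<le> b\<^sup>2 * (c * c)" using b2 by simp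
    moreover have "0 \<le> b\<^sup>2 * (norm w)\<^sup>2" using b2 by simp
    ultimately have "(norm (M w))\<^sup>2 \<le> (\<bar>b\<bar> * c)\<^sup>2"
    proof -
      have "(\<bar>b\<bar> * c)\<^sup>2 = b\<^sup>2 * (c * c)" by (simp add: power_mult_distrib power2_eq_square[of c])
      then show ?thesis using eq \<open>b\<^sup>2 * inner e w \<le> b\<^sup>2 * (c * c)\<close> \<open>0 \<le> b\<^sup>2 * (norm w)\<^sup>2\<close> by linarith
    qed
    then have Mw: "norm (M w) \<le> \<bar>b\<bar> * c" by (rule power2_le_imp_le) (use c in simp)
    have "inner e w = inner w (Bn n e) + inner (M w) y"
      using y by (metis inner_add_right self_adjoint inner_commute)
    also have "\<dots> \<le> norm w * norm (Bn n e) + norm (M w) * norm y"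
      by (intro add_mono norm_cauchy_schwarz)
    also have "\<dots> \<le> c * norm (Bn n e) + (\<bar>b\<bar> * c) * norm y"
      by (intro add_mono mult_right_mono wc Mw) simp_all
    also have "\<dots> \<le> c * norm (Bn n e) + \<bar>b\<bar> * (c * (norm y + 1))"
      using c by (simp add: algebra_simps)
    also have "\<bar>b\<bar> * (c * (norm y + 1)) < d * (c * (norm y + 1))"
      using b c by (intro mult_strict_right_mono) (simp_all add: add_nonneg_pos)
    also have "d * (c * (norm y + 1)) = \<eta> / 2"
    proof -
      have "c * (norm y + 1) \<noteq> 0" using c by (simp add: add_nonneg_eq_0_iff)
      then show ?thesis by (simp add: d_def field_simps)
    qed
    finally show ?thesis using n by simp
  qed
  ultimately show ?thesis by blast
qed

end

section \<open>Spectral measures of bounded self-adjoint operators\<close>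

definition poly_op :: "('a \<Rightarrow> 'a) \<Rightarrow> real poly \<Rightarrow> 'a \<Rightarrow> 'a :: real_vector" where
  "poly_op A p v = (\<Sum>i\<le>degree p. coeff p i *\<^sub>R (A ^^ i) v)"

lemma poly_op_0 [simp]: "poly_op A 0 v = 0"
  by (simp add: poly_op_def)

lemma poly_op_pCons:
  assumes "linear A"
  shows "poly_op A (pCons a p) v = a *\<^sub>R v + A (poly_op A p v)"
proof (cases "p = 0")
  case True
  then show ?thesis by (simp add: poly_op_def linear_0[OF assms])
next
  case False
  have "poly_op A (pCons a p) v = (\<Sum>i\<le>Suc (degree p). coeff (pCons a p) i *\<^sub>R (A ^^ i) v)"
    using False by (simp add: poly_op_def)
  also have "\<dots> = a *\<^sub>R v + (\<Sum>i\<le>degree p. coeff p i *\<^sub>R A ((A ^^ i) v))"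
    by (subst sum.atMost_Suc_shift) simp
  also have "\<dots> = a *\<^sub>R v + A (poly_op A p v)"
    by (simp add: poly_op_def linear_sum[OF assms] linear_scale[OF assms])
  finally show ?thesis .
qed

lemma poly_op_add:
  assumes "linear A"
  shows "poly_op A (p + q) v = poly_op A p v + poly_op A q v"
  by (induction p q rule: poly_induct2)
    (simp_all add: poly_op_pCons[OF assms] linear_add[OF assms] scaleR_add_left)

lemma poly_op_smult:
  assumes "linear A"
  shows "poly_op A (Polynomial.smult c p) v = c *\<^sub>R poly_op A p v"
  by (induction p) (simp_all add: poly_op_pCons[OF assms] linear_scale[OF assms] scaleR_add_right)

lemma poly_op_mult:
  assumes "linear A"
  shows "poly_op A (p * q) v = poly_op A p (poly_op A q v)"
  by (induction p) (simp_all add: poly_op_pCons[OF assms] poly_op_add[OF assms] poly_op_smult[OF assms])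

text \<open>A complex root \<open>z\<close> is treated as multiplication by \<open>z\<close> on the
  complex numbers, a real vector space, so that \<open>poly_op\<close> evaluates real polynomials at
  \<open>z\<close>. If \<open>z\<close> is not real, the remainder modulo its real quadratic is
  linear and vanishes at \<open>z\<close>, hence is zero.\<close>

lemma real_poly_factor:
  fixes p :: "real poly"
  assumes "0 < degree p"
  obtains l q where "p = [:- l, 1:] * q"
  | a b q where "b \<noteq> 0" "p = [:a\<^sup>2 + b\<^sup>2, - (2 * a), 1:] * q"
proof -
  have "\<exists>z::complex. (\<Sum>k\<le>degree p. of_real (coeff p k) * z ^ k) = 0"
    using assms by (intro alg_closed) auto
  then obtain z :: complex where root: "(\<Sum>k\<le>degree p. of_real (coeff p k) * z ^ k) = 0" ..
  have pow: "((\<lambda>w. z * w) ^^ k) 1 = z ^ k" for k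
    by (induction k) simp_all
  have z: "poly_op (\<lambda>w. z * w) p 1 = 0"
    using root by (simp add: poly_op_def scaleR_conv_of_real pow)
  have lin: "linear (\<lambda>w. z * w)"
    by (rule linearI) (simp_all add: algebra_simps)
  show thesis
  proof (cases "Im z = 0")
    case True
    then obtain x where zx: "z = of_real x" using complex_is_Real_iff Reals_cases by metis
    have "of_real (poly p x) = (0 :: complex)"
      using root unfolding zx by (simp add: poly_altdef)
    then have "poly p x = 0" by simp
    then have "[:- x, 1:] dvd p" by (simp add: poly_eq_0_iff_dvd)
    then show thesis using that(1) by (auto elim: dvdE)
  next
    case False
    define r where "r = [:(Re z)\<^sup>2 + (Im z)\<^sup>2, - (2 * Re z), 1:]"
    have deg: "degree r = 2" by (simp add: r_def)
    have rz: "poly_op (\<lambda>w. z * w) r w = 0" for w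
      unfolding r_def by (simp add: poly_op_pCons[OF lin]) (simp add: complex_eq_iff power2_eq_square algebra_simps)
    define s where "s = p mod r"
    have "degree s < 2" unfolding s_def using degree_mod_less'[of r p] deg by (cases "p mod r = 0") (auto simp: r_def)
    then have s: "s = [:coeff s 0, coeff s 1:]"
      by (intro poly_eqI) (auto simp: coeff_pCons coeff_eq_0 split: nat.splits)
    then obtain c d where s: "s = [:c, d:]" by blast
    have "p = r * (p div r) + s" by (simp add: s_def mult.commute)
    then have "poly_op (\<lambda>w. z * w) s 1 = 0"
      using z by (metis poly_op_add[OF lin] poly_op_mult[OF lin] rz add_0)
    then have "of_real c + z * of_real d = 0"
      unfolding s by (simp add: poly_op_pCons[OF lin] scaleR_conv_of_real)
    then have "d = 0" "c = 0" using False by (auto simp: complex_eq_iff)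
    then have "p = r * (p div r)" using \<open>p = r * (p div r) + s\<close> s by simp
    then show thesis using that(2)[of "Im z" "Re z"] False unfolding r_def by blast
  qed
qed

text \<open>Induction on the degree, one real factor at a time. A quadratic factor acts as
  \<open>(A - a)^2 + b^2\<close>, which is positive definite and can be cancelled. A linear factor
  \<open>A - l\<close> is undone on each eigenvector found for \<open>A e - l e\<close>.\<close>

lemma eigenvector_decomposition:
  fixes A :: "'a :: real_inner \<Rightarrow> 'a"
  assumes lin: "linear A" and sa: "\<And>u v. inner (A u) v = inner u (A v)"
    and "p \<noteq> 0" "poly_op A p e = 0"
  shows "\<exists>\<Lambda> v. finite \<Lambda> \<and> (\<forall>l\<in>\<Lambda>. A (v l) = l *\<^sub>R v l) \<and> e = (\<Sum>l\<in>\<Lambda>. v l)"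
  using assms(3,4)
proof (induction "degree p" arbitrary: p e rule: less_induct)
  case less
  show ?case
  proof (cases "degree p = 0")
    case True
    then obtain c where "p = [:c:]" by (metis degree_eq_zeroE)
    then have "e = 0" using less.prems by (simp add: poly_op_def)
    then show ?thesis by (intro exI[of _ "{}"]) simp
  next
    case False
    then have "0 < degree p" by simp
    then show ?thesis
    proof (cases rule: real_poly_factor)
      case (1 l q)
      define f where "f = A e - l *\<^sub>R e"
      have "q \<noteq> 0" using 1 less.prems by auto
      then have "degree p = degree [:- l, 1:] + degree q"
        unfolding 1 by (intro degree_mult_eq) simp_all
      then have "degree q < degree p" by simp
      moreover have "poly_op A q f = 0"
      proof -
        have "poly_op A [:- l, 1:] e = f"
          by (simp add: poly_op_pCons[OF lin] f_def linear_0[OF lin])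
        moreover have "poly_op A (q * [:- l, 1:]) e = 0" using 1 less.prems by (simp add: mult.commute)
        ultimately show ?thesis unfolding poly_op_mult[OF lin] by simp
      qed
      ultimately obtain \<Lambda> v where v: "finite \<Lambda>" "\<forall>l\<in>\<Lambda>. A (v l) = l *\<^sub>R v l" "f = (\<Sum>l\<in>\<Lambda>. v l)"
        using less.hyps \<open>q \<noteq> 0\<close> by metis
      define w where "w = (if l \<in> \<Lambda> then v l else 0)"
      \<comment> \<open>Subtracts preimages under \<open>A - l\<close> of all components with
        eigenvalue \<open>m\<close> different from \<open>l\<close>; what \<open>A - l\<close>
        leaves of \<open>u\<close> is the component \<open>w\<close> at \<open>l\<close>
        itself.\<close>
      define u where "u = e - (\<Sum>m\<in>\<Lambda> - {l}. (1 / (m - l)) *\<^sub>R v m)"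
      have "A u - l *\<^sub>R u = f - (\<Sum>m\<in>\<Lambda> - {l}. (1 / (m - l)) *\<^sub>R (A (v m) - l *\<^sub>R v m))"
        by (simp add: u_def f_def linear_diff[OF lin] linear_sum[OF lin] linear_scale[OF lin]
            scaleR_diff_right sum_subtractf scaleR_sum_right algebra_simps)
      also have "(\<Sum>m\<in>\<Lambda> - {l}. (1 / (m - l)) *\<^sub>R (A (v m) - l *\<^sub>R v m)) = (\<Sum>m\<in>\<Lambda> - {l}. v m)"
      proof (rule sum.cong[OF refl])
        fix m assume "m \<in> \<Lambda> - {l}"
        then have "A (v m) - l *\<^sub>R v m = (m - l) *\<^sub>R v m" "m - l \<noteq> 0"
          using v(2) by (auto simp: scaleR_diff_left)
        then show "(1 / (m - l)) *\<^sub>R (A (v m) - l *\<^sub>R v m) = v m" by simp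
      qed
      also have "f - (\<Sum>m\<in>\<Lambda> - {l}. v m) = w"
        using v(1,3) by (auto simp: w_def sum.remove)
      finally have uw: "A u - l *\<^sub>R u = w" .
      have Aw: "A w = l *\<^sub>R w" using v(2) by (auto simp: w_def linear_0[OF lin])
      \<comment> \<open>\<open>w\<close> lies in the range of \<open>A - l\<close> and is
        annihilated by it; for a symmetric operator such a vector is orthogonal to itself.\<close>
      have "inner w w = inner (A u - l *\<^sub>R u) w" by (simp add: uw)
      also have "\<dots> = inner u (A w - l *\<^sub>R w)"
        by (simp add: inner_diff_left inner_diff_right sa)
      finally have "w = 0" using Aw by simp
      then have Au: "A u = l *\<^sub>R u" using uw by simp
      define v' where "v' m = (if m = l then u else (1 / (m - l)) *\<^sub>R v m)" for m
      have "(\<Sum>m\<in>\<Lambda> - {l}. v' m) = (\<Sum>m\<in>\<Lambda> - {l}. (1 / (m - l)) *\<^sub>R v m)"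
        by (rule sum.cong) (auto simp: v'_def)
      then have "e = (\<Sum>m\<in>insert l (\<Lambda> - {l}). v' m)"
        using v(1) by (subst sum.insert) (simp_all add: v'_def u_def)
      moreover have "\<forall>m\<in>insert l (\<Lambda> - {l}). A (v' m) = m *\<^sub>R v' m"
        using Au v(2) by (auto simp: v'_def linear_scale[OF lin])
      moreover have "finite (insert l (\<Lambda> - {l}))" using v(1) by simp
      ultimately show ?thesis by blast
    next
      case (2 a b q)
      have "q \<noteq> 0" using 2 less.prems by auto
      then have "degree p = degree [:a\<^sup>2 + b\<^sup>2, - (2 * a), 1:] + degree q"
        unfolding 2(2) by (intro degree_mult_eq) simp_all
      then have "degree q < degree p" by simp
      moreover have "poly_op A q e = 0"
      proof -
        define f where "f = poly_op A q e"
        have "poly_op A [:a\<^sup>2 + b\<^sup>2, - (2 * a), 1:] f = 0"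
          using less.prems(2) unfolding 2(2) poly_op_mult[OF lin] f_def .
        then have "(a\<^sup>2 + b\<^sup>2) *\<^sub>R f - (2 * a) *\<^sub>R A f + A (A f) = 0"
          by (simp add: poly_op_pCons[OF lin] linear_add[OF lin] linear_scale[OF lin]
              linear_0[OF lin] linear_neg[OF lin] linear_diff[OF lin] algebra_simps)
        then have "inner ((a\<^sup>2 + b\<^sup>2) *\<^sub>R f - (2 * a) *\<^sub>R A f + A (A f)) f = 0" by simp
        then have "(norm (A f - a *\<^sub>R f))\<^sup>2 + b\<^sup>2 * (norm f)\<^sup>2 = 0"
          unfolding power2_norm_eq_inner
          by (simp add: inner_diff_left inner_diff_right inner_add_left sa power2_eq_square algebra_simps inner_commute)
        then show ?thesis using 2(1) unfolding f_def[symmetric]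
          by (simp add: add_nonneg_eq_0_iff)
      qed
      ultimately show ?thesis using less.hyps \<open>q \<noteq> 0\<close> by blast
    qed
  qed
qed

lemma annihilating_poly_exists:
  fixes A :: "'a :: real_vector \<Rightarrow> 'a"
  assumes "finite S" "\<And>n. (A ^^ n) e \<in> span S"
  shows "\<exists>p. p \<noteq> 0 \<and> poly_op A p e = 0"
proof -
  define n where "n = card S"
  define f where "f i = (A ^^ i) e" for i
  have eval: "poly_op A p e = (\<Sum>i\<le>n. coeff p i *\<^sub>R f i)" if "degree p \<le> n" for p
    unfolding poly_op_def f_def
    by (rule sum.mono_neutral_left) (use that in \<open>auto simp: coeff_eq_0\<close>)
  show ?thesis
  proof (cases "inj_on f {..n}")
    \<comment> \<open>Linear dependence is a property of sets and does not see repetitions in the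
      sequence of powers; a repetition yields the difference of two monomials.\<close>
    case False
    then obtain i j where ij: "i \<le> n" "j \<le> n" "i \<noteq> j" "f i = f j" by (auto simp: inj_on_def)
    define p where "p = monom (1::real) i - monom 1 j"
    have "coeff p i = 1" using ij by (simp add: p_def)
    then have "p \<noteq> 0" by auto
    have deg: "degree p \<le> n" unfolding p_def using ij
      by (intro degree_diff_le) (auto intro: order_trans[OF degree_monom_le])
    have "poly_op A p e = (\<Sum>k\<le>n. (if k = i then f k else 0) - (if k = j then f k else 0))"
      unfolding eval[OF deg] by (rule sum.cong) (auto simp: p_def scaleR_diff_left)
    also have "\<dots> = f i - f j" using ij by (simp add: sum_subtractf)
    finally show ?thesis using ij \<open>p \<noteq> 0\<close> by auto
  next
    case True
    then have "card (f ` {..n}) = Suc n" by (simp add: card_image)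
    have "dependent (f ` {..n})"
    proof (rule ccontr)
      assume "independent (f ` {..n})"
      then have "card (f ` {..n}) \<le> card S"
        using independent_span_bound[OF assms(1)] assms(2) by (auto simp: f_def)
      then show False using \<open>card (f ` {..n}) = Suc n\<close> by (simp add: n_def)
    qed
    then obtain u where u: "\<exists>v\<in>f ` {..n}. u v \<noteq> 0" "(\<Sum>v\<in>f ` {..n}. u v *\<^sub>R v) = 0"
      using real_vector.dependent_finite[of "f ` {..n}"] by auto
    define p where "p = (\<Sum>i\<le>n. monom (u (f i)) i)"
    have c: "coeff p k = u (f k)" if "k \<le> n" for k
      using that by (simp add: p_def coeff_sum if_distrib cong: if_cong)
    obtain i where "i \<le> n" "u (f i) \<noteq> 0" using u(1) by auto
    then have "p \<noteq> 0" using c by force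
    have "degree p \<le> n" unfolding p_def
      by (intro degree_sum_le) (auto intro: order_trans[OF degree_monom_le])
    then have "poly_op A p e = (\<Sum>i\<le>n. u (f i) *\<^sub>R f i)" by (simp add: eval c)
    also have "\<dots> = 0" using u(2) sum.reindex[OF True, of "\<lambda>v. u v *\<^sub>R v"] by simp
    finally show ?thesis using \<open>p \<noteq> 0\<close> by auto
  qed
qed

text \<open>Writing \<open>e\<close> as a sum of orthogonal eigenvectors \<open>v l\<close>, the
  measure puts mass \<open>(norm (v l))^2\<close> at \<open>l\<close>. The pair \<open>u\<close>,
  \<open>v\<close> of the statement is the real and imaginary part of the resolvent at
  \<open>a + i b\<close> applied to \<open>e\<close>. The interval is enlarged by 1 because its left
  end is open.\<close>

lemma finite_rank_spectral_measure:
  fixes A :: "'a :: real_inner \<Rightarrow> 'a"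
  assumes lin: "linear A" and sa: "\<And>u v. inner (A u) v = inner u (A v)"
    and bound: "\<And>u. (norm (A u))\<^sup>2 \<le> C * (norm u)\<^sup>2"
    and S: "finite S" "e \<in> span S" "\<And>u. A u \<in> span S" and e: "norm e = 1"
  shows "\<exists>\<mu>. real_distribution \<mu> \<and> measure \<mu> {- (sqrt C + 1) <.. sqrt C + 1} = 1 \<and>
    (\<forall>a b. b \<noteq> 0 \<longrightarrow> (\<exists>u v. A u - a *\<^sub>R u + b *\<^sub>R v = e \<and> A v - a *\<^sub>R v = b *\<^sub>R u \<and>
      inner e u = (\<integral>\<xi>. (\<xi> - a) / ((\<xi> - a)\<^sup>2 + b\<^sup>2) \<partial>\<mu>) \<and>
      inner e v = (\<integral>\<xi>. b / ((\<xi> - a)\<^sup>2 + b\<^sup>2) \<partial>\<mu>)))"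
proof -
  have "(A ^^ n) e \<in> span S" for n using S by (cases n) auto
  then obtain p where "p \<noteq> 0" "poly_op A p e = 0" using annihilating_poly_exists S(1) by blast
  then obtain \<Lambda>0 v where v0: "finite \<Lambda>0" "\<forall>l\<in>\<Lambda>0. A (v l) = l *\<^sub>R v l" "e = (\<Sum>l\<in>\<Lambda>0. v l)"
    using eigenvector_decomposition[OF lin sa] by metis
  define \<Lambda> where "\<Lambda> = {l\<in>\<Lambda>0. v l \<noteq> 0}"
  have fin: "finite \<Lambda>" and eig: "\<And>l. l \<in> \<Lambda> \<Longrightarrow> A (v l) = l *\<^sub>R v l" and nz: "\<And>l. l \<in> \<Lambda> \<Longrightarrow> v l \<noteq> 0"
    using v0 by (auto simp: \<Lambda>_def)
  have esum: "e = (\<Sum>l\<in>\<Lambda>. v l)"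
    unfolding v0(3) \<Lambda>_def by (rule sum.mono_neutral_right) (use v0(1) in auto)
  have orth: "inner (v l) (v m) = 0" if "l \<in> \<Lambda>" "m \<in> \<Lambda>" "l \<noteq> m" for l m
  proof -
    have "l * inner (v l) (v m) = m * inner (v l) (v m)"
      using sa[of "v l" "v m"] eig that by simp
    then show ?thesis using that by simp
  qed
  define w where "w l = (norm (v l))\<^sup>2" for l
  have ev: "inner e (v l) = w l" if "l \<in> \<Lambda>" for l
  proof -
    have "inner e (v l) = (\<Sum>m\<in>\<Lambda>. if m = l then w l else 0)"
      unfolding esum inner_sum_left
      by (rule sum.cong) (auto simp: orth that w_def power2_norm_eq_inner)
    then show ?thesis using fin that by simp
  qed
  have "(\<Sum>l\<in>\<Lambda>. w l) = inner e (\<Sum>l\<in>\<Lambda>. v l)" by (simp add: inner_sum_right ev)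
  then have wsum: "(\<Sum>l\<in>\<Lambda>. w l) = 1"
    using e by (simp add: esum[symmetric] power2_norm_eq_inner[symmetric])
  have w0: "0 \<le> w l" for l by (simp add: w_def)
  define \<mu> where "\<mu> = distr (point_measure \<Lambda> (\<lambda>l. ennreal (w l))) borel (\<lambda>x. x)"
  have meas: "(\<lambda>x. x) \<in> measurable (point_measure \<Lambda> (\<lambda>l. ennreal (w l))) borel"
    by (simp add: measurable_def space_point_measure sets_point_measure)
  have int: "(\<integral>x. g x \<partial>\<mu>) = (\<Sum>l\<in>\<Lambda>. w l * g l)" if "g \<in> borel_measurable borel" for g :: "real \<Rightarrow> real"
    unfolding \<mu>_def using that meas fin w0
    by (subst integral_distr) (simp_all add: lebesgue_integral_point_measure_finite)
  have "emeasure \<mu> (space \<mu>) = (\<Sum>l\<in>\<Lambda>. ennreal (w l))"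
    unfolding \<mu>_def using fin meas by (simp add: emeasure_distr emeasure_point_measure_finite space_point_measure)
  also have "\<dots> = 1" using w0 wsum by (simp add: sum_ennreal)
  finally interpret \<mu>: prob_space \<mu> by (rule prob_spaceI)
  have "sets \<mu> = sets borel" by (simp add: \<mu>_def)
  then have rd: "real_distribution \<mu>" by unfold_locales
  have small: "\<bar>l\<bar> \<le> sqrt C" if "l \<in> \<Lambda>" for l
  proof -
    have "l\<^sup>2 * (norm (v l))\<^sup>2 \<le> C * (norm (v l))\<^sup>2"
      using bound[of "v l"] eig[OF that] by (simp add: power_mult_distrib)
    then have "l\<^sup>2 \<le> C" using nz[OF that] by simp
    then have "sqrt (l\<^sup>2) \<le> sqrt C" by (rule real_sqrt_le_mono)
    then show ?thesis by simp
  qed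
  have "measure \<mu> {- (sqrt C + 1) <.. sqrt C + 1} = (\<integral>x. indicator {- (sqrt C + 1) <.. sqrt C + 1} x \<partial>\<mu>)"
    by (simp add: \<open>sets \<mu> = sets borel\<close> \<mu>_def)
  also have "\<dots> = (\<Sum>l\<in>\<Lambda>. w l * indicator {- (sqrt C + 1) <.. sqrt C + 1} l)"
    by (rule int) simp
  also have "\<dots> = (\<Sum>l\<in>\<Lambda>. w l)"
  proof (rule sum.cong[OF refl])
    fix l assume "l \<in> \<Lambda>"
    then have "- (sqrt C + 1) < l" "l \<le> sqrt C + 1" using small[of l] by (simp_all add: abs_le_iff)
    then show "w l * indicator {- (sqrt C + 1) <.. sqrt C + 1} l = w l" by simp
  qed
  finally have supp: "measure \<mu> {- (sqrt C + 1) <.. sqrt C + 1} = 1" using wsum by simp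
  have "\<exists>u u'. A u - a *\<^sub>R u + b *\<^sub>R u' = e \<and> A u' - a *\<^sub>R u' = b *\<^sub>R u \<and>
      inner e u = (\<integral>\<xi>. (\<xi> - a) / ((\<xi> - a)\<^sup>2 + b\<^sup>2) \<partial>\<mu>) \<and>
      inner e u' = (\<integral>\<xi>. b / ((\<xi> - a)\<^sup>2 + b\<^sup>2) \<partial>\<mu>)" if b: "b \<noteq> 0" for a b
  proof -
    define f where "f l = (l - a) / ((l - a)\<^sup>2 + b\<^sup>2)" for l
    define g where "g l = b / ((l - a)\<^sup>2 + b\<^sup>2)" for l
    have den: "0 < (l - a)\<^sup>2 + b\<^sup>2" for l using b by (simp add: add_nonneg_pos)
    have den': "(l - a)\<^sup>2 + b\<^sup>2 \<noteq> 0" for l using den[of l] by linarith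
    have 1: "l * f l - a * f l + b * g l = 1" for l
    proof -
      have "l * f l - a * f l + b * g l = (l - a) * f l + b * g l" by (simp only: left_diff_distrib)
      also have "\<dots> = ((l - a)\<^sup>2 + b\<^sup>2) / ((l - a)\<^sup>2 + b\<^sup>2)"
        by (simp only: f_def g_def times_divide_eq_right add_divide_distrib power2_eq_square)
      finally show ?thesis using den' by simp
    qed
    have 2: "l * g l - a * g l = b * f l" for l
      by (simp add: f_def g_def diff_divide_distrib[symmetric] algebra_simps)
    define u where "u = (\<Sum>l\<in>\<Lambda>. f l *\<^sub>R v l)"
    define u' where "u' = (\<Sum>l\<in>\<Lambda>. g l *\<^sub>R v l)"
    have Au: "A u = (\<Sum>l\<in>\<Lambda>. (l * f l) *\<^sub>R v l)" and Au': "A u' = (\<Sum>l\<in>\<Lambda>. (l * g l) *\<^sub>R v l)"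
      by (simp_all add: u_def u'_def linear_sum[OF lin] linear_scale[OF lin] eig mult.commute)
    have "A u - a *\<^sub>R u + b *\<^sub>R u' = (\<Sum>l\<in>\<Lambda>. (l * f l - a * f l + b * g l) *\<^sub>R v l)"
      unfolding Au unfolding u_def u'_def
      by (simp add: scaleR_sum_right sum_subtractf sum.distrib scaleR_add_left scaleR_diff_left)
    then have "A u - a *\<^sub>R u + b *\<^sub>R u' = e" by (simp add: 1 esum)
    moreover have "A u' - a *\<^sub>R u' = (\<Sum>l\<in>\<Lambda>. (l * g l - a * g l) *\<^sub>R v l)"
      unfolding Au' unfolding u'_def
      by (simp add: scaleR_sum_right sum_subtractf scaleR_diff_left)
    then have "A u' - a *\<^sub>R u' = b *\<^sub>R u" by (simp add: 2 u_def scaleR_sum_right)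
    moreover have "inner e u = (\<integral>\<xi>. f \<xi> \<partial>\<mu>)" "inner e u' = (\<integral>\<xi>. g \<xi> \<partial>\<mu>)"
      by (simp_all add: int f_def g_def u_def u'_def inner_sum_right ev mult.commute)
    ultimately show ?thesis unfolding f_def g_def by blast
  qed
  then show ?thesis using rd supp by blast
qed

text \<open>The resolvent bound \<open>1 / |Im z|\<close> in real form: for
  \<open>z = a + i b\<close> the two equations say
  \<open>(T - z) (u + i v) = r + i s\<close>.\<close>

lemma resolvent_perturbation:
  fixes u v :: "'a :: real_inner"
  assumes lin: "linear T" and sa: "\<And>u v. inner (T u) v = inner u (T v)" and b: "b \<noteq> 0"
    and "T u - a *\<^sub>R u + b *\<^sub>R v = r" "T v - a *\<^sub>R v - b *\<^sub>R u = s"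
  shows "b\<^sup>2 * ((norm u)\<^sup>2 + (norm v)\<^sup>2) \<le> (norm r)\<^sup>2 + (norm s)\<^sup>2"
proof -
  have "inner (T u - a *\<^sub>R u + b *\<^sub>R v) v - inner u (T v - a *\<^sub>R v - b *\<^sub>R u) = b * ((norm u)\<^sup>2 + (norm v)\<^sup>2)"
    unfolding power2_norm_eq_inner
    by (simp add: inner_add_left inner_diff_left inner_diff_right sa algebra_simps)
  then have eq: "b * ((norm u)\<^sup>2 + (norm v)\<^sup>2) = inner r v - inner u s" using assms by simp
  have "0 \<le> (norm (r - b *\<^sub>R v))\<^sup>2 + (norm (s + b *\<^sub>R u))\<^sup>2" by simp
  also have "\<dots> = (norm r)\<^sup>2 + (norm s)\<^sup>2 + b\<^sup>2 * ((norm u)\<^sup>2 + (norm v)\<^sup>2) - 2 * (b * (inner r v - inner u s))"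
    unfolding power2_norm_eq_inner
    by (simp add: inner_add_left inner_add_right inner_diff_left inner_diff_right inner_commute
        power2_eq_square algebra_simps)
  also have "b * (inner r v - inner u s) = b\<^sup>2 * ((norm u)\<^sup>2 + (norm v)\<^sup>2)"
    by (simp add: eq[symmetric] power2_eq_square)
  finally show ?thesis by simp
qed

section \<open>From finite rank to bounded operators by weak limits\<close>

lemma tight_supported:
  assumes "\<And>n. real_distribution (\<mu> n)" "\<And>n. measure (\<mu> n) {a<..b} = 1"
  shows "tight \<mu>"
proof -
  have "a < b" using assms(2)[of 0] by (cases "a < b") auto
  then show ?thesis unfolding tight_def using assms by (intro conjI allI impI exI[of _ a] exI[of _ b]) auto
qed

text \<open>The compressions \<open>T n\<close> to finitely many coordinates converge strongly to
  \<open>A\<close>. Their spectral measures live on one bounded interval, hence have a weak limit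
  along a subsequence, and \<open>resolvent_perturbation\<close> makes the resolvents converge as
  well.\<close>

lemma real_spectral_measure_exists:
  fixes A :: "ell2 \<Rightarrow> ell2"
  assumes "self_adjoint_operator A C"
  shows "\<exists>\<mu>. real_distribution \<mu> \<and>
    (\<forall>a b u v. b \<noteq> 0 \<longrightarrow> A u - a *\<^sub>R u + b *\<^sub>R v = delta_vec x \<longrightarrow> A v - a *\<^sub>R v = b *\<^sub>R u \<longrightarrow>
      coord u x = (\<integral>\<xi>. (\<xi> - a) / ((\<xi> - a)\<^sup>2 + b\<^sup>2) \<partial>\<mu>) \<and>
      coord v x = (\<integral>\<xi>. b / ((\<xi> - a)\<^sup>2 + b\<^sup>2) \<partial>\<mu>))"
proof -
  interpret self_adjoint_operator A C by fact
  define e where "e = delta_vec x"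
  \<comment> \<open>The offset \<open>Suc x\<close> keeps \<open>delta_vec x\<close> in the range of
    every compression.\<close>
  define R where "R n = restr {..<Suc x + n}" for n
  define T where "T n u = R n (A (R n u))" for n u
  interpret R: bounded_linear "R n" for n unfolding R_def by (rule bounded_linear_restr)
  have R_lim: "(\<lambda>n. R n u) \<longlonglongrightarrow> u" for u
    using LIMSEQ_ignore_initial_segment[OF restr_tendsto[of u], of "Suc x"] by (simp add: R_def add.commute)
  have T_lin: "linear (T n)" for n
    by (rule linearI) (simp_all add: T_def R.add R.scaleR M_simps)
  have T_sa: "inner (T n u) v = inner u (T n v)" for n u v
    by (simp add: T_def R_def inner_restr self_adjoint)
  have R_le: "(norm (R n u))\<^sup>2 \<le> (norm u)\<^sup>2" for n u
    unfolding R_def by (rule power_mono[OF norm_restr_le norm_ge_zero])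
  have T_bound: "(norm (T n u))\<^sup>2 \<le> C * (norm u)\<^sup>2" for n u
  proof -
    have "(norm (T n u))\<^sup>2 \<le> (norm (A (R n u)))\<^sup>2" unfolding T_def by (rule R_le)
    also have "\<dots> \<le> C * (norm (R n u))\<^sup>2" by (rule norm_M_le)
    also have "\<dots> \<le> C * (norm u)\<^sup>2" using C_pos R_le by (intro mult_left_mono) simp_all
    finally show ?thesis .
  qed
  have R_span: "R n u \<in> span (delta_vec ` {..<Suc x + n})" for n u
    unfolding R_def restr_finite[OF finite_lessThan]
    by (intro span_sum span_scale span_base) simp
  have e_span: "e \<in> span (delta_vec ` {..<Suc x + n})" for n
    unfolding e_def by (intro span_base) simp
  have T_lim: "(\<lambda>n. T n u) \<longlonglongrightarrow> A u" for u
  proof -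
    have "(\<lambda>n. R n (A (R n u - u))) \<longlonglongrightarrow> 0"
    proof (rule Lim_null_comparison)
      show "\<forall>\<^sub>F n in sequentially. norm (R n (A (R n u - u))) \<le> norm (A (R n u - u))"
        unfolding R_def by (simp add: norm_restr_le)
      have "(\<lambda>n. norm (A (R n u - u))) \<longlonglongrightarrow> norm (A (u - u))"
        by (intro tendsto_intros tendsto_M R_lim)
      then show "(\<lambda>n. norm (A (R n u - u))) \<longlonglongrightarrow> 0" by (simp add: M_simps)
    qed
    then have "(\<lambda>n. R n (A (R n u - u)) + R n (A u)) \<longlonglongrightarrow> 0 + A u"
      by (intro tendsto_add R_lim)
    then show ?thesis by (simp add: T_def M_simps R.diff)
  qed
  have "\<forall>n. \<exists>\<mu>. real_distribution \<mu> \<and> measure \<mu> {- (sqrt C + 1) <.. sqrt C + 1} = 1 \<and>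
    (\<forall>a b. b \<noteq> 0 \<longrightarrow> (\<exists>u v. T n u - a *\<^sub>R u + b *\<^sub>R v = e \<and> T n v - a *\<^sub>R v = b *\<^sub>R u \<and>
      inner e u = (\<integral>\<xi>. (\<xi> - a) / ((\<xi> - a)\<^sup>2 + b\<^sup>2) \<partial>\<mu>) \<and>
      inner e v = (\<integral>\<xi>. b / ((\<xi> - a)\<^sup>2 + b\<^sup>2) \<partial>\<mu>)))"
  proof (rule allI, rule finite_rank_spectral_measure[OF T_lin T_sa T_bound _ e_span])
    fix n u
    show "T n u \<in> span (delta_vec ` {..<Suc x + n})" unfolding T_def by (rule R_span)
  qed (simp_all add: e_def)
  from choice[OF this] obtain \<mu> where all: "\<forall>n. real_distribution (\<mu> n) \<and> measure (\<mu> n) {- (sqrt C + 1) <.. sqrt C + 1} = 1 \<and>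
    (\<forall>a b. b \<noteq> 0 \<longrightarrow> (\<exists>u v. T n u - a *\<^sub>R u + b *\<^sub>R v = e \<and> T n v - a *\<^sub>R v = b *\<^sub>R u \<and>
      inner e u = (\<integral>\<xi>. (\<xi> - a) / ((\<xi> - a)\<^sup>2 + b\<^sup>2) \<partial>\<mu> n) \<and>
      inner e v = (\<integral>\<xi>. b / ((\<xi> - a)\<^sup>2 + b\<^sup>2) \<partial>\<mu> n)))" by blast
  then have \<mu>: "\<And>n. real_distribution (\<mu> n)" "\<And>n. measure (\<mu> n) {- (sqrt C + 1) <.. sqrt C + 1} = 1"
    and res: "\<And>n a b. b \<noteq> 0 \<Longrightarrow> \<exists>u v. T n u - a *\<^sub>R u + b *\<^sub>R v = e \<and> T n v - a *\<^sub>R v = b *\<^sub>R u \<and>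
      inner e u = (\<integral>\<xi>. (\<xi> - a) / ((\<xi> - a)\<^sup>2 + b\<^sup>2) \<partial>\<mu> n) \<and>
      inner e v = (\<integral>\<xi>. b / ((\<xi> - a)\<^sup>2 + b\<^sup>2) \<partial>\<mu> n)"
    by simp_all
  have "tight \<mu>" by (rule tight_supported[OF \<mu>])
  then have "\<exists>r M. strict_mono (r :: nat \<Rightarrow> nat) \<and> real_distribution M \<and> weak_conv_m (\<mu> \<circ> id \<circ> r) M"
    by (rule tight_imp_convergent_subsubsequence) (simp add: strict_mono_def)
  then obtain r M where r: "strict_mono r" "real_distribution M" "weak_conv_m (\<mu> \<circ> id \<circ> r) M"
    by (elim exE conjE)
  have conv: "(\<lambda>n. \<integral>x. g x \<partial>\<mu> (r n)) \<longlonglongrightarrow> (\<integral>x. g x \<partial>M)"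
    if "\<And>x. isCont g x" "\<And>x. norm (g x) \<le> K" for g :: "real \<Rightarrow> real" and K
    using weak_conv_imp_integral_bdd_continuous_conv[of "\<mu> \<circ> id \<circ> r" M g K] r \<mu>(1) that by simp
  have "coord u x = (\<integral>\<xi>. (\<xi> - a) / ((\<xi> - a)\<^sup>2 + b\<^sup>2) \<partial>M) \<and>
      coord v x = (\<integral>\<xi>. b / ((\<xi> - a)\<^sup>2 + b\<^sup>2) \<partial>M)"
    if b: "b \<noteq> 0" and uv: "A u - a *\<^sub>R u + b *\<^sub>R v = e" "A v - a *\<^sub>R v = b *\<^sub>R u" for a b u v
  proof -
    have "\<forall>n. \<exists>p. T n (fst p) - a *\<^sub>R fst p + b *\<^sub>R snd p = e \<and> T n (snd p) - a *\<^sub>R snd p = b *\<^sub>R fst p \<and>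
      inner e (fst p) = (\<integral>\<xi>. (\<xi> - a) / ((\<xi> - a)\<^sup>2 + b\<^sup>2) \<partial>\<mu> n) \<and>
      inner e (snd p) = (\<integral>\<xi>. b / ((\<xi> - a)\<^sup>2 + b\<^sup>2) \<partial>\<mu> n)"
      using res[OF b] by simp
    from choice[OF this] obtain W where "\<And>n. T n (fst (W n)) - a *\<^sub>R fst (W n) + b *\<^sub>R snd (W n) = e \<and>
      T n (snd (W n)) - a *\<^sub>R snd (W n) = b *\<^sub>R fst (W n) \<and>
      inner e (fst (W n)) = (\<integral>\<xi>. (\<xi> - a) / ((\<xi> - a)\<^sup>2 + b\<^sup>2) \<partial>\<mu> n) \<and>
      inner e (snd (W n)) = (\<integral>\<xi>. b / ((\<xi> - a)\<^sup>2 + b\<^sup>2) \<partial>\<mu> n)" by blast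
    moreover define U V where "U n = fst (W n)" and "V n = snd (W n)" for n
    ultimately have UV: "\<And>n. T n (U n) - a *\<^sub>R U n + b *\<^sub>R V n = e" "\<And>n. T n (V n) - a *\<^sub>R V n = b *\<^sub>R U n"
      "\<And>n. inner e (U n) = (\<integral>\<xi>. (\<xi> - a) / ((\<xi> - a)\<^sup>2 + b\<^sup>2) \<partial>\<mu> n)"
      "\<And>n. inner e (V n) = (\<integral>\<xi>. b / ((\<xi> - a)\<^sup>2 + b\<^sup>2) \<partial>\<mu> n)"
      by simp_all
    define d where "d n = ((norm (T n u - A u))\<^sup>2 + (norm (T n v - A v))\<^sup>2) / b\<^sup>2" for n
    have close: "b\<^sup>2 * ((norm (u - U n))\<^sup>2 + (norm (v - V n))\<^sup>2) \<le> (norm (T n u - A u))\<^sup>2 + (norm (T n v - A v))\<^sup>2" for n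
    proof (rule resolvent_perturbation[OF T_lin T_sa b])
      have "T n (u - U n) - a *\<^sub>R (u - U n) + b *\<^sub>R (v - V n)
          = (T n u - a *\<^sub>R u + b *\<^sub>R v) - (T n (U n) - a *\<^sub>R U n + b *\<^sub>R V n)"
        by (simp add: linear_diff[OF T_lin] algebra_simps)
      also have "\<dots> = T n u - A u" unfolding UV(1) uv(1)[symmetric] by simp
      finally show "T n (u - U n) - a *\<^sub>R (u - U n) + b *\<^sub>R (v - V n) = T n u - A u" .
      have "T n (v - V n) - a *\<^sub>R (v - V n) - b *\<^sub>R (u - U n)
          = (T n v - a *\<^sub>R v - b *\<^sub>R u) - (T n (V n) - a *\<^sub>R V n - b *\<^sub>R U n)"
        by (simp add: linear_diff[OF T_lin] algebra_simps)
      also have "\<dots> = T n v - A v" unfolding UV(2) uv(2)[symmetric] by simp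
      finally show "T n (v - V n) - a *\<^sub>R (v - V n) - b *\<^sub>R (u - U n) = T n v - A v" .
    qed
    have dlim: "d \<longlonglongrightarrow> 0"
    proof -
      have "d \<longlonglongrightarrow> ((norm (A u - A u))\<^sup>2 + (norm (A v - A v))\<^sup>2) / b\<^sup>2"
        unfolding d_def by (intro tendsto_intros T_lim) (use b in simp)
      then show ?thesis by simp
    qed
    have lim: "W \<longlonglongrightarrow> w" if W: "\<And>n. (norm (w - W n))\<^sup>2 \<le> d n" for W and w :: ell2
    proof -
      have "(\<lambda>n. (norm (w - W n))\<^sup>2) \<longlonglongrightarrow> 0"
        by (rule tendsto_sandwich[OF _ _ tendsto_const dlim]) (auto simp: W)
      from tendsto_real_sqrt[OF this] have "(\<lambda>n. norm (w - W n)) \<longlonglongrightarrow> 0" by simp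
      then show ?thesis
        by (subst LIM_zero_iff[symmetric], subst tendsto_norm_zero_iff[symmetric])
          (simp add: norm_minus_commute)
    qed
    have b2: "0 < b\<^sup>2" using b by simp
    have cl: "(norm (u - U n))\<^sup>2 + (norm (v - V n))\<^sup>2 \<le> d n" for n
      unfolding d_def using close[of n] b2 by (subst pos_le_divide_eq) (simp_all add: mult.commute)
    have "(norm (u - U n))\<^sup>2 \<le> d n" "(norm (v - V n))\<^sup>2 \<le> d n" for n
      using cl[of n] zero_le_power2[of "norm (u - U n)"] zero_le_power2[of "norm (v - V n)"] by linarith+
    then have "U \<longlonglongrightarrow> u" "V \<longlonglongrightarrow> v" using lim by blast+
    then have "(\<lambda>n. coord (U (r n)) x) \<longlonglongrightarrow> coord u x" "(\<lambda>n. coord (V (r n)) x) \<longlonglongrightarrow> coord v x"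
      using LIMSEQ_subseq_LIMSEQ[OF tendsto_coord r(1)] by (auto simp: o_def)
    then have 1: "(\<lambda>n. \<integral>\<xi>. (\<xi> - a) / ((\<xi> - a)\<^sup>2 + b\<^sup>2) \<partial>\<mu> (r n)) \<longlonglongrightarrow> coord u x"
      and 2: "(\<lambda>n. \<integral>\<xi>. b / ((\<xi> - a)\<^sup>2 + b\<^sup>2) \<partial>\<mu> (r n)) \<longlonglongrightarrow> coord v x"
      using UV(3,4) by (simp_all add: e_def)
    have den: "0 < (\<xi> - a)\<^sup>2 + b\<^sup>2" for \<xi> using b2 by (simp add: add_nonneg_pos)
    have den': "(\<xi> - a)\<^sup>2 + b\<^sup>2 \<noteq> 0" for \<xi> using den[of \<xi>] by linarith
    have "\<bar>\<xi> - a\<bar> * \<bar>b\<bar> \<le> (\<xi> - a)\<^sup>2 + b\<^sup>2" for \<xi>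
      using sum_squares_bound[of "\<bar>\<xi> - a\<bar>" "\<bar>b\<bar>"] mult_nonneg_nonneg[of "\<bar>\<xi> - a\<bar>" "\<bar>b\<bar>"] by (simp only: power2_abs) linarith
    then have K1: "norm ((\<xi> - a) / ((\<xi> - a)\<^sup>2 + b\<^sup>2)) \<le> 1 / \<bar>b\<bar>" for \<xi>
      using den[of \<xi>] b by (simp add: field_simps)
    have K2: "norm (b / ((\<xi> - a)\<^sup>2 + b\<^sup>2)) \<le> \<bar>b\<bar> / b\<^sup>2" for \<xi>
      using den[of \<xi>] b2 by (simp add: frac_le)
    have "(\<lambda>n. \<integral>\<xi>. (\<xi> - a) / ((\<xi> - a)\<^sup>2 + b\<^sup>2) \<partial>\<mu> (r n)) \<longlonglongrightarrow> (\<integral>\<xi>. (\<xi> - a) / ((\<xi> - a)\<^sup>2 + b\<^sup>2) \<partial>M)"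
      by (rule conv[OF _ K1]) (intro continuous_intros den')
    moreover have "(\<lambda>n. \<integral>\<xi>. b / ((\<xi> - a)\<^sup>2 + b\<^sup>2) \<partial>\<mu> (r n)) \<longlonglongrightarrow> (\<integral>\<xi>. b / ((\<xi> - a)\<^sup>2 + b\<^sup>2) \<partial>M)"
      by (rule conv[OF _ K2]) (intro continuous_intros den')
    ultimately show ?thesis using 1 2 LIMSEQ_unique by blast
  qed
  then show ?thesis using r(2) unfolding e_def by blast
qed

subsection \<open>Stieltjes inversion\<close>

text \<open>The limiting step function has the value 0 at its jump, so an atom there is counted by
  half; this is why atoms are recovered separately below.\<close>

lemma arctan_eps_lim:
  "(\<lambda>n. arctan (x * real (Suc n))) \<longlonglongrightarrow> pi / 2 * sgn x"
proof -
  have lin: "filterlim (\<lambda>n. y * real (Suc n)) at_top sequentially" if "0 < y" for y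
  proof (rule filterlim_tendsto_pos_mult_at_top[OF tendsto_const that])
    show "filterlim (\<lambda>n. real (Suc n)) at_top sequentially"
      by (rule filterlim_compose[OF filterlim_real_sequentially filterlim_Suc])
  qed
  have pos: "(\<lambda>n. arctan (y * real (Suc n))) \<longlonglongrightarrow> pi / 2" if "0 < y" for y
    by (rule filterlim_compose[OF tendsto_arctan_at_top lin[OF that]])
  consider "x = 0" | "0 < x" | "x < 0" by linarith
  then show ?thesis
  proof cases
    case 3
    then have "(\<lambda>n. - arctan (- x * real (Suc n))) \<longlonglongrightarrow> - (pi / 2)"
      by (intro tendsto_minus pos) simp
    then show ?thesis using 3 by (simp add: arctan_minus)
  qed (use pos[of x] in auto)
qed

lemma poisson_integral:
  fixes b \<xi> :: real
  assumes "a \<le> c" "b > 0"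
  shows "(LINT x|lborel. indicator {a..c} x * (b / ((\<xi> - x)\<^sup>2 + b\<^sup>2))) = arctan ((c - \<xi>) / b) - arctan ((a - \<xi>) / b)"
proof -
  have den: "(\<xi> - x)\<^sup>2 + b\<^sup>2 \<noteq> 0" for x
    using assms(2) by (simp add: add_nonneg_eq_0_iff)
  have "(LINT x|lborel. indicator {a..c} x *\<^sub>R (b / ((\<xi> - x)\<^sup>2 + b\<^sup>2))) = arctan ((c - \<xi>) / b) - arctan ((a - \<xi>) / b)"
  proof (rule integral_FTC_atLeastAtMost[OF assms(1)])
    fix x
    have "((\<lambda>x. arctan ((x - \<xi>) / b)) has_real_derivative (1 / b) / (1 + ((x - \<xi>) / b)\<^sup>2)) (at x within {a..c})"
      using assms(2) by (auto intro!: derivative_eq_intros simp: field_simps)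
    moreover have "(1 / b) / (1 + ((x - \<xi>) / b)\<^sup>2) = b / ((\<xi> - x)\<^sup>2 + b\<^sup>2)"
    proof -
      have "1 + ((x - \<xi>) / b)\<^sup>2 = ((\<xi> - x)\<^sup>2 + b\<^sup>2) / b\<^sup>2"
        using assms(2) by (simp add: power_divide power2_commute[of x \<xi>] add_divide_distrib)
      then show ?thesis using assms(2) by (simp add: power2_eq_square)
    qed
    ultimately show "((\<lambda>x. arctan ((x - \<xi>) / b)) has_vector_derivative b / ((\<xi> - x)\<^sup>2 + b\<^sup>2)) (at x within {a..c})"
      by (simp add: has_real_derivative_iff_has_vector_derivative)
  next
    show "continuous_on {a..c} (\<lambda>x. b / ((\<xi> - x)\<^sup>2 + b\<^sup>2))"
      by (intro continuous_intros ballI den)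
  qed
  then show ?thesis by simp
qed

lemma poisson_fubini:
  assumes "real_distribution M" "a \<le> c" "b > 0"
  shows "(LINT x|lborel. indicator {a..c} x * (\<integral>\<xi>. b / ((\<xi> - x)\<^sup>2 + b\<^sup>2) \<partial>M))
    = (\<integral>\<xi>. arctan ((c - \<xi>) / b) - arctan ((a - \<xi>) / b) \<partial>M)"
proof -
  interpret M: real_distribution M by fact
  interpret P: pair_sigma_finite M lborel ..
  define f where "f \<xi> x = indicator {a..c} x * (b / ((\<xi> - x)\<^sup>2 + b\<^sup>2))" for \<xi> x :: real
  have meas: "(\<lambda>(\<xi>, x). f \<xi> x) \<in> borel_measurable (M \<Otimes>\<^sub>M lborel)"
    unfolding f_def by measurable
  have le: "norm (f \<xi> x) \<le> indicator {a..c} x * (1 / b)" for \<xi> x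
  proof -
    have "b / ((\<xi> - x)\<^sup>2 + b\<^sup>2) \<le> b / b\<^sup>2"
      using assms(3) by (intro divide_left_mono) (simp_all add: add_nonneg_pos)
    also have "\<dots> = 1 / b" by (simp add: power2_eq_square)
    finally have "b / ((\<xi> - x)\<^sup>2 + b\<^sup>2) \<le> 1 / b" .
    moreover have "0 \<le> b / ((\<xi> - x)\<^sup>2 + b\<^sup>2)" using assms(3) by simp
    ultimately show ?thesis using assms(3) by (simp add: f_def indicator_def)
  qed
  have "integrable (M \<Otimes>\<^sub>M lborel) (\<lambda>(\<xi>, x). indicator {a..c} x * (1 / b))"
  proof (rule P.Fubini_integrable)
    show "(\<lambda>(\<xi>, x). indicator {a..c} x * (1 / b)) \<in> borel_measurable (M \<Otimes>\<^sub>M lborel)" by measurable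
    show "AE \<xi> in M. integrable lborel (\<lambda>x. case (\<xi>, x) of (\<xi>, x) \<Rightarrow> indicator {a..c} x * (1 / b))"
      by (rule AE_I2, unfold prod.case, rule integrable_mult_left, rule integrable_real_indicator)
        (simp_all add: emeasure_lborel_Icc_eq)
  qed simp
  then have "integrable (M \<Otimes>\<^sub>M lborel) (\<lambda>(\<xi>, x). f \<xi> x)"
    by (rule Bochner_Integration.integrable_bound) (use meas le assms(3) in \<open>auto simp: split_beta\<close>)
  from P.Fubini_integral[OF this]
  have "(\<integral>x. (\<integral>\<xi>. f \<xi> x \<partial>M) \<partial>lborel) = (\<integral>\<xi>. (\<integral>x. f \<xi> x \<partial>lborel) \<partial>M)" .
  moreover have "(\<integral>\<xi>. f \<xi> x \<partial>M) = indicator {a..c} x * (\<integral>\<xi>. b / ((\<xi> - x)\<^sup>2 + b\<^sup>2) \<partial>M)" for x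
    unfolding f_def by (rule integral_mult_right_zero)
  moreover have "(\<integral>x. f \<xi> x \<partial>lborel) = arctan ((c - \<xi>) / b) - arctan ((a - \<xi>) / b)" for \<xi>
    unfolding f_def by (rule poisson_integral[OF assms(2,3)])
  ultimately show ?thesis by simp
qed

text \<open>
  The Poisson integrals determine \<open>\<mu> {..<c} - \<mu> {c<..}\<close> by integrating over \<open>[a, c]\<close>, and the
  masses of points by evaluating at the point itself.
\<close>

lemma poisson_unique:
  assumes "real_distribution M1" "real_distribution M2"
    and eq: "\<And>a b. b > 0 \<Longrightarrow> (\<integral>\<xi>. b / ((\<xi> - a)\<^sup>2 + b\<^sup>2) \<partial>M1) = (\<integral>\<xi>. b / ((\<xi> - a)\<^sup>2 + b\<^sup>2) \<partial>M2)"
  shows "M1 = M2"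
proof -
  have bnd: "\<bar>arctan x\<bar> \<le> 2" for x
    using arctan_bounded[of x] pi_less_4 by linarith
  have lim1: "(\<lambda>n. \<integral>\<xi>. arctan ((c - \<xi>) * real (Suc n)) - arctan ((a - \<xi>) * real (Suc n)) \<partial>M)
      \<longlonglongrightarrow> (\<integral>\<xi>. pi / 2 * sgn (c - \<xi>) - pi / 2 * sgn (a - \<xi>) \<partial>M)" if "real_distribution M" for M a c
  proof -
    interpret real_distribution M by fact
    show ?thesis
    proof (rule integral_dominated_convergence[where w = "\<lambda>_. 4"])
      show "AE \<xi> in M. (\<lambda>n. arctan ((c - \<xi>) * real (Suc n)) - arctan ((a - \<xi>) * real (Suc n)))
          \<longlonglongrightarrow> pi / 2 * sgn (c - \<xi>) - pi / 2 * sgn (a - \<xi>)"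
        by (intro AE_I2 tendsto_diff arctan_eps_lim)
      show "AE \<xi> in M. norm (arctan ((c - \<xi>) * real (Suc n)) - arctan ((a - \<xi>) * real (Suc n))) \<le> 4" for n
      proof (rule AE_I2)
        fix \<xi>
        show "norm (arctan ((c - \<xi>) * real (Suc n)) - arctan ((a - \<xi>) * real (Suc n))) \<le> 4"
          using bnd[of "(c - \<xi>) * real (Suc n)"] bnd[of "(a - \<xi>) * real (Suc n)"] by (simp only: real_norm_def)
      qed
    qed simp_all
  qed
  \<comment> \<open>The left end of the integration interval is sent to minus infinity.\<close>
  have lim2: "(\<lambda>n. \<integral>\<xi>. pi / 2 * sgn (c - \<xi>) - pi / 2 * sgn (- real n - \<xi>) \<partial>M)
      \<longlonglongrightarrow> (\<integral>\<xi>. pi / 2 * sgn (c - \<xi>) + pi / 2 \<partial>M)" if "real_distribution M" for M c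
  proof -
    interpret real_distribution M by fact
    show ?thesis
    proof (rule integral_dominated_convergence[where w = "\<lambda>_. pi"])
      show "AE \<xi> in M. (\<lambda>n. pi / 2 * sgn (c - \<xi>) - pi / 2 * sgn (- real n - \<xi>))
          \<longlonglongrightarrow> pi / 2 * sgn (c - \<xi>) + pi / 2"
      proof (rule AE_I2, rule tendsto_eventually)
        fix \<xi> :: real
        obtain N :: nat where N: "- \<xi> < real N" using reals_Archimedean2 by blast
        show "\<forall>\<^sub>F n in sequentially. pi / 2 * sgn (c - \<xi>) - pi / 2 * sgn (- real n - \<xi>) = pi / 2 * sgn (c - \<xi>) + pi / 2"
          using eventually_ge_at_top[of N]
        proof eventually_elim
          case (elim n)
          then have "- real n - \<xi> < 0" using N by linarith
          then show ?case by simp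
        qed
      qed
      show "AE \<xi> in M. norm (pi / 2 * sgn (c - \<xi>) - pi / 2 * sgn (- real n - \<xi>)) \<le> pi" for n
        by (rule AE_I2) (auto simp: sgn_if)
    qed simp_all
  qed
  have fubini: "(\<integral>\<xi>. arctan ((c - \<xi>) * real (Suc n)) - arctan ((a - \<xi>) * real (Suc n)) \<partial>M1) =
      (\<integral>\<xi>. arctan ((c - \<xi>) * real (Suc n)) - arctan ((a - \<xi>) * real (Suc n)) \<partial>M2)" if "a \<le> c" for a c n
    using poisson_fubini[OF assms(1) that, of "1 / real (Suc n)"] poisson_fubini[OF assms(2) that, of "1 / real (Suc n)"]
      eq[of "1 / real (Suc n)"] by simp
  have sgn_eq: "(\<integral>\<xi>. pi / 2 * sgn (c - \<xi>) - pi / 2 * sgn (a - \<xi>) \<partial>M1) =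
      (\<integral>\<xi>. pi / 2 * sgn (c - \<xi>) - pi / 2 * sgn (a - \<xi>) \<partial>M2)" if "a \<le> c" for a c
    using LIMSEQ_unique[OF lim1[OF assms(1), of c a] lim1[OF assms(2), of c a, folded fubini[OF that]]] .
  have sgn_eq': "(\<integral>\<xi>. pi / 2 * sgn (c - \<xi>) + pi / 2 \<partial>M1) = (\<integral>\<xi>. pi / 2 * sgn (c - \<xi>) + pi / 2 \<partial>M2)" for c
  proof (rule LIMSEQ_unique[OF lim2[OF assms(1)]])
    obtain N :: nat where N: "- c < real N" using reals_Archimedean2 by blast
    have "\<forall>\<^sub>F n in sequentially. (\<integral>\<xi>. pi / 2 * sgn (c - \<xi>) - pi / 2 * sgn (- real n - \<xi>) \<partial>M2) =
       (\<integral>\<xi>. pi / 2 * sgn (c - \<xi>) - pi / 2 * sgn (- real n - \<xi>) \<partial>M1)"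
      using eventually_ge_at_top[of N]
    proof eventually_elim
      case (elim n)
      then show ?case using N by (intro sgn_eq[symmetric]) linarith
    qed
    then show "(\<lambda>n. \<integral>\<xi>. pi / 2 * sgn (c - \<xi>) - pi / 2 * sgn (- real n - \<xi>) \<partial>M1)
      \<longlonglongrightarrow> (\<integral>\<xi>. pi / 2 * sgn (c - \<xi>) + pi / 2 \<partial>M2)"
      using lim2[OF assms(2), of c] by (rule Lim_transform_eventually[rotated])
  qed
  \<comment> \<open>With \<open>b = 1 / Suc n\<close>, the Poisson kernel centred at
    \<open>c\<close>, multiplied by \<open>b\<close>, is \<open>1 / (((x - c) / b)^2 + 1)\<close>,
    which tends to the indicator of \<open>c\<close>.\<close>
  have lim3: "(\<lambda>n. 1 / real (Suc n) * (\<integral>\<xi>. (1 / real (Suc n)) / ((\<xi> - c)\<^sup>2 + (1 / real (Suc n))\<^sup>2) \<partial>M)) \<longlonglongrightarrow> measure M {c}"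
    if "real_distribution M" for M c
  proof -
    interpret real_distribution M by fact
    define g where "g n \<xi> = 1 / (((\<xi> - c) * real (Suc n))\<^sup>2 + 1)" for n \<xi>
    have g: "1 / real (Suc n) * ((1 / real (Suc n)) / ((\<xi> - c)\<^sup>2 + (1 / real (Suc n))\<^sup>2)) = g n \<xi>" for n \<xi>
    proof -
      define k where "k = real (Suc n)"
      have k: "k \<noteq> 0" by (simp add: k_def)
      have "1 / k * ((1 / k) / ((\<xi> - c)\<^sup>2 + (1 / k)\<^sup>2)) = 1 / (k\<^sup>2 * ((\<xi> - c)\<^sup>2 + (1 / k)\<^sup>2))"
        by (simp add: power2_eq_square)
      also have "k\<^sup>2 * ((\<xi> - c)\<^sup>2 + (1 / k)\<^sup>2) = ((\<xi> - c) * k)\<^sup>2 + 1"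
        using k by (simp add: distrib_left power_divide power_mult_distrib mult.commute)
      finally show ?thesis unfolding g_def k_def .
    qed
    have "(\<lambda>n. \<integral>\<xi>. g n \<xi> \<partial>M) \<longlonglongrightarrow> (\<integral>\<xi>. indicator {c} \<xi> \<partial>M)"
    proof (rule integral_dominated_convergence[where w = "\<lambda>_. 1"])
      show "AE \<xi> in M. (\<lambda>n. g n \<xi>) \<longlonglongrightarrow> indicator {c} \<xi>"
      proof (rule AE_I2)
        fix \<xi>
        show "(\<lambda>n. g n \<xi>) \<longlonglongrightarrow> indicator {c} \<xi>"
        proof (cases "\<xi> = c")
          case False
          have lim: "(\<lambda>n. 1 / (real (Suc n))\<^sup>2) \<longlonglongrightarrow> 0"
            using LIMSEQ_Suc[OF lim_inverse_n'] by (auto simp: power_one_over[symmetric] intro: tendsto_eq_intros)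
          have "(\<lambda>n. (1 / (real (Suc n))\<^sup>2) / ((\<xi> - c)\<^sup>2 + 1 / (real (Suc n))\<^sup>2)) \<longlonglongrightarrow> 0 / ((\<xi> - c)\<^sup>2 + 0)"
            using False by (intro tendsto_intros lim) simp
          moreover have "(1 / (real (Suc n))\<^sup>2) / ((\<xi> - c)\<^sup>2 + 1 / (real (Suc n))\<^sup>2) = g n \<xi>" for n
            unfolding g[symmetric]
            by (simp only: power_one_over[symmetric]) (simp only: power2_eq_square times_divide_eq_right)
          ultimately show ?thesis using False by simp
        qed (simp add: g_def)
      qed
      show "AE \<xi> in M. norm (g n \<xi>) \<le> 1" for n
        by (rule AE_I2) (simp add: g_def divide_le_eq_1 add_nonneg_pos)
    qed (simp_all add: g_def)
    moreover have "(\<integral>\<xi>. g n \<xi> \<partial>M) = 1 / real (Suc n) * (\<integral>\<xi>. (1 / real (Suc n)) / ((\<xi> - c)\<^sup>2 + (1 / real (Suc n))\<^sup>2) \<partial>M)" for n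
      unfolding g[symmetric] by (rule integral_mult_right_zero)
    ultimately show ?thesis by simp
  qed
  have atom: "measure M1 {c} = measure M2 {c}" for c
  proof -
    have "(\<integral>\<xi>. (1 / real (Suc n)) / ((\<xi> - c)\<^sup>2 + (1 / real (Suc n))\<^sup>2) \<partial>M1) =
        (\<integral>\<xi>. (1 / real (Suc n)) / ((\<xi> - c)\<^sup>2 + (1 / real (Suc n))\<^sup>2) \<partial>M2)" for n
      by (rule eq) simp
    from LIMSEQ_unique[OF lim3[OF assms(1), of c, unfolded this] lim3[OF assms(2), of c]]
    show ?thesis .
  qed
  \<comment> \<open>At the point \<open>c\<close> the integrand is \<open>pi / 2\<close>, so the
    integral is \<open>pi\<close> times the mass below \<open>c\<close> plus half of
    \<open>pi\<close> times the atom; one more atom completes twice the mass of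
    \<open>{..c}\<close>.\<close>
  have cdf: "2 * cdf M c = measure M {c} + 2 / pi * (\<integral>\<xi>. pi / 2 * sgn (c - \<xi>) + pi / 2 \<partial>M)"
    if "real_distribution M" for M c
  proof -
    interpret real_distribution M by fact
    have "measure M {c} + 2 * (\<integral>\<xi>. indicator {..<c} \<xi> \<partial>M) + measure M {c} = 2 * measure M ({..<c} \<union> {c})"
      by (subst finite_measure_Union) auto
    also have "{..<c} \<union> {c} = {..c}" by auto
    finally have *: "2 * cdf M c = 2 * (\<integral>\<xi>. indicator {..<c} \<xi> \<partial>M) + 2 * measure M {c}" by (simp add: cdf_def)
    have "(\<integral>\<xi>. pi / 2 * sgn (c - \<xi>) + pi / 2 \<partial>M) = (\<integral>\<xi>. pi * indicator {..<c} \<xi> + pi / 2 * indicator {c} \<xi> \<partial>M)"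
      by (rule Bochner_Integration.integral_cong) (auto simp: sgn_if indicator_def)
    also have "\<dots> = pi * (\<integral>\<xi>. indicator {..<c} \<xi> \<partial>M) + pi / 2 * measure M {c}"
    proof -
      have i: "integrable M (indicat_real A)" if "A \<in> sets borel" for A
        by (rule integrable_real_indicator) (use that in \<open>auto simp: less_top[symmetric]\<close>)
      show ?thesis
        by (subst Bochner_Integration.integral_add) (auto intro!: integrable_mult_right i)
    qed
    finally show ?thesis using * by (simp add: field_simps)
  qed
  have "cdf M1 = cdf M2"
  proof
    fix c
    have "2 * cdf M1 c = 2 * cdf M2 c" unfolding cdf[OF assms(1)] cdf[OF assms(2)] by (simp only: atom sgn_eq')
    then show "cdf M1 c = cdf M2 c" by simp
  qed
  then show ?thesis by (rule cdf_unique[OF assms(1,2)])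
qed

section \<open>Adjacency operators of graphs of bounded degree\<close>

text \<open>Sequences are indexed by all of \<open>nat\<close>, while \<open>verts G\<close> may be
  smaller. Indices outside have no neighbours, so the adjacency operator vanishes there.\<close>

locale bounded_graph =
  fixes G :: "nat graph" and D :: nat
  assumes simple: "simple_graph G"
    and finite_nbrs: "\<And>x. x \<in> verts G \<Longrightarrow> finite (neighbours G x)"
    and degree_le: "\<And>x. x \<in> verts G \<Longrightarrow> vertex_degree G x \<le> D"
begin

abbreviation N :: "nat \<Rightarrow> nat set" where "N \<equiv> neighbours G"

lemma nbr_sym: "y \<in> N x \<longleftrightarrow> x \<in> N y"
  by (simp add: neighbours_def insert_commute)

lemma nbr_verts: "y \<in> N x \<Longrightarrow> x \<in> verts G \<and> y \<in> verts G \<and> x \<noteq> y"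
  using simple unfolding simple_graph_def neighbours_def by (fastforce simp: doubleton_eq_iff)

lemma nbrs_outside: "x \<notin> verts G \<Longrightarrow> N x = {}"
  using nbr_verts by blast

lemma finite_N [simp]: "finite (N x)"
  using finite_nbrs nbrs_outside by (cases "x \<in> verts G") simp_all

lemma card_N: "card (N x) \<le> D"
  using degree_le nbrs_outside unfolding vertex_degree_def by (cases "x \<in> verts G") simp_all

text \<open>Schur test: Cauchy-Schwarz costs a factor \<open>D\<close> in each row, and exchanging
  the sums counts each coordinate at most \<open>D\<close> times.\<close>

lemma adjacency_bounded:
  "\<exists>w. coord w = (\<lambda>x. \<Sum>y\<in>N x. coord u y) \<and> norm w \<le> D * norm u"
proof (rule ell2_boundedI)
  fix n
  define Y where "Y = (\<Union>x<n. N x)"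
  have finY: "finite Y" by (simp add: Y_def)
  have "(\<Sum>x<n. (\<Sum>y\<in>N x. coord u y)\<^sup>2) \<le> (\<Sum>x<n. D * (\<Sum>y\<in>N x. (coord u y)\<^sup>2))"
  proof (rule sum_mono)
    fix x
    have "(\<Sum>y\<in>N x. coord u y)\<^sup>2 \<le> (\<Sum>y\<in>N x. (coord u y)\<^sup>2) * card (N x)"
      by (rule sum_squared_le_sum_of_squares)
    also have "\<dots> \<le> (\<Sum>y\<in>N x. (coord u y)\<^sup>2) * D"
      using card_N by (intro mult_left_mono) (simp_all add: sum_nonneg)
    finally show "(\<Sum>y\<in>N x. coord u y)\<^sup>2 \<le> D * (\<Sum>y\<in>N x. (coord u y)\<^sup>2)" by (simp add: mult.commute)
  qed
  also have "\<dots> = D * (\<Sum>x<n. \<Sum>y\<in>{y\<in>Y. y \<in> N x}. (coord u y)\<^sup>2)"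
  proof -
    have "N x = {y\<in>Y. y \<in> N x}" if "x < n" for x using that by (auto simp: Y_def)
    then show ?thesis by (simp add: sum_distrib_left)
  qed
  also have "(\<Sum>x<n. \<Sum>y\<in>{y\<in>Y. y \<in> N x}. (coord u y)\<^sup>2) = (\<Sum>y\<in>Y. \<Sum>x\<in>{x\<in>{..<n}. y \<in> N x}. (coord u y)\<^sup>2)"
    by (rule sum.swap_restrict) (simp_all add: finY)
  also have "\<dots> \<le> (\<Sum>y\<in>Y. D * (coord u y)\<^sup>2)"
  proof (rule sum_mono)
    fix y
    have "card {x\<in>{..<n}. y \<in> N x} \<le> card (N y)"
      by (rule card_mono) (auto simp: nbr_sym)
    then have "card {x\<in>{..<n}. y \<in> N x} \<le> D" using card_N order_trans by blast
    then show "(\<Sum>x\<in>{x\<in>{..<n}. y \<in> N x}. (coord u y)\<^sup>2) \<le> D * (coord u y)\<^sup>2"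
      by (simp add: mult_right_mono)
  qed
  also have "(\<Sum>y\<in>Y. D * (coord u y)\<^sup>2) \<le> D * (norm u)\<^sup>2"
    using sum_coord_sq_le[OF finY, of u] by (simp add: sum_distrib_left[symmetric] mult_left_mono)
  finally show "(\<Sum>x<n. (\<Sum>y\<in>N x. coord u y)\<^sup>2) \<le> (D * norm u)\<^sup>2"
    by (simp add: power_mult_distrib power2_eq_square[of "real D"] mult_left_mono)
qed simp

definition adj :: "ell2 \<Rightarrow> ell2" where
  "adj u = (SOME w. coord w = (\<lambda>x. \<Sum>y\<in>N x. coord u y) \<and> norm w \<le> D * norm u)"

lemma coord_adj: "coord (adj u) x = (\<Sum>y\<in>N x. coord u y)"
  and norm_adj: "norm (adj u) \<le> D * norm u"
  using someI_ex[OF adjacency_bounded[of u]] unfolding adj_def by simp_all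

lemma linear_adj: "linear adj"
  by (rule linearI; rule ell2_eqI) (simp_all add: coord_adj sum.distrib sum_distrib_left)

lemmas adj_simps = linear_add[OF linear_adj] linear_diff[OF linear_adj] linear_scale[OF linear_adj]

lemma bounded_linear_adj: "bounded_linear adj"
  using norm_adj by (intro bounded_linear_intro[where K = "real D"]) (simp_all add: adj_simps mult.commute)

lemma adj_delta: "adj (delta_vec x) = (\<Sum>y\<in>N x. delta_vec y)"
  by (rule ell2_eqI) (auto simp: coord_adj coord_sum nbr_sym)

text \<open>Checked on truncations, where it is a finite sum, and extended by continuity.\<close>

lemma self_adjoint_adj: "inner (adj u) v = inner u (adj v)"
proof -
  have fin: "inner (adj (restr {..<n} u)) v = inner (restr {..<n} u) (adj v)" for n
    by (simp add: restr_finite linear_sum[OF linear_adj] adj_simps adj_delta inner_sum_left coord_adj)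
  have "(\<lambda>n. inner (adj (restr {..<n} u)) v) \<longlonglongrightarrow> inner (adj u) v"
    by (intro tendsto_intros bounded_linear.tendsto[OF bounded_linear_adj] restr_tendsto)
  moreover have "(\<lambda>n. inner (restr {..<n} u) (adj v)) \<longlonglongrightarrow> inner u (adj v)"
    by (intro tendsto_intros restr_tendsto)
  ultimately show ?thesis unfolding fin by (rule LIMSEQ_unique)
qed

text \<open>The operator norm is at most \<open>D + |t|\<close>; the summand 1 keeps the constant
  positive when both vanish. The same constant appears in \<open>contract_fun\<close>.\<close>

lemma self_adjoint_shift:
  fixes t :: real
  shows "self_adjoint_operator (\<lambda>u. adj u - t *\<^sub>R u) ((real D + \<bar>t\<bar> + 1)\<^sup>2)"
proof (rule self_adjoint_operator.intro)
  show "linear (\<lambda>u. adj u - t *\<^sub>R u)"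
    by (rule linearI) (simp_all add: adj_simps algebra_simps)
  show "inner (adj u - t *\<^sub>R u) v = inner u (adj v - t *\<^sub>R v)" for u v
    by (simp add: inner_diff_left inner_diff_right self_adjoint_adj)
  show "(norm (adj u - t *\<^sub>R u))\<^sup>2 \<le> (real D + \<bar>t\<bar> + 1)\<^sup>2 * (norm u)\<^sup>2" for u
  proof -
    have "norm (adj u - t *\<^sub>R u) \<le> norm (adj u) + norm (t *\<^sub>R u)" by (rule norm_triangle_ineq4)
    also have "\<dots> \<le> real D * norm u + \<bar>t\<bar> * norm u" using norm_adj[of u] by simp
    also have "\<dots> \<le> (real D + \<bar>t\<bar> + 1) * norm u" by (simp add: algebra_simps)
    finally have "(norm (adj u - t *\<^sub>R u))\<^sup>2 \<le> ((real D + \<bar>t\<bar> + 1) * norm u)\<^sup>2" by (rule power_mono) simp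
    then show ?thesis by (simp add: power_mult_distrib)
  qed
  show "0 < (real D + \<bar>t\<bar> + 1)\<^sup>2" by (simp add: add_nonneg_eq_0_iff zero_less_power2)
qed

subsection \<open>The adjacency operator on complex functions\<close>

text \<open>Complex vectors are pairs of real ones, on which the real operator \<open>adj\<close>
  acts componentwise.\<close>

definition cvec :: "ell2 \<Rightarrow> ell2 \<Rightarrow> nat \<Rightarrow> complex" where
  "cvec u v = (\<lambda>n. Complex (coord u n) (coord v n))"

definition supported :: "ell2 \<Rightarrow> bool" where
  "supported u \<longleftrightarrow> (\<forall>x. x \<notin> verts G \<longrightarrow> coord u x = 0)"

lemma supported_adj: "supported (adj u)"
  by (simp add: supported_def coord_adj nbrs_outside)

lemma cvec_diff: "(\<lambda>x. cvec u v x - cvec p q x) = cvec (u - p) (v - q)"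
  by (auto simp: cvec_def fun_eq_iff complex_eq_iff)

lemma cvec_eq_iff: "cvec u v = cvec p q \<longleftrightarrow> u = p \<and> v = q"
  by (auto simp: cvec_def fun_eq_iff intro!: ell2_eqI)

lemma cvec_sums: "(\<lambda>n. (cmod (cvec u v n))\<^sup>2) sums ((norm u)\<^sup>2 + (norm v)\<^sup>2)"
  using sums_add[OF norm_ell2_sums[of u] norm_ell2_sums[of v]] by (simp add: cvec_def cmod_power2)

lemma l2_norm_cvec: "l2_norm (cvec u v) = sqrt ((norm u)\<^sup>2 + (norm v)\<^sup>2)"
  unfolding l2_norm_def using infsumI[OF sums_nonneg_imp_has_sum[OF cvec_sums[of u v]]] by simp

lemma l2_space_iff: "f \<in> l2_space (verts G) \<longleftrightarrow> (\<exists>u v. supported u \<and> supported v \<and> f = cvec u v)"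
proof
  assume f: "f \<in> l2_space (verts G)"
  then have z: "f x = 0" if "x \<notin> verts G" for x using that by (simp add: l2_space_def)
  have "(\<lambda>x. (cmod (f x))\<^sup>2) summable_on verts G" using f by (simp add: l2_space_def)
  then have "(\<lambda>x. (cmod (f x))\<^sup>2) summable_on UNIV"
    by (rule summable_on_cong_neutral[THEN iffD1, rotated 3]) (auto simp: z)
  then have s: "summable (\<lambda>x. (cmod (f x))\<^sup>2)" by (simp add: summable_on_UNIV_nonneg_real_iff)
  have "summable (\<lambda>x. (Re (f x))\<^sup>2)" "summable (\<lambda>x. (Im (f x))\<^sup>2)"
    by (rule summable_comparison_test'[OF s], simp add: cmod_power2)+
  then have "coord (Abs_ell2 (\<lambda>x. Re (f x))) = (\<lambda>x. Re (f x))" "coord (Abs_ell2 (\<lambda>x. Im (f x))) = (\<lambda>x. Im (f x))"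
    by (simp_all add: Abs_ell2_inverse)
  then show "\<exists>u v. supported u \<and> supported v \<and> f = cvec u v"
    by (intro exI[of _ "Abs_ell2 (\<lambda>x. Re (f x))"] exI[of _ "Abs_ell2 (\<lambda>x. Im (f x))"])
      (simp add: supported_def z cvec_def)
next
  assume "\<exists>u v. supported u \<and> supported v \<and> f = cvec u v"
  then obtain u v where uv: "supported u" "supported v" "f = cvec u v" by blast
  have "(\<lambda>x. (cmod (f x))\<^sup>2) summable_on UNIV"
    using sums_nonneg_imp_has_sum[OF cvec_sums[of u v]] uv(3) by (auto simp: summable_on_def)
  then have "(\<lambda>x. (cmod (f x))\<^sup>2) summable_on verts G"
    by (rule summable_on_subset_banach) simp
  then show "f \<in> l2_space (verts G)"
    using uv by (auto simp: l2_space_def supported_def cvec_def complex_eq_iff)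
qed

lemma l2_inner_cvec:
  "l2_inner (cvec u v) (cvec p q) = Complex (inner u p + inner v q) (inner u q - inner v p)"
proof -
  have "(\<lambda>n. Re (cnj (cvec u v n) * cvec p q n)) sums (inner u p + inner v q)"
    using sums_add[OF inner_ell2_sums[of u p] inner_ell2_sums[of v q]] by (simp add: cvec_def)
  moreover have "(\<lambda>n. Im (cnj (cvec u v n) * cvec p q n)) sums (inner u q - inner v p)"
    using sums_diff[OF inner_ell2_sums[of u q] inner_ell2_sums[of v p]] by (simp add: cvec_def)
  ultimately have s: "(\<lambda>n. cnj (cvec u v n) * cvec p q n) sums Complex (inner u p + inner v q) (inner u q - inner v p)"
    by (simp add: sums_complex_iff)
  have "summable (\<lambda>n. norm (cnj (cvec u v n) * cvec p q n))"
  proof (rule summable_comparison_test')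
    show "summable (\<lambda>n. (cmod (cvec u v n))\<^sup>2 + (cmod (cvec p q n))\<^sup>2)"
      using cvec_sums[of u v] cvec_sums[of p q] by (intro summable_add) (auto simp: sums_iff)
    fix n
    have "2 * cmod (cvec u v n) * cmod (cvec p q n) \<le> (cmod (cvec u v n))\<^sup>2 + (cmod (cvec p q n))\<^sup>2"
      by (rule sum_squares_bound)
    moreover have "0 \<le> cmod (cvec u v n) * cmod (cvec p q n)" by simp
    ultimately have "cmod (cvec u v n) * cmod (cvec p q n) \<le> (cmod (cvec u v n))\<^sup>2 + (cmod (cvec p q n))\<^sup>2"
      by linarith
    then show "norm (norm (cnj (cvec u v n) * cvec p q n)) \<le> (cmod (cvec u v n))\<^sup>2 + (cmod (cvec p q n))\<^sup>2"
      by (simp add: norm_mult)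
  qed
  then show ?thesis
    unfolding l2_inner_def using s by (intro infsumI norm_summable_imp_has_sum) simp_all
qed

lemma basis_vec_cvec: "basis_vec x = cvec (delta_vec x) 0"
  by (auto simp: basis_vec_def cvec_def fun_eq_iff complex_eq_iff)

definition adjacency_graph :: "nat operator" where
  "adjacency_graph = {(cvec u v, cvec (adj u) (adj v)) | u v. supported u \<and> supported v}"

lemma adjacency_op_iff:
  "(f, g) \<in> adjacency_op G \<longleftrightarrow> (\<exists>u v. finite {x. coord u x \<noteq> 0 \<or> coord v x \<noteq> 0} \<and> supported u \<and> supported v \<and>
    f = cvec u v \<and> g = cvec (adj u) (adj v))"
proof -
  have app: "(\<Sum>y | cvec u v y \<noteq> 0. adj_entry G x y * cvec u v y) = cvec (adj u) (adj v) x"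
    if fin: "finite {y. cvec u v y \<noteq> 0}" for u v x
  proof -
    have "(\<Sum>y | cvec u v y \<noteq> 0. adj_entry G x y * cvec u v y) = (\<Sum>y\<in>{y. cvec u v y \<noteq> 0} \<inter> N x. cvec u v y)"
      unfolding sum.inter_restrict[OF fin]
      by (rule sum.cong) (auto simp: adj_entry_def neighbours_def)
    also have "\<dots> = (\<Sum>y\<in>N x. cvec u v y)" by (rule sum.mono_neutral_left) auto
    also have "\<dots> = cvec (adj u) (adj v) x"
      by (simp add: cvec_def coord_adj complex_eq_iff Re_sum Im_sum)
    finally show ?thesis .
  qed
  have ne: "cvec u v x \<noteq> 0 \<longleftrightarrow> coord u x \<noteq> 0 \<or> coord v x \<noteq> 0" for u v x
    by (auto simp: cvec_def complex_eq_iff)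
  show ?thesis
  proof
    assume "(f, g) \<in> adjacency_op G"
    then have f: "finite {x. f x \<noteq> 0}" "{x. f x \<noteq> 0} \<subseteq> verts G"
      and g: "g = (\<lambda>x. \<Sum>y | f y \<noteq> 0. adj_entry G x y * f y)" by (auto simp: adjacency_op_def)
    have "(\<lambda>x. (cmod (f x))\<^sup>2) summable_on verts G"
      by (rule summable_on_cong_neutral[THEN iffD1, rotated 3, OF summable_on_finite[OF f(1)]]) (use f(2) in auto)
    then have "f \<in> l2_space (verts G)" using f(2) by (auto simp: l2_space_def)
    then obtain u v where uv: "supported u" "supported v" "f = cvec u v" by (auto simp: l2_space_iff)
    then show "\<exists>u v. finite {x. coord u x \<noteq> 0 \<or> coord v x \<noteq> 0} \<and> supported u \<and> supported v \<and>
      f = cvec u v \<and> g = cvec (adj u) (adj v)"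
      using f(1) g app by (intro exI[of _ u] exI[of _ v]) (auto simp: ne fun_eq_iff)
  next
    assume "\<exists>u v. finite {x. coord u x \<noteq> 0 \<or> coord v x \<noteq> 0} \<and> supported u \<and> supported v \<and>
      f = cvec u v \<and> g = cvec (adj u) (adj v)"
    then obtain u v where uv: "finite {x. cvec u v x \<noteq> 0}" "supported u" "supported v"
      "f = cvec u v" "g = cvec (adj u) (adj v)" by (auto simp: ne)
    have "{x. cvec u v x \<noteq> 0} \<subseteq> verts G" using uv(2,3) by (auto simp: ne supported_def)
    moreover have "g = (\<lambda>x. \<Sum>y | f y \<noteq> 0. adj_entry G x y * f y)"
      unfolding uv(4,5) using app[OF uv(1)] by simp
    ultimately show "(f, g) \<in> adjacency_op G" using uv(1,4) by (auto simp: adjacency_op_def)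
  qed
qed

text \<open>Boundedness gives both inclusions: a limit of pairs in the graph is again such a pair,
  and truncations approximate a vector and its image at the same time.\<close>

lemma op_closure_adjacency: "op_closure (verts G) (adjacency_op G) = adjacency_graph"
proof (intro equalityI subsetI; clarify)
  fix f g assume fg: "(f, g) \<in> op_closure (verts G) (adjacency_op G)"
  then have "f \<in> l2_space (verts G)" "g \<in> l2_space (verts G)" by (auto simp: op_closure_def)
  then obtain u v p q where uv: "supported u" "supported v" "f = cvec u v"
    and pq: "g = cvec p q" unfolding l2_space_iff by blast
  have close: "norm (p - adj u) \<le> (real D + 1) * e \<and> norm (q - adj v) \<le> (real D + 1) * e" if e: "e > 0" for e :: real
  proof -
    from fg e obtain f' g' where fg': "(f', g') \<in> adjacency_op G"
      "l2_norm (\<lambda>x. f' x - f x) < e" "l2_norm (\<lambda>x. g' x - g x) < e"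
      unfolding op_closure_def by blast
    then obtain u' v' where u': "f' = cvec u' v'" "g' = cvec (adj u') (adj v')" unfolding adjacency_op_iff by blast
    have b: "norm a \<le> l2_norm (cvec a b)" "norm b \<le> l2_norm (cvec a b)" for a b
      unfolding l2_norm_cvec by (rule real_le_rsqrt, simp)+
    have "norm (u' - u) < e" "norm (v' - v) < e"
      using fg'(2) b[where a = "u' - u" and b = "v' - v"] unfolding u' uv cvec_diff by linarith+
    moreover have "norm (adj u' - p) < e" "norm (adj v' - q) < e"
      using fg'(3) b[where a = "adj u' - p" and b = "adj v' - q"] unfolding u' pq cvec_diff by linarith+
    moreover have "norm (r - adj w) \<le> (real D + 1) * e" if "norm (w' - w) < e" "norm (adj w' - r) < e" for r w w'
    proof -
      have "norm (r - adj w) = norm (adj (w' - w) - (adj w' - r))" by (simp add: adj_simps)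
      also have "\<dots> \<le> norm (adj (w' - w)) + norm (adj w' - r)" by (rule norm_triangle_ineq4)
      also have "\<dots> \<le> real D * e + e"
        using norm_adj[of "w' - w"] that mult_left_mono[of "norm (w' - w)" e "real D"] by linarith
      finally show ?thesis by (simp add: algebra_simps)
    qed
    ultimately show ?thesis by blast
  qed
  have "r = s" if "\<And>e. e > 0 \<Longrightarrow> norm (r - s) \<le> (real D + 1) * e" for r s :: ell2
  proof (rule ccontr)
    assume "r \<noteq> s"
    then have pos: "0 < norm (r - s)" by simp
    have "norm (r - s) \<le> (real D + 1) * (norm (r - s) / (2 * (real D + 1)))"
      by (rule that) (use pos in simp)
    also have "\<dots> = norm (r - s) / 2"
    proof -
      have "k * (c / (2 * k)) = c / 2" if "k \<noteq> 0" for k c :: real using that by simp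
      then show ?thesis by (metis of_nat_0_le_iff add_nonneg_eq_0_iff zero_le_one zero_neq_one)
    qed
    finally show False using pos by simp
  qed
  then have "p = adj u" "q = adj v" using close by blast+
  then show "(f, g) \<in> adjacency_graph" using uv pq unfolding adjacency_graph_def by blast
next
  fix f g assume "(f, g) \<in> adjacency_graph"
  then obtain u v where uv: "supported u" "supported v" "f = cvec u v" "g = cvec (adj u) (adj v)"
    unfolding adjacency_graph_def by blast
  have "\<exists>(f', g')\<in>adjacency_op G. l2_norm (\<lambda>x. f' x - f x) < e \<and> l2_norm (\<lambda>x. g' x - g x) < e"
    if e: "e > 0" for e
  proof -
    define F where "F n = l2_norm (\<lambda>x. cvec (restr {..<n} u) (restr {..<n} v) x - f x)" for n
    define H where "H n = l2_norm (\<lambda>x. cvec (adj (restr {..<n} u)) (adj (restr {..<n} v)) x - g x)" for n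
    have "F \<longlonglongrightarrow> sqrt ((norm (u - u))\<^sup>2 + (norm (v - v))\<^sup>2)"
      unfolding F_def uv cvec_diff l2_norm_cvec by (intro tendsto_intros restr_tendsto)
    moreover have "H \<longlonglongrightarrow> sqrt ((norm (adj u - adj u))\<^sup>2 + (norm (adj v - adj v))\<^sup>2)"
      unfolding H_def uv cvec_diff l2_norm_cvec
      by (intro tendsto_intros restr_tendsto bounded_linear.tendsto[OF bounded_linear_adj])
    ultimately have "F \<longlonglongrightarrow> 0" "H \<longlonglongrightarrow> 0" by simp_all
    then have "\<forall>\<^sub>F n in sequentially. F n < e \<and> H n < e"
      using e by (intro eventually_conj order_tendstoD(2))
    then obtain n where n: "F n < e" "H n < e" by (auto simp: eventually_sequentially)
    have "finite {x. coord (restr {..<n} u) x \<noteq> 0 \<or> coord (restr {..<n} v) x \<noteq> 0}"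
      by (rule finite_subset[of _ "{..<n}"]) auto
    moreover have "supported (restr {..<n} u)" "supported (restr {..<n} v)"
      using uv by (auto simp: supported_def)
    ultimately have "(cvec (restr {..<n} u) (restr {..<n} v), cvec (adj (restr {..<n} u)) (adj (restr {..<n} v))) \<in> adjacency_op G"
      unfolding adjacency_op_iff by blast
    then show ?thesis using n unfolding F_def H_def by blast
  qed
  moreover have "f \<in> l2_space (verts G)" "g \<in> l2_space (verts G)"
    using uv supported_adj unfolding l2_space_iff by blast+
  ultimately show "(f, g) \<in> op_closure (verts G) (adjacency_op G)" by (simp add: op_closure_def)
qed

text \<open>Testing the adjoint on basis vectors of \<open>verts G\<close> determines the
  coordinates there; at all other indices both sides vanish.\<close>

lemma self_adjoint_graph: "self_adjoint_graph G"
  unfolding self_adjoint_graph_def essentially_self_adjoint_def self_adjoint_op_def op_closure_adjacency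
proof (intro equalityI subsetI; clarify)
  fix g h assume "(g, h) \<in> op_adjoint (verts G) adjacency_graph"
  then have l2: "g \<in> l2_space (verts G)" "h \<in> l2_space (verts G)"
    and eq: "\<And>f k. (f, k) \<in> adjacency_graph \<Longrightarrow> l2_inner g k = l2_inner h f"
    by (auto simp: op_adjoint_def)
  then obtain u v p q where uv: "supported u" "supported v" "g = cvec u v"
    and pq: "supported p" "supported q" "h = cvec p q" unfolding l2_space_iff by blast
  have "coord (adj u) x = coord p x \<and> coord (adj v) x = coord q x" for x
  proof (cases "x \<in> verts G")
    case True
    then have "(cvec (delta_vec x) 0, cvec (adj (delta_vec x)) (adj 0)) \<in> adjacency_graph"
      unfolding adjacency_graph_def mem_Collect_eq
      by (intro exI[of _ "delta_vec x"] exI[of _ 0]) (auto simp: supported_def)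
    from eq[OF this] show ?thesis
      unfolding uv pq l2_inner_cvec by (simp add: self_adjoint_adj[symmetric] linear_0[OF linear_adj])
  next
    case False
    then show ?thesis using pq supported_adj[of u] supported_adj[of v] by (simp add: supported_def)
  qed
  then have "p = adj u" "q = adj v" by (auto intro: ell2_eqI)
  then show "(g, h) \<in> adjacency_graph" using uv pq unfolding adjacency_graph_def by blast
next
  fix g h assume "(g, h) \<in> adjacency_graph"
  then obtain u v where uv: "supported u" "supported v" "g = cvec u v" "h = cvec (adj u) (adj v)"
    unfolding adjacency_graph_def by blast
  then have "g \<in> l2_space (verts G)" "h \<in> l2_space (verts G)"
    using supported_adj unfolding l2_space_iff by blast+
  moreover have "l2_inner g k = l2_inner h f" if "(f, k) \<in> adjacency_graph" for f k
    using that unfolding adjacency_graph_def uv by (auto simp: l2_inner_cvec self_adjoint_adj)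
  ultimately show "(g, h) \<in> op_adjoint (verts G) adjacency_graph" by (auto simp: op_adjoint_def)
qed

text \<open>The \<open>THE\<close> in the resolvent is unique because
  \<open>resolvent_perturbation\<close> with zero right-hand sides leaves only the zero
  vector.\<close>

lemma resolvent_pair:
  assumes "x \<in> verts G" "b \<noteq> 0"
    and uv: "adj u - a *\<^sub>R u + b *\<^sub>R v = delta_vec x" "adj v - a *\<^sub>R v = b *\<^sub>R u"
  shows "l2_inner (basis_vec x) (op_resolvent (op_closure (verts G) (adjacency_op G)) (Complex a b) (basis_vec x))
    = Complex (coord u x) (coord v x)"
proof -
  have step: "(\<lambda>n. basis_vec x n + Complex a b * cvec p q n) = cvec (delta_vec x + a *\<^sub>R p - b *\<^sub>R q) (a *\<^sub>R q + b *\<^sub>R p)" for p q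
    by (auto simp: cvec_def basis_vec_def fun_eq_iff complex_eq_iff)
  have "op_resolvent adjacency_graph (Complex a b) (basis_vec x) = cvec u v"
    unfolding op_resolvent_def
  proof (rule the_equality)
    \<comment> \<open>Outside the vertices \<open>adj\<close> gives 0, and the two equations become
      a homogeneous linear system with determinant \<open>a^2 + b^2\<close>, up to sign.\<close>
    have sup: "coord u n = 0 \<and> coord v n = 0" if n: "n \<notin> verts G" for n
    proof -
      have "coord (adj u - a *\<^sub>R u + b *\<^sub>R v) n = 0" "coord (adj v - a *\<^sub>R v - b *\<^sub>R u) n = 0"
        using assms(1) n by (auto simp: uv)
      then have e: "b * coord v n = a * coord u n" "- a * coord v n = b * coord u n"
        using supported_adj[of u] supported_adj[of v] n by (simp_all add: supported_def)
      have "(b * b + a * a) * coord v n = b * (b * coord v n) + - a * (- a * coord v n)" by (simp add: algebra_simps)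
      also have "\<dots> = 0" unfolding e by simp
      finally have "coord v n = 0" using assms(2) by (simp add: sum_squares_eq_zero_iff)
      then show ?thesis using e assms(2) by simp
    qed
    have "adj u = delta_vec x + a *\<^sub>R u - b *\<^sub>R v" "adj v = a *\<^sub>R v + b *\<^sub>R u"
      using uv by (simp_all add: algebra_simps)
    then show "(cvec u v, \<lambda>n. basis_vec x n + Complex a b * cvec u v n) \<in> adjacency_graph"
      unfolding step adjacency_graph_def mem_Collect_eq using sup
      by (intro exI[of _ u] exI[of _ v]) (auto simp: supported_def)
  next
    fix f assume "(f, \<lambda>n. basis_vec x n + Complex a b * f n) \<in> adjacency_graph"
    then obtain p q where pq: "f = cvec p q" "(\<lambda>n. basis_vec x n + Complex a b * f n) = cvec (adj p) (adj q)"
      unfolding adjacency_graph_def by blast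
    then have "adj p = delta_vec x + a *\<^sub>R p - b *\<^sub>R q" "adj q = a *\<^sub>R q + b *\<^sub>R p"
      unfolding step cvec_eq_iff pq(1) by auto
    then have "adj (u - p) - a *\<^sub>R (u - p) + b *\<^sub>R (v - q) = 0" "adj (v - q) - a *\<^sub>R (v - q) - b *\<^sub>R (u - p) = 0"
      using uv by (simp_all add: adj_simps algebra_simps)
    from resolvent_perturbation[OF linear_adj self_adjoint_adj assms(2) this]
    have "b\<^sup>2 * ((norm (u - p))\<^sup>2 + (norm (v - q))\<^sup>2) \<le> 0" by simp
    moreover have "0 < b\<^sup>2" using assms(2) by simp
    ultimately have "(norm (u - p))\<^sup>2 + (norm (v - q))\<^sup>2 \<le> 0" by (simp only: mult_le_0_iff) linarith
    then show "f = cvec u v" unfolding pq(1) by (simp add: sum_power2_le_zero_iff)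
  qed
  then show ?thesis
    unfolding op_closure_adjacency basis_vec_cvec[of x] by (simp add: l2_inner_cvec)
qed

lemma resolvent_pair_exists:
  assumes "b \<noteq> 0"
  obtains u v where "adj u - a *\<^sub>R u + b *\<^sub>R v = delta_vec x" "adj v - a *\<^sub>R v = b *\<^sub>R u"
proof -
  interpret self_adjoint_operator "\<lambda>u. adj u - a *\<^sub>R u" "(real D + \<bar>a\<bar> + 1)\<^sup>2" by (rule self_adjoint_shift)
  define M where "M u = adj u - a *\<^sub>R u" for u
  obtain v0 where v0: "M (M v0) + b\<^sup>2 *\<^sub>R v0 = delta_vec x"
    using resolvent_exists[OF assms, of "delta_vec x"] unfolding M_def by blast
  have lin: "M (c *\<^sub>R w) = c *\<^sub>R M w" for c w
    by (simp add: M_def adj_simps algebra_simps)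
  \<comment> \<open>Since \<open>(M - i b) (M + i b) = M^2 + b^2\<close>, the resolvent of
    \<open>delta_vec x\<close> is \<open>(M + i b) v0\<close>, with real part \<open>M v0\<close>
    and imaginary part \<open>b v0\<close>.\<close>
  define v where "v = b *\<^sub>R v0"
  define u where "u = M v0"
  have "M u + b *\<^sub>R v = delta_vec x" using v0 by (simp add: u_def v_def power2_eq_square)
  moreover have "M v = b *\<^sub>R u" by (simp add: u_def v_def lin)
  ultimately show thesis using that unfolding M_def by blast
qed

lemma cauchy_kernel_integral:
  assumes "real_distribution \<mu>" "b \<noteq> 0"
  shows "(\<integral>\<xi>. 1 / (complex_of_real \<xi> - Complex a b) \<partial>\<mu>) =
    Complex (\<integral>\<xi>. (\<xi> - a) / ((\<xi> - a)\<^sup>2 + b\<^sup>2) \<partial>\<mu>) (\<integral>\<xi>. b / ((\<xi> - a)\<^sup>2 + b\<^sup>2) \<partial>\<mu>)"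
proof -
  interpret real_distribution \<mu> by fact
  have b2: "0 < b\<^sup>2" using assms(2) by simp
  have eq: "1 / (complex_of_real \<xi> - Complex a b) = Complex ((\<xi> - a) / ((\<xi> - a)\<^sup>2 + b\<^sup>2)) (b / ((\<xi> - a)\<^sup>2 + b\<^sup>2))" for \<xi>
    by (simp add: complex_eq_iff Re_divide Im_divide)
  have "norm (1 / (complex_of_real \<xi> - Complex a b)) \<le> 1 / \<bar>b\<bar>" for \<xi>
  proof -
    have "\<bar>b\<bar> \<le> norm (complex_of_real \<xi> - Complex a b)"
      using abs_Im_le_cmod[of "complex_of_real \<xi> - Complex a b"] by simp
    then show ?thesis using assms(2) by (simp add: norm_divide frac_le)
  qed
  then have "integrable \<mu> (\<lambda>\<xi>. 1 / (complex_of_real \<xi> - Complex a b))"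
    by (intro integrable_const_bound[where B = "1 / \<bar>b\<bar>"] AE_I2) simp_all
  then have "Re (\<integral>\<xi>. 1 / (complex_of_real \<xi> - Complex a b) \<partial>\<mu>) = (\<integral>\<xi>. Re (1 / (complex_of_real \<xi> - Complex a b)) \<partial>\<mu>)"
    "Im (\<integral>\<xi>. 1 / (complex_of_real \<xi> - Complex a b) \<partial>\<mu>) = (\<integral>\<xi>. Im (1 / (complex_of_real \<xi> - Complex a b)) \<partial>\<mu>)"
    by simp_all
  then show ?thesis unfolding eq by (simp add: complex_eq_iff)
qed

text \<open>Resolves the \<open>THE\<close> in \<open>spectral_measure\<close>: existence comes from
  finite rank approximation, uniqueness from the Poisson integrals, that is from the imaginary parts
  alone.\<close>

lemma spectral_measure_resolvent:
  assumes "x \<in> verts G"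
  shows "real_distribution (spectral_measure G x)"
    and "\<And>a b u v. b \<noteq> 0 \<Longrightarrow> adj u - a *\<^sub>R u + b *\<^sub>R v = delta_vec x \<Longrightarrow> adj v - a *\<^sub>R v = b *\<^sub>R u \<Longrightarrow>
      coord v x = (\<integral>\<xi>. b / ((\<xi> - a)\<^sup>2 + b\<^sup>2) \<partial>spectral_measure G x)"
proof -
  interpret A: self_adjoint_operator "\<lambda>u. adj u - 0 *\<^sub>R u" "(real D + \<bar>0\<bar> + 1)\<^sup>2" by (rule self_adjoint_shift)
  have "self_adjoint_operator adj ((real D + \<bar>0\<bar> + 1)\<^sup>2)" using A.self_adjoint_operator_axioms by simp
  from real_spectral_measure_exists[OF this, of x] obtain \<mu> where \<mu>: "real_distribution \<mu>"
    and int: "\<And>a b u v. b \<noteq> 0 \<Longrightarrow> adj u - a *\<^sub>R u + b *\<^sub>R v = delta_vec x \<Longrightarrow> adj v - a *\<^sub>R v = b *\<^sub>R u \<Longrightarrow>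
      coord u x = (\<integral>\<xi>. (\<xi> - a) / ((\<xi> - a)\<^sup>2 + b\<^sup>2) \<partial>\<mu>) \<and> coord v x = (\<integral>\<xi>. b / ((\<xi> - a)\<^sup>2 + b\<^sup>2) \<partial>\<mu>)"
    by blast
  have iff: "is_spectral_measure G x \<nu> \<longleftrightarrow> real_distribution \<nu> \<and>
    (\<forall>a b u v. b \<noteq> 0 \<longrightarrow> adj u - a *\<^sub>R u + b *\<^sub>R v = delta_vec x \<longrightarrow> adj v - a *\<^sub>R v = b *\<^sub>R u \<longrightarrow>
      coord u x = (\<integral>\<xi>. (\<xi> - a) / ((\<xi> - a)\<^sup>2 + b\<^sup>2) \<partial>\<nu>) \<and> coord v x = (\<integral>\<xi>. b / ((\<xi> - a)\<^sup>2 + b\<^sup>2) \<partial>\<nu>))"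
    (is "_ \<longleftrightarrow> _ \<and> ?R \<nu>") for \<nu>
  proof (cases "real_distribution \<nu>")
    case True
    have rd: "prob_space \<nu> \<and> sets \<nu> = sets borel"
      using True by (simp add: real_distribution_def real_distribution_axioms_def)
    have "(\<forall>z. Im z \<noteq> 0 \<longrightarrow> l2_inner (basis_vec x) (op_resolvent (op_closure (verts G) (adjacency_op G)) z (basis_vec x))
          = (\<integral>\<xi>. 1 / (complex_of_real \<xi> - z) \<partial>\<nu>)) \<longleftrightarrow> ?R \<nu>" (is "?L \<longleftrightarrow> _")
    proof
      assume L: ?L
      show "?R \<nu>"
      proof (intro allI impI)
        fix a b :: real and u v
        assume b: "b \<noteq> 0" and uv: "adj u - a *\<^sub>R u + b *\<^sub>R v = delta_vec x" "adj v - a *\<^sub>R v = b *\<^sub>R u"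
        then show "coord u x = (\<integral>\<xi>. (\<xi> - a) / ((\<xi> - a)\<^sup>2 + b\<^sup>2) \<partial>\<nu>) \<and> coord v x = (\<integral>\<xi>. b / ((\<xi> - a)\<^sup>2 + b\<^sup>2) \<partial>\<nu>)"
          using L[rule_format, of "Complex a b"] resolvent_pair[OF assms b uv] cauchy_kernel_integral[OF True b, of a]
          by simp
      qed
    next
      assume R: "?R \<nu>"
      show ?L
      proof (intro allI impI)
        fix z :: complex assume z: "Im z \<noteq> 0"
        obtain u v where uv: "adj u - Re z *\<^sub>R u + Im z *\<^sub>R v = delta_vec x" "adj v - Re z *\<^sub>R v = Im z *\<^sub>R u"
          using resolvent_pair_exists[OF z] by blast
        show "l2_inner (basis_vec x) (op_resolvent (op_closure (verts G) (adjacency_op G)) z (basis_vec x))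
          = (\<integral>\<xi>. 1 / (complex_of_real \<xi> - z) \<partial>\<nu>)"
          using resolvent_pair[OF assms z uv] cauchy_kernel_integral[OF True z, of "Re z"] R[rule_format, OF z uv] by simp
      qed
    qed
    then show ?thesis unfolding is_spectral_measure_def using True rd by simp
  next
    case False
    then show ?thesis by (auto simp: is_spectral_measure_def real_distribution_def real_distribution_axioms_def)
  qed
  have "is_spectral_measure G x (THE \<mu>. is_spectral_measure G x \<mu>)"
  proof (rule theI[of _ \<mu>])
    show "is_spectral_measure G x \<mu>" unfolding iff using \<mu> int by blast
    fix \<nu> assume \<nu>: "is_spectral_measure G x \<nu>"
    show "\<nu> = \<mu>"
    proof (rule poisson_unique)
      fix a b :: real assume "b > 0"
      then have b: "b \<noteq> 0" by simp
      obtain u v where uv: "adj u - a *\<^sub>R u + b *\<^sub>R v = delta_vec x" "adj v - a *\<^sub>R v = b *\<^sub>R u"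
        using resolvent_pair_exists[OF b] by blast
      have "coord v x = (\<integral>\<xi>. b / ((\<xi> - a)\<^sup>2 + b\<^sup>2) \<partial>\<nu>)" using \<nu> b uv unfolding iff by blast
      moreover have "coord v x = (\<integral>\<xi>. b / ((\<xi> - a)\<^sup>2 + b\<^sup>2) \<partial>\<mu>)" using int[OF b uv] by blast
      ultimately show "(\<integral>\<xi>. b / ((\<xi> - a)\<^sup>2 + b\<^sup>2) \<partial>\<nu>) = (\<integral>\<xi>. b / ((\<xi> - a)\<^sup>2 + b\<^sup>2) \<partial>\<mu>)" by simp
    qed (use \<nu> \<mu> iff in blast)+
  qed
  then have "is_spectral_measure G x (spectral_measure G x)"
    by (simp add: spectral_measure_def self_adjoint_graph)
  then show "real_distribution (spectral_measure G x)"
    "\<And>a b u v. b \<noteq> 0 \<Longrightarrow> adj u - a *\<^sub>R u + b *\<^sub>R v = delta_vec x \<Longrightarrow> adj v - a *\<^sub>R v = b *\<^sub>R u \<Longrightarrow>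
      coord v x = (\<integral>\<xi>. b / ((\<xi> - a)\<^sup>2 + b\<^sup>2) \<partial>spectral_measure G x)"
    unfolding iff by blast+
qed

text \<open>\<open>b\<close> times the imaginary part of the resolvent at \<open>t + i b\<close> is
  the integral of \<open>b^2 / ((x - t)^2 + b^2)\<close>. It dominates the mass at \<open>t\<close>,
  and \<open>resolvent_small\<close> makes it arbitrarily small.\<close>

lemma no_atom:
  assumes x: "x \<in> verts G"
    and proj: "self_adjoint_operator.proj (\<lambda>u. adj u - t *\<^sub>R u) ((real D + \<bar>t\<bar> + 1)\<^sup>2) (delta_vec x) = 0"
  shows "emeasure (spectral_measure G x) {t} = 0"
proof -
  interpret self_adjoint_operator "\<lambda>u. adj u - t *\<^sub>R u" "(real D + \<bar>t\<bar> + 1)\<^sup>2" by (rule self_adjoint_shift)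
  define \<mu> where "\<mu> = spectral_measure G x"
  interpret \<mu>: real_distribution \<mu> unfolding \<mu>_def by (rule spectral_measure_resolvent(1)[OF x])
  define M where "M u = adj u - t *\<^sub>R u" for u
  have "measure \<mu> {t} \<le> \<eta>" if \<eta>: "\<eta> > 0" for \<eta>
  proof -
    obtain d where d: "d > 0" and small: "\<And>b w. 0 < \<bar>b\<bar> \<Longrightarrow> \<bar>b\<bar> < d \<Longrightarrow>
        M (M w) + b\<^sup>2 *\<^sub>R w = b\<^sup>2 *\<^sub>R delta_vec x \<Longrightarrow> inner (delta_vec x) w < \<eta>"
      using resolvent_small[OF proj \<eta>] unfolding M_def by blast
    define b where "b = d / 2"
    have b: "0 < \<bar>b\<bar>" "\<bar>b\<bar> < d" "0 < b" "b \<noteq> 0" using d by (simp_all add: b_def)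
    obtain u v where uv: "adj u - t *\<^sub>R u + b *\<^sub>R v = delta_vec x" "adj v - t *\<^sub>R v = b *\<^sub>R u"
      using resolvent_pair_exists[OF b(4)] by blast
    have lin: "M (c *\<^sub>R w) = c *\<^sub>R M w" for c w by (simp add: M_def adj_simps algebra_simps)
    have "M (M (b *\<^sub>R v)) + b\<^sup>2 *\<^sub>R (b *\<^sub>R v) = b\<^sup>2 *\<^sub>R (M u + b *\<^sub>R v)"
      using uv(2) unfolding lin by (simp add: M_def[symmetric] lin power2_eq_square algebra_simps)
    also have "M u + b *\<^sub>R v = delta_vec x" using uv(1) by (simp add: M_def)
    finally have "inner (delta_vec x) (b *\<^sub>R v) < \<eta>" by (rule small[OF b(1,2)])
    then have "b * coord v x < \<eta>" by simp
    moreover have "b * coord v x = (\<integral>\<xi>. b\<^sup>2 / ((\<xi> - t)\<^sup>2 + b\<^sup>2) \<partial>\<mu>)"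
      using spectral_measure_resolvent(2)[OF x b(4) uv] unfolding \<mu>_def
      by (simp add: power2_eq_square flip: integral_mult_right_zero)
    moreover have "(\<integral>\<xi>. indicator {t} \<xi> \<partial>\<mu>) \<le> (\<integral>\<xi>. b\<^sup>2 / ((\<xi> - t)\<^sup>2 + b\<^sup>2) \<partial>\<mu>)"
    proof (rule integral_mono)
      show "integrable \<mu> (indicator {t} :: real \<Rightarrow> real)"
        by (intro \<mu>.integrable_const_bound[where B = 1] AE_I2) (auto simp: indicator_def)
      show "integrable \<mu> (\<lambda>\<xi>. b\<^sup>2 / ((\<xi> - t)\<^sup>2 + b\<^sup>2))"
        by (intro \<mu>.integrable_const_bound[where B = 1] AE_I2) (use b in \<open>auto simp: divide_le_eq_1 add_nonneg_pos\<close>)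
      show "indicator {t} \<xi> \<le> b\<^sup>2 / ((\<xi> - t)\<^sup>2 + b\<^sup>2)" for \<xi>
        using b by (auto simp: indicator_def)
    qed
    ultimately show ?thesis by simp
  qed
  then have "measure \<mu> {t} \<le> 0" by (metis dense_ge)
  then have "measure \<mu> {t} = 0" using measure_nonneg[of \<mu> "{t}"] by linarith
  then show ?thesis unfolding \<mu>_def[symmetric] by (simp add: \<mu>.emeasure_eq_measure)
qed

end

section \<open>The eigenspace on a tree\<close>

text \<open>
  The kernels of the eigenprojection and of the pseudo-inverse of \<open>A - t\<close> are defined as limits of
  polynomials in \<open>A\<close>, hence of local quantities; this makes them Borel functions of doubly rooted
  graphs.
\<close>

definition adj_fun :: "nat graph \<Rightarrow> (nat \<Rightarrow> real) \<Rightarrow> nat \<Rightarrow> real" where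
  "adj_fun G u x = (\<Sum>y\<in>neighbours G x. u y)"

definition shift_fun :: "nat graph \<Rightarrow> real \<Rightarrow> (nat \<Rightarrow> real) \<Rightarrow> nat \<Rightarrow> real" where
  "shift_fun G t u x = adj_fun G u x - t * u x"

text \<open>The operator \<open>B\<close> for \<open>M = A - t\<close> with the constant of
  \<open>self_adjoint_shift\<close>, written for arbitrary functions so that the kernels make sense
  on every graph.\<close>

definition contract_fun :: "nat graph \<Rightarrow> nat \<Rightarrow> real \<Rightarrow> (nat \<Rightarrow> real) \<Rightarrow> nat \<Rightarrow> real" where
  "contract_fun G D t u x = u x - shift_fun G t (shift_fun G t u) x / (real D + \<bar>t\<bar> + 1)\<^sup>2"

definition proj_kernel :: "nat graph \<Rightarrow> nat \<Rightarrow> real \<Rightarrow> nat \<Rightarrow> nat \<Rightarrow> real" where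
  "proj_kernel G D t x y = lim (\<lambda>n. (contract_fun G D t ^^ n) (\<lambda>z. if z = y then 1 else 0) x)"

definition green_kernel :: "nat graph \<Rightarrow> nat \<Rightarrow> real \<Rightarrow> nat \<Rightarrow> nat \<Rightarrow> real" where
  "green_kernel G D t x y = lim (\<lambda>n. \<Sum>k<n.
     shift_fun G t ((contract_fun G D t ^^ k) (\<lambda>z. if z = y then 1 else 0)) x / (real D + \<bar>t\<bar> + 1)\<^sup>2)"

definition eigen_support :: "nat graph \<Rightarrow> nat \<Rightarrow> real \<Rightarrow> nat set" where
  "eigen_support G D t = {x \<in> verts G. 0 < proj_kernel G D t x x}"

text \<open>The condition on \<open>x\<close> makes the block of a vertex outside the support empty;
  reflexivity of the closure alone would give a singleton.\<close>

definition block :: "nat graph \<Rightarrow> nat \<Rightarrow> real \<Rightarrow> nat \<Rightarrow> nat set" where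
  "block G D t x = {z. x \<in> eigen_support G D t \<and>
     (x, z) \<in> {(a, b). a \<in> eigen_support G D t \<and> b \<in> eigen_support G D t \<and> b \<in> neighbours G a}\<^sup>*}"

locale bounded_tree = bounded_graph G D for G :: "nat graph" and D :: nat +
  fixes t :: real
  assumes tree: "tree_graph G"
begin

abbreviation M :: "ell2 \<Rightarrow> ell2" where "M u \<equiv> adj u - t *\<^sub>R u"

sublocale S: self_adjoint_operator M "(real D + \<bar>t\<bar> + 1)\<^sup>2"
  by (rule self_adjoint_shift)

lemma coord_M: "coord (M u) = shift_fun G t (coord u)"
  by (auto simp: shift_fun_def adj_fun_def coord_adj)

lemma coord_B: "coord (S.B u) = contract_fun G D t (coord u)"
  by (auto simp: S.B_def contract_fun_def coord_M[symmetric] simp del: coord_simps(4) simp add: coord_simps(4)[of u] fun_eq_iff)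

lemma coord_Bn: "coord (S.Bn n (delta_vec y)) = (contract_fun G D t ^^ n) (\<lambda>z. if z = y then 1 else 0)"
proof (induction n)
  case 0
  then show ?case by (auto simp: fun_eq_iff)
next
  case (Suc n)
  then show ?case by (simp only: funpow.simps o_apply coord_B)
qed

definition P :: "nat \<Rightarrow> ell2" where "P x = S.proj (delta_vec x)"

abbreviation pk :: "nat \<Rightarrow> nat \<Rightarrow> real" where "pk \<equiv> proj_kernel G D t"
abbreviation sk :: "nat \<Rightarrow> nat \<Rightarrow> real" where "sk \<equiv> green_kernel G D t"
abbreviation "supp \<equiv> eigen_support G D t"
abbreviation "K \<equiv> block G D t"

lemma pk_eq: "pk x y = coord (P y) x"
  unfolding proj_kernel_def P_def coord_Bn[symmetric]
  by (rule limI) (intro tendsto_coord S.Bn_tendsto)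

lemma M_P: "M (P x) = 0"
  unfolding P_def by (rule S.M_proj)

lemma inner_P: "M h = 0 \<Longrightarrow> inner (P x) h = coord h x"
  unfolding P_def by (simp add: S.inner_proj_kernel)

lemma pk_sym: "pk x y = pk y x"
  using inner_P[OF M_P, of x y] inner_P[OF M_P, of y x] by (simp add: pk_eq inner_commute)

lemma norm_P: "(norm (P x))\<^sup>2 = pk x x"
  using inner_P[OF M_P, of x x] by (simp add: pk_eq power2_norm_eq_inner)

lemma pk_nonneg: "0 \<le> pk x x"
  using norm_P[of x] zero_le_power2[of "norm (P x)"] by linarith

text \<open>The diagonal entry is the squared norm of \<open>P x\<close>, so \<open>P x = 0\<close>,
  and \<open>delta_vec x\<close> is orthogonal to the kernel.\<close>

lemma kernel_vanishes:
  assumes "x \<in> verts G" "x \<notin> supp" "M h = 0"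
  shows "coord h x = 0"
proof -
  have "pk x x = 0" using assms pk_nonneg[of x] by (auto simp: eigen_support_def)
  then have "P x = 0" using norm_P[of x] by simp
  then show ?thesis using inner_P[OF assms(3), of x] by simp
qed

section \<open>Cutting an edge: branches and the discrete Wronskian\<close>

definition branch :: "nat \<Rightarrow> nat \<Rightarrow> nat set" where
  "branch x y = {v. (x, v) \<in> {(a, b). b \<in> N a \<and> {a, b} \<noteq> {x, y}}\<^sup>*}"

lemma branch_root: "x \<in> branch x y"
  by (simp add: branch_def)

text \<open>Acyclicity enters here: \<open>branch x y\<close> is the component of \<open>x\<close>
  after deleting the edge to \<open>y\<close>, and a walk from \<open>x\<close> to \<open>y\<close>
  inside it would close up with this edge to a cycle.\<close>

lemma not_in_branch:
  assumes "x \<in> N y"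
  shows "y \<notin> branch x y"
proof
  let ?R = "{(a, b). b \<in> N a \<and> {a, b} \<noteq> {x, y}}"
  assume "y \<in> branch x y"
  then have "\<exists>n. (x, y) \<in> ?R ^^ n" unfolding branch_def using rtrancl_imp_relpow by blast
  \<comment> \<open>A walk of minimal length has no repeated vertex, since a loop could be cut
    out.\<close>
  define n where "n = (LEAST n. (x, y) \<in> ?R ^^ n)"
  have n: "(x, y) \<in> ?R ^^ n" and least: "\<And>m. (x, y) \<in> ?R ^^ m \<Longrightarrow> n \<le> m"
    using LeastI_ex[OF \<open>\<exists>n. (x, y) \<in> ?R ^^ n\<close>] Least_le unfolding n_def by fast+
  obtain f where f: "f 0 = x" "f n = y" "\<And>i. i < n \<Longrightarrow> (f i, f (Suc i)) \<in> ?R"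
    using n unfolding relpow_fun_conv by blast
  have seg: "(f i, f j) \<in> ?R ^^ (j - i)" if "i \<le> j" "j \<le> n" for i j
    unfolding relpow_fun_conv
    by (rule exI[of _ "\<lambda>k. f (i + k)"]) (use that f(3) in auto)
  have inj: "inj_on f {..n}"
  proof (rule linorder_inj_onI')
    fix i j assume ij: "i \<in> {..n}" "j \<in> {..n}" "i < j"
    show "f i \<noteq> f j"
    proof
      assume "f i = f j"
      then have "(x, y) \<in> ?R ^^ (i - 0) O ?R ^^ (n - j)"
        using seg[of 0 i] seg[of j n] ij f by auto
      then have "(x, y) \<in> ?R ^^ (i + (n - j))" by (simp add: relpow_add)
      then show False using least[of "i + (n - j)"] ij by auto
    qed
  qed
  have "x \<noteq> y" using assms nbr_verts by blast
  then have "n \<noteq> 0" using f by (metis)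
  \<comment> \<open>A walk of length 1 would use the deleted edge; so the cycle has at least three
    vertices.\<close>
  moreover have "n \<noteq> 1" using f(1,2) f(3)[of 0] by auto
  ultimately have n2: "2 \<le> n" by simp
  define xs where "xs = map f [0..<Suc n]"
  have xs: "xs ! i = f i" if "i \<le> n" for i using that by (simp add: xs_def nth_map_upt del: upt_Suc)
  have "is_cycle G xs"
    unfolding is_cycle_def
  proof (intro conjI allI impI)
    show "3 \<le> length xs" using n2 by (simp add: xs_def)
    show "distinct xs" using inj by (simp add: xs_def distinct_map atLeast0LessThan lessThan_Suc_atMost del: upt_Suc)
    fix i assume "i < length xs"
    then have i: "i \<le> n" by (simp add: xs_def)
    show "{xs ! i, xs ! (Suc i mod length xs)} \<in> edges G"
    proof (cases "i = n")
      case True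
      then have "{xs ! i, xs ! (Suc i mod length xs)} = {y, x}" using f xs by (simp add: xs_def[symmetric]) (simp add: xs_def)
      then show ?thesis using assms by (simp add: neighbours_def)
    next
      case False
      then have "Suc i mod length xs = Suc i" using i by (simp add: xs_def)
      then show ?thesis using f(3)[of i] False i xs by (auto simp: neighbours_def)
    qed
  qed
  then show False using tree unfolding tree_graph_def by blast
qed

lemma branch_step:
  assumes "x \<in> N y" "v \<in> branch x y" "w \<in> N v"
  shows "w \<in> branch x y \<or> v = x \<and> w = y"
proof (cases "{v, w} = {x, y}")
  case True
  then show ?thesis using not_in_branch[OF assms(1)] assms(2) by (auto simp: doubleton_eq_iff)
next
  case False
  then show ?thesis using assms unfolding branch_def by (auto intro: rtrancl_into_rtrancl)
qed

lemma branch_disjoint: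
  assumes "x \<in> N y"
  shows "branch x y \<inter> branch y x = {}"
proof (rule ccontr)
  let ?R = "{(a, b). b \<in> N a \<and> {a, b} \<noteq> {x, y}}"
  assume "branch x y \<inter> branch y x \<noteq> {}"
  then obtain v where v: "(x, v) \<in> ?R\<^sup>*" "(y, v) \<in> ?R\<^sup>*"
    unfolding branch_def by (auto simp: insert_commute)
  have "sym ?R" by (auto simp: sym_def nbr_sym insert_commute)
  then have "(v, y) \<in> ?R\<^sup>*" using v(2) by (meson sym_rtrancl symD)
  then have "y \<in> branch x y" using v(1) unfolding branch_def by auto
  then show False using not_in_branch[OF assms] by blast
qed

text \<open>Truncation to the branch disturbs the equation only across the deleted edge:
  \<open>y\<close> receives the value at \<open>x\<close>, and \<open>x\<close> loses the value at
  \<open>y\<close>.\<close>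

lemma M_restr_branch:
  assumes xy: "x \<in> N y" and f: "\<And>v. v \<in> branch x y \<Longrightarrow> coord (M f) v = 0"
  shows "M (restr (branch x y) f) = coord f x *\<^sub>R delta_vec y - coord f y *\<^sub>R delta_vec x"
proof (rule ell2_eqI)
  fix v
  have ne: "x \<noteq> y" using nbr_verts xy by blast
  have sum: "coord (adj (restr (branch x y) f)) v = (\<Sum>w\<in>N v \<inter> branch x y. coord f w)"
    by (simp add: coord_adj sum.inter_restrict)
  show "coord (M (restr (branch x y) f)) v = coord (coord f x *\<^sub>R delta_vec y - coord f y *\<^sub>R delta_vec x) v"
  proof (cases "v \<in> branch x y")
    case True
    then have fv: "(\<Sum>w\<in>N v. coord f w) = t * coord f v" using f[OF True] by (simp add: coord_adj)
    have vy: "v \<noteq> y" using True not_in_branch[OF xy] by blast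
    show ?thesis
    proof (cases "v = x")
      case True
      have "N x \<inter> branch x y = N x - {y}"
        using branch_step[OF xy branch_root] not_in_branch[OF xy] by auto
      moreover have "y \<in> N x" using xy nbr_sym by blast
      ultimately have "coord (adj (restr (branch x y) f)) v = t * coord f v - coord f y"
        using sum fv True by (simp add: sum_diff1)
      then show ?thesis using True ne branch_root by simp
    next
      case False
      then have "N v \<inter> branch x y = N v" using branch_step[OF xy True] by auto
      then show ?thesis using sum fv True False vy by simp
    qed
  next
    case False
    have "N v \<inter> branch x y = (if v = y then {x} else {})"
      using branch_step[OF xy] False xy branch_root nbr_sym by (auto split: if_splits)
    moreover have "v \<noteq> x" using False branch_root by blast
    ultimately show ?thesis using sum False ne by simp
  qed
qed

text \<open>The discrete Wronskian is constant along the branch, hence zero.\<close>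

lemma wronskian:
  assumes "x \<in> N y" "\<And>v. v \<in> branch x y \<Longrightarrow> coord (M f) v = 0" "M h = 0"
  shows "coord f x * coord h y = coord f y * coord h x"
proof -
  have "inner (M (restr (branch x y) f)) h = 0"
    using S.self_adjoint[of "restr (branch x y) f" h] assms(3) by simp
  moreover have "M (restr (branch x y) f) = coord f x *\<^sub>R delta_vec y - coord f y *\<^sub>R delta_vec x"
    by (rule M_restr_branch[OF assms(1,2)])
  ultimately have "inner (coord f x *\<^sub>R delta_vec y - coord f y *\<^sub>R delta_vec x) h = 0" by simp
  then show ?thesis by (simp add: inner_diff_left)
qed

text \<open>Along every edge of the support, \<open>f\<close> is parallel to the whole kernel. Cross
  products avoid dividing by values that might vanish.\<close>

definition proportional :: "ell2 \<Rightarrow> bool" where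
  "proportional f \<longleftrightarrow> (\<forall>x y h. x \<in> supp \<longrightarrow> y \<in> supp \<longrightarrow> y \<in> N x \<longrightarrow> M h = 0 \<longrightarrow>
     coord f x * coord h y = coord f y * coord h x)"

lemma proportional_kernel: "M f = 0 \<Longrightarrow> proportional f"
  unfolding proportional_def using wronskian nbr_sym by (metis coord_simps(1))

text \<open>The source \<open>z\<close> lies in at most one of the two branches of an edge, so the
  Wronskian argument can be run on the other.\<close>

lemma proportional_green:
  assumes "M f = delta_vec z" "z \<notin> supp"
  shows "proportional f"
  unfolding proportional_def
proof (intro allI impI)
  fix x y h assume xy: "x \<in> supp" "y \<in> supp" "y \<in> N x" and h: "M h = 0"
  have xN: "x \<in> N y" using xy nbr_sym by blast
  have van: "coord (M f) v = 0" if "v \<noteq> z" for v using assms(1) that by simp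
  show "coord f x * coord h y = coord f y * coord h x"
  proof (cases "z \<in> branch x y")
    case False
    then show ?thesis by (intro wronskian[OF xN _ h] van) auto
  next
    case True
    then have "z \<notin> branch y x" using branch_disjoint[OF xN] by blast
    then have "coord f y * coord h x = coord f x * coord h y"
      by (intro wronskian[OF xy(3) _ h] van) auto
    then show ?thesis by simp
  qed
qed

section \<open>Blocks of the support and the vectors attached to their boundary\<close>

lemma block_subset: "K x \<subseteq> supp"
proof
  fix z assume "z \<in> K x"
  then have "x \<in> supp" "(x, z) \<in> {(a, b). a \<in> supp \<and> b \<in> supp \<and> b \<in> N a}\<^sup>*" by (auto simp: block_def)
  from this(2,1) show "z \<in> supp" by (induction rule: rtrancl_induct) auto
qed

lemma supp_verts: "supp \<subseteq> verts G"
  by (auto simp: eigen_support_def)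

lemma block_root: "x \<in> supp \<Longrightarrow> x \<in> K x"
  by (simp add: block_def)

lemma block_step: "z \<in> K x \<Longrightarrow> w \<in> N z \<Longrightarrow> w \<in> supp \<Longrightarrow> w \<in> K x"
  using block_subset[of x] by (auto simp: block_def intro: rtrancl_into_rtrancl)

lemma block_sym: "z \<in> K x \<longleftrightarrow> x \<in> K z"
proof -
  have "sym ({(a, b). a \<in> supp \<and> b \<in> supp \<and> b \<in> N a}\<^sup>*)"
    by (rule sym_rtrancl) (auto simp: sym_def nbr_sym)
  then show ?thesis
    using block_subset[of x] block_subset[of z] unfolding block_def sym_def by blast
qed

lemma block_eq: "z \<in> K x \<Longrightarrow> K z = K x"
proof -
  have "K z \<subseteq> K x" if "z \<in> K x" for z x
    using that unfolding block_def by (auto intro: rtrancl_trans)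
  then show "z \<in> K x \<Longrightarrow> K z = K x" using block_sym by blast
qed

text \<open>Proportionality is carried from edge to edge along a path in the block. Each step
  divides by a value of \<open>P x\<close>, which is why its nonvanishing is proved in the same
  induction.\<close>

lemma block_ratio:
  assumes "x \<in> supp" "z \<in> K x"
  shows "coord (P x) z \<noteq> 0 \<and> (\<forall>f. proportional f \<longrightarrow> coord f x * coord (P x) z = coord f z * coord (P x) x)"
proof -
  have "(x, z) \<in> {(a, b). a \<in> supp \<and> b \<in> supp \<and> b \<in> N a}\<^sup>*" using assms by (simp add: block_def)
  then show ?thesis
  proof (induction rule: rtrancl_induct)
    case base
    then show ?case using assms by (auto simp: eigen_support_def pk_eq)
  next
    case (step z w)
    then have zw: "z \<in> supp" "w \<in> supp" "w \<in> N z" by auto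
    \<comment> \<open>\<open>P w\<close> does not vanish at its own vertex; compared with it along
      the edge, \<open>P x\<close> cannot vanish at \<open>w\<close> unless it already did at
      \<open>z\<close>.\<close>
    have h: "coord (P w) w \<noteq> 0" using zw by (auto simp: eigen_support_def pk_eq)
    have "coord (P x) z * coord (P w) w = coord (P x) w * coord (P w) z"
      using proportional_kernel[OF M_P, of x] zw M_P unfolding proportional_def by blast
    then have nz: "coord (P x) w \<noteq> 0" using h step.IH by auto
    have "coord f x * coord (P x) w = coord f w * coord (P x) x" if "proportional f" for f
    proof -
      have "coord f z * coord (P x) w = coord f w * coord (P x) z"
        using that zw M_P unfolding proportional_def by blast
      moreover have "coord f x * coord (P x) z = coord f z * coord (P x) x" using step.IH that by blast
      ultimately have "(coord f x * coord (P x) w) * coord (P x) z = (coord f w * coord (P x) x) * coord (P x) z"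
        by (metis mult.assoc mult.commute)
      then show ?thesis using step.IH by simp
    qed
    then show ?case using nz by blast
  qed
qed

text \<open>On a block the kernel of the projection has rank one: \<open>block_ratio\<close> applied
  to \<open>P z\<close>, combined with symmetry.\<close>

lemma pk_block: "x \<in> supp \<Longrightarrow> z \<in> K x \<Longrightarrow> (pk z x)\<^sup>2 = pk z z * pk x x"
  using block_ratio[of x z] proportional_kernel[OF M_P, of z] pk_sym[of x z]
  by (auto simp: pk_eq power2_eq_square)

text \<open>Bessel's inequality for \<open>P x\<close>, whose squared norm is \<open>pk x x\<close>,
  divided by \<open>pk x x\<close>. Finite parts suffice for the total mass of infinite
  blocks.\<close>

lemma sum_pk_block_le:
  assumes "x \<in> supp" "finite F" "F \<subseteq> K x"
  shows "(\<Sum>z\<in>F. pk z z) \<le> 1"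
proof -
  have pos: "0 < pk x x" using assms by (simp add: eigen_support_def)
  have "pk x x * (\<Sum>z\<in>F. pk z z) = (\<Sum>z\<in>F. (pk z x)\<^sup>2)"
    unfolding sum_distrib_left using assms by (intro sum.cong) (auto simp: pk_block mult.commute)
  also have "\<dots> \<le> pk x x"
    using sum_coord_sq_le[OF assms(2), of "P x"] unfolding norm_P pk_eq .
  finally show ?thesis using pos by simp
qed

text \<open>\<open>P x\<close> vanishes at \<open>y\<close>, so cutting it to the branch of
  \<open>x\<close> leaves only a multiple of \<open>delta_vec y\<close> under \<open>M\<close>.
  Scaling gives the solution \<open>r\<close>, and subtracting its projection makes it orthogonal to
  the kernel.\<close>

lemma green_vector:
  assumes "y \<in> verts G" "y \<notin> supp" "x \<in> N y" "x \<in> supp"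
  obtains s where "M s = delta_vec y" "\<And>h. M h = 0 \<Longrightarrow> inner s h = 0"
    "\<And>v. v \<in> verts G \<Longrightarrow> v \<notin> supp \<Longrightarrow> coord s v = 0" "\<And>v. coord s v = sk v y"
proof -
  define c where "c = coord (P x) x"
  have c: "c \<noteq> 0" using assms(4) by (simp add: c_def eigen_support_def pk_eq)
  define r where "r = (1 / c) *\<^sub>R restr (branch x y) (P x)"
  have van: "coord (P x) v = 0" if "v \<in> verts G" "v \<notin> supp" for v
    using kernel_vanishes[OF that M_P] .
  have "M (restr (branch x y) (P x)) = c *\<^sub>R delta_vec y"
    using M_restr_branch[OF assms(3), of "P x"] M_P van[OF assms(1,2)] by (simp add: c_def)
  then have Mr: "M r = delta_vec y" using c unfolding r_def S.M_simps by simp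
  define s where "s = r - S.proj r"
  have Ms: "M s = delta_vec y" unfolding s_def S.M_simps S.M_proj Mr by simp
  moreover have "inner s h = 0" if "M h = 0" for h
    using S.inner_proj_kernel[OF that, of r] by (simp add: s_def inner_diff_left)
  moreover have "coord s v = 0" if "v \<in> verts G" "v \<notin> supp" for v
    using van[OF that] kernel_vanishes[OF that S.M_proj, of r] by (simp add: s_def r_def)
  \<comment> \<open>The partial sums of the pseudo-inverse see \<open>r\<close> only through
    \<open>M r = delta_vec y\<close>; hence \<open>s\<close> does not depend on the chosen neighbour
    \<open>x\<close>.\<close>
  moreover have "coord s v = sk v y" for v
  proof -
    have "(\<lambda>n. coord (\<Sum>k<n. (1 / (real D + \<bar>t\<bar> + 1)\<^sup>2) *\<^sub>R M (S.Bn k (M r))) v) \<longlonglongrightarrow> coord (r - S.proj r) v"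
      by (intro tendsto_coord S.pseudo_inverse_tendsto)
    moreover have "coord (\<Sum>k<n. (1 / (real D + \<bar>t\<bar> + 1)\<^sup>2) *\<^sub>R M (S.Bn k (M r))) v =
      (\<Sum>k<n. shift_fun G t ((contract_fun G D t ^^ k) (\<lambda>z. if z = y then 1 else 0)) v / (real D + \<bar>t\<bar> + 1)\<^sup>2)" for n
      unfolding coord_sum Mr coord_simps(5) coord_M coord_Bn by simp
    ultimately show ?thesis unfolding s_def green_kernel_def by (simp add: limI)
  qed
  ultimately show thesis using that by blast
qed

text \<open>The equation \<open>M s = delta_vec y\<close> read at \<open>y\<close>, where
  \<open>s\<close> vanishes, as it does at neighbours off the support.\<close>

lemma sum_green_boundary:
  assumes "y \<in> verts G" "y \<notin> supp" "N y \<inter> supp \<noteq> {}"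
  shows "(\<Sum>x\<in>N y \<inter> supp. sk x y) = 1"
proof -
  obtain x where "x \<in> N y" "x \<in> supp" using assms(3) by blast
  from green_vector[OF assms(1,2) this] obtain s where s: "M s = delta_vec y"
    "\<And>v. v \<in> verts G \<Longrightarrow> v \<notin> supp \<Longrightarrow> coord s v = 0" "\<And>v. coord s v = sk v y" by metis
  have "(\<Sum>x\<in>N y \<inter> supp. sk x y) = (\<Sum>x\<in>N y. sk x y)"
  proof (rule sum.mono_neutral_left)
    show "\<forall>w\<in>N y - N y \<inter> supp. sk w y = 0"
    proof
      fix w assume "w \<in> N y - N y \<inter> supp"
      then have "coord s w = 0" using nbr_verts by (intro s(2)) blast+
      then show "sk w y = 0" by (simp only: s(3))
    qed
  qed auto
  also have "\<dots> = coord (M s) y" using s(2)[OF assms(1,2)] by (simp add: coord_adj s(3)[symmetric])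
  finally show ?thesis using s(1) by simp
qed

text \<open>With \<open>r\<close> the part of \<open>s\<close> in the branch of \<open>x\<close>,
  \<open>M r\<close> is \<open>coord s x\<close> times \<open>M s\<close>. Orthogonality of
  \<open>s\<close> to the kernel turns this into
  \<open>(norm r)^2 = coord s x * (norm s)^2\<close>.\<close>

lemma green_nonneg:
  assumes "y \<in> verts G" "y \<notin> supp" "x \<in> N y" "x \<in> supp"
  shows "0 \<le> sk x y"
proof -
  obtain s where s: "M s = delta_vec y" "\<And>h. M h = 0 \<Longrightarrow> inner s h = 0"
    "\<And>v. v \<in> verts G \<Longrightarrow> v \<notin> supp \<Longrightarrow> coord s v = 0" "\<And>v. coord s v = sk v y"
    using green_vector[OF assms] by metis
  define r where "r = restr (branch x y) s"
  have "coord (M s) v = 0" if "v \<in> branch x y" for v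
    using s(1) that not_in_branch[OF assms(3)] by auto
  from M_restr_branch[OF assms(3) this] have "M r = coord s x *\<^sub>R delta_vec y"
    using s(3)[OF assms(1,2)] by (simp add: r_def)
  then have "M (r - coord s x *\<^sub>R s) = 0" unfolding S.M_simps s(1) by simp
  from s(2)[OF this] have "inner s r = coord s x * (norm s)\<^sup>2"
    by (simp add: inner_diff_right power2_norm_eq_inner)
  moreover have "inner s r = (norm r)\<^sup>2"
  proof -
    have "inner r r = inner s (restr (branch x y) r)" unfolding r_def inner_restr ..
    moreover have "restr (branch x y) r = r" unfolding r_def by (rule ell2_eqI) simp
    ultimately show ?thesis by (simp add: power2_norm_eq_inner)
  qed
  moreover have "0 < (norm s)\<^sup>2"
  proof -
    have "s \<noteq> 0" using s(1) by (metis S.M_simps(4) norm_delta_vec norm_zero zero_neq_one)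
    then show ?thesis by simp
  qed
  ultimately have "0 \<le> coord s x" using zero_le_power2[of "norm r"] by (simp add: zero_le_mult_iff)
  then show ?thesis using s(4) by simp
qed

text \<open>Cutting \<open>h = P x\<close> to its block creates defects only at the boundary, and
  the \<open>s_y\<close> repair them. The resulting expansion of the truncation
  \<open>\<psi>\<close> is read at \<open>x\<close>, where every term carries the factor
  \<open>pk x x\<close>.\<close>

lemma block_identity:
  assumes x: "x \<in> supp" and fin: "finite (K x)"
  shows "(\<Sum>z\<in>K x. pk z z) + (\<Sum>z\<in>K x. \<Sum>y\<in>N z - supp. sk z y) = 1"
proof -
  define h where "h = P x"
  define B where "B = Sigma (K x) (\<lambda>z. N z - supp)"
  have finB: "finite B" using fin by (simp add: B_def)
  have "\<exists>s. M s = delta_vec (snd b) \<and> (\<forall>h. M h = 0 \<longrightarrow> inner s h = 0) \<and> (\<forall>v. coord s v = sk v (snd b))"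
    if "b \<in> B" for b
  proof -
    from that obtain z y where b: "b = (z, y)" "z \<in> K x" "y \<in> N z" "y \<notin> supp" by (auto simp: B_def)
    have "z \<in> supp" using b block_subset by blast
    then show ?thesis using green_vector[of y z] b nbr_verts nbr_sym by (metis snd_conv)
  qed
  then obtain s where s: "\<And>b. b \<in> B \<Longrightarrow> M (s b) = delta_vec (snd b)"
    "\<And>b h. b \<in> B \<Longrightarrow> M h = 0 \<Longrightarrow> inner (s b) h = 0" "\<And>b v. b \<in> B \<Longrightarrow> coord (s b) v = sk v (snd b)"
    by metis
  define \<psi> where "\<psi> = restr (K x) h"
  \<comment> \<open>A vertex of the support outside the block has no neighbour in the block, so
    defects occur only off the support, one for each boundary edge in \<open>B\<close>.\<close>
  have M\<psi>: "M \<psi> = (\<Sum>b\<in>B. coord h (fst b) *\<^sub>R delta_vec (snd b))"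
  proof (rule ell2_eqI)
    fix v
    have "coord (adj \<psi>) v = (\<Sum>w\<in>N v \<inter> K x. coord h w)"
      by (simp add: \<psi>_def coord_adj sum.inter_restrict)
    moreover have "coord (\<Sum>b\<in>B. coord h (fst b) *\<^sub>R delta_vec (snd b)) v =
        (if v \<in> supp then 0 else \<Sum>w\<in>N v \<inter> K x. coord h w)"
    proof -
      have "coord (\<Sum>b\<in>B. coord h (fst b) *\<^sub>R delta_vec (snd b)) v = (\<Sum>b\<in>B. if snd b = v then coord h (fst b) else 0)"
        unfolding coord_sum by (rule sum.cong) auto
      also have "\<dots> = (\<Sum>b\<in>{b\<in>B. snd b = v}. coord h (fst b))"
        using finB by (simp add: sum.inter_filter)
      also have "{b\<in>B. snd b = v} = (\<lambda>z. (z, v)) ` (if v \<in> supp then {} else N v \<inter> K x)"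
        using nbr_sym by (auto simp: B_def)
      also have "(\<Sum>b\<in>(\<lambda>z. (z, v)) ` (if v \<in> supp then {} else N v \<inter> K x). coord h (fst b)) =
          (if v \<in> supp then 0 else \<Sum>w\<in>N v \<inter> K x. coord h w)"
        by (subst sum.reindex) (auto simp: inj_on_def)
      finally show ?thesis .
    qed
    moreover have "(\<Sum>w\<in>N v \<inter> K x. coord h w) = t * coord h v" if v: "v \<in> K x"
    proof -
      have "(\<Sum>w\<in>N v \<inter> K x. coord h w) = (\<Sum>w\<in>N v. coord h w)"
      proof (rule sum.mono_neutral_left)
        show "\<forall>w\<in>N v - N v \<inter> K x. coord h w = 0"
        proof
          fix w assume w: "w \<in> N v - N v \<inter> K x"
          then have "w \<notin> supp" using block_step[OF v] by blast
          then show "coord h w = 0" using w nbr_verts kernel_vanishes[OF _ _ M_P] unfolding h_def by blast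
        qed
      qed auto
      also have "\<dots> = t * coord h v" using arg_cong[OF M_P[of x], of "\<lambda>u. coord u v"] by (simp add: coord_adj h_def)
      finally show ?thesis .
    qed
    moreover have "N v \<inter> K x = {}" if "v \<in> supp" "v \<notin> K x"
      using that block_step nbr_sym by blast
    ultimately show "coord (M \<psi>) v = coord (\<Sum>b\<in>B. coord h (fst b) *\<^sub>R delta_vec (snd b)) v"
      using block_subset[of x] by (cases "v \<in> K x") (auto simp: \<psi>_def)
  qed
  define r where "r = \<psi> - S.proj \<psi> - (\<Sum>b\<in>B. coord h (fst b) *\<^sub>R s b)"
  have "M (\<Sum>b\<in>B. coord h (fst b) *\<^sub>R s b) = (\<Sum>b\<in>B. coord h (fst b) *\<^sub>R delta_vec (snd b))"
    unfolding linear_sum[OF S.linear_M] by (rule sum.cong) (simp_all only: S.M_simps s)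
  then have Mr: "M r = 0" unfolding r_def S.M_simps S.M_proj M\<psi> by simp
  \<comment> \<open>\<open>r\<close> lies in the kernel, while \<open>\<psi> - S.proj \<psi>\<close>
    and all \<open>s b\<close> are orthogonal to the kernel.\<close>
  have "inner r r = inner (\<psi> - S.proj \<psi>) r - (\<Sum>b\<in>B. coord h (fst b) * inner (s b) r)"
    unfolding r_def by (simp add: inner_diff_left inner_sum_left)
  also have "\<dots> = 0"
    using S.inner_proj_kernel[OF Mr, of \<psi>] s(2)[OF _ Mr] by (simp add: inner_diff_left)
  finally have "r = 0" by simp
  then have eq: "\<psi> = S.proj \<psi> + (\<Sum>b\<in>B. coord h (fst b) *\<^sub>R s b)" unfolding r_def by (simp add: algebra_simps)
  have px: "pk x x \<noteq> 0" using x by (simp add: eigen_support_def)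
  have 1: "coord (S.proj \<psi>) x = pk x x * (\<Sum>z\<in>K x. pk z z)"
  proof -
    have "coord (S.proj \<psi>) x = inner (P x) (restr (K x) h)"
      unfolding P_def \<psi>_def S.self_adjoint_proj by simp
    also have "\<dots> = (\<Sum>z\<in>K x. coord h z * coord h z)"
      by (simp add: restr_finite[OF fin] inner_sum_right h_def)
    also have "\<dots> = (\<Sum>z\<in>K x. pk x x * pk z z)"
      by (rule sum.cong) (use pk_block[OF x] in \<open>auto simp: h_def pk_eq power2_eq_square\<close>)
    finally show ?thesis by (simp add: sum_distrib_left)
  qed
  have 2: "coord (\<Sum>b\<in>B. coord h (fst b) *\<^sub>R s b) x = pk x x * (\<Sum>z\<in>K x. \<Sum>y\<in>N z - supp. sk z y)"
  proof -
    have "coord (\<Sum>b\<in>B. coord h (fst b) *\<^sub>R s b) x = (\<Sum>b\<in>B. pk x x * sk (fst b) (snd b))"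
      unfolding coord_sum
    proof (rule sum.cong[OF refl])
      fix b assume b: "b \<in> B"
      then have bK: "fst b \<in> K x" and "snd b \<notin> supp" by (auto simp: B_def)
      then have "proportional (s b)" using proportional_green[OF s(1)[OF b]] by blast
      then have "coord (s b) x * coord h (fst b) = coord (s b) (fst b) * coord h x"
        using block_ratio[OF x bK] unfolding h_def by blast
      then show "coord (coord h (fst b) *\<^sub>R s b) x = pk x x * sk (fst b) (snd b)"
        using s(3)[OF b] by (simp add: h_def pk_eq mult.commute)
    qed
    also have "\<dots> = pk x x * (\<Sum>(z, y)\<in>B. sk z y)" by (simp add: sum_distrib_left split_beta)
    also have "(\<Sum>(z, y)\<in>B. sk z y) = (\<Sum>z\<in>K x. \<Sum>y\<in>N z - supp. sk z y)"
      unfolding B_def using fin by (subst sum.Sigma) simp_all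
    finally show ?thesis .
  qed
  have "pk x x = coord \<psi> x" using block_root[OF x] by (simp add: \<psi>_def h_def pk_eq)
  also have "\<dots> = pk x x * ((\<Sum>z\<in>K x. pk z z) + (\<Sum>z\<in>K x. \<Sum>y\<in>N z - supp. sk z y))"
    by (subst eq) (simp only: coord_simps(2) 1 2 distrib_left)
  finally show ?thesis using px by simp
qed

end

section \<open>Finite trees and their eigenvalues\<close>

definition tree_eigenvalue :: "nat \<Rightarrow> real \<Rightarrow> bool" where
  "tree_eigenvalue n t \<longleftrightarrow>
     (\<exists>G. tree_graph G \<and> verts G = {..<n} \<and> eigenvalue (adjacency_matrix n G) t)"

lemma tree_complexity_le: "tree_eigenvalue n t \<Longrightarrow> tree_complexity t \<le> n"
  unfolding tree_complexity_def tree_eigenvalue_def by (rule Least_le)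

lemma adjacency_matrix_carrier: "adjacency_matrix n G \<in> carrier_mat n n"
  by (simp add: adjacency_matrix_def)

lemma finite_eigenvalues:
  fixes A :: "real mat"
  assumes "A \<in> carrier_mat n n"
  shows "finite {t. eigenvalue A t}"
proof -
  have "char_poly A \<noteq> 0" using degree_monic_char_poly[OF assms] by auto
  then show ?thesis unfolding eigenvalue_root_char_poly[OF assms] by (rule poly_roots_finite)
qed

text \<open>A tree enters only through its 0-1 matrix, and each size allows finitely many of
  these.\<close>

lemma finite_tree_eigenvalues: "finite {t. tree_eigenvalue n t}"
proof -
  define m :: "(nat \<times> nat) set \<Rightarrow> real mat" where "m E = mat n n (\<lambda>ij. if ij \<in> E then 1 else 0)" for E
  have "{t. tree_eigenvalue n t} \<subseteq> (\<Union>E\<in>Pow ({..<n} \<times> {..<n}). {t. eigenvalue (m E) t})"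
  proof
    fix t assume "t \<in> {t. tree_eigenvalue n t}"
    then obtain G where G: "eigenvalue (adjacency_matrix n G) t" by (auto simp: tree_eigenvalue_def)
    have "adjacency_matrix n G = m ({(i, j). {i, j} \<in> edges G} \<inter> {..<n} \<times> {..<n})"
      unfolding adjacency_matrix_def m_def by (rule eq_matI) (auto simp: adj_entry_def)
    then show "t \<in> (\<Union>E\<in>Pow ({..<n} \<times> {..<n}). {t. eigenvalue (m E) t})" using G by auto
  qed
  moreover have "finite (\<Union>E\<in>Pow ({..<n} \<times> {..<n}). {t. eigenvalue (m E) t})"
    by (intro finite_UN_I finite_Pow_iff[THEN iffD2] finite_cartesian_product finite_lessThan finite_eigenvalues[of _ n])
      (simp add: m_def)
  ultimately show ?thesis by (rule finite_subset)
qed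

lemma hermitian_eigenvalue_real:
  fixes A :: "complex mat"
  assumes A: "A \<in> carrier_mat n n" and sym: "\<And>i j. i < n \<Longrightarrow> j < n \<Longrightarrow> A $$ (j, i) = cnj (A $$ (i, j))"
    and z: "eigenvalue A z"
  shows "z \<in> \<real>"
proof -
  obtain v where v: "v \<in> carrier_vec n" "v \<noteq> 0\<^sub>v n" "A *\<^sub>v v = z \<cdot>\<^sub>v v"
    using z A unfolding eigenvalue_def eigenvector_def by auto
  have row: "(\<Sum>j<n. A $$ (i, j) * v $ j) = z * v $ i" if "i < n" for i
  proof -
    have "(A *\<^sub>v v) $ i = (\<Sum>j<n. A $$ (i, j) * v $ j)"
      using A v(1) that by (simp add: scalar_prod_def atLeast0LessThan)
    then show ?thesis using v that by simp
  qed
  define q where "q = (\<Sum>i<n. \<Sum>j<n. cnj (v $ i) * (A $$ (i, j) * v $ j))"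
  define s where "s = (\<Sum>i<n. (cmod (v $ i))\<^sup>2)"
  have "q = (\<Sum>i<n. cnj (v $ i) * (z * v $ i))"
    unfolding q_def sum_distrib_left[symmetric] by (rule sum.cong) (simp_all add: row)
  also have "\<dots> = z * of_real s"
  proof -
    have "cnj (v $ i) * (z * v $ i) = z * of_real ((cmod (v $ i))\<^sup>2)" for i
      unfolding complex_norm_square by (simp only: mult_ac)
    then show ?thesis unfolding s_def of_real_sum sum_distrib_left by (simp only:)
  qed
  finally have qz: "q = z * of_real s" .
  have "cnj q = (\<Sum>i<n. \<Sum>j<n. cnj (v $ j) * (A $$ (j, i) * v $ i))"
  proof -
    have "cnj (cnj (v $ i) * (A $$ (i, j) * v $ j)) = cnj (v $ j) * (A $$ (j, i) * v $ i)" if "i < n" "j < n" for i j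
      unfolding sym[OF that] by simp
    then show ?thesis unfolding q_def cnj_sum by (intro sum.cong refl) simp
  qed
  also have "\<dots> = q" unfolding q_def by (rule sum.swap)
  finally have "q \<in> \<real>" by (simp add: Reals_cnj_iff)
  have "s \<noteq> 0"
  proof
    assume "s = 0"
    then have "\<forall>i\<in>{..<n}. (cmod (v $ i))\<^sup>2 = 0"
      unfolding s_def by (subst (asm) sum_nonneg_eq_0_iff) auto
    then have "v = 0\<^sub>v n" using v(1) by (intro eq_vecI) auto
    then show False using v(2) by blast
  qed
  then have "z = q / of_real s" using qz by simp
  then show ?thesis using \<open>q \<in> \<real>\<close> by simp
qed

text \<open>The witness is the characteristic polynomial of the integer adjacency matrix: it is
  monic, and its complex roots are eigenvalues of a Hermitian matrix.\<close>

lemma tree_eigenvalue_totally_real: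
  assumes "tree_eigenvalue n t"
  shows "t \<in> totally_real_algebraic_integers"
proof -
  obtain G where G: "eigenvalue (adjacency_matrix n G) t" using assms by (auto simp: tree_eigenvalue_def)
  define Z :: "int mat" where "Z = mat n n (\<lambda>(i, j). adj_entry G i j)"
  have Z: "Z \<in> carrier_mat n n" by (simp add: Z_def)
  have "map_mat real_of_int Z = adjacency_matrix n G"
    unfolding Z_def adjacency_matrix_def by (rule eq_matI) (auto simp: adj_entry_def)
  then have "map_poly real_of_int (char_poly Z) = char_poly (adjacency_matrix n G)"
    using of_int_hom.char_poly_hom[OF Z] by metis
  then have "poly (map_poly real_of_int (char_poly Z)) t = 0"
    using G eigenvalue_root_char_poly[OF adjacency_matrix_carrier] by simp
  moreover have "z \<in> \<real>" if "poly (map_poly of_int (char_poly Z)) z = 0" for z :: complex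
  proof (rule hermitian_eigenvalue_real)
    show "map_mat of_int Z \<in> carrier_mat n n" using Z by simp
    show "eigenvalue (map_mat of_int Z) z"
    proof -
      have "char_poly (map_mat of_int Z :: complex mat) = map_poly of_int (char_poly Z)"
        by (rule of_int_hom.char_poly_hom[OF Z])
      then show ?thesis using that eigenvalue_root_char_poly[of "map_mat of_int Z" n z] Z by simp
    qed
    show "map_mat of_int Z $$ (j, i) = cnj (map_mat of_int Z $$ (i, j))" if "i < n" "j < n" for i j
      using that by (simp add: Z_def adj_entry_def insert_commute)
  qed
  moreover have "lead_coeff (char_poly Z) = 1" using degree_monic_char_poly[OF Z] by simp
  ultimately show ?thesis unfolding totally_real_algebraic_integers_def by blast
qed

section \<open>Edge counting in finite subtrees, and blocks as finite trees\<close>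

context bounded_tree
begin

text \<open>Finite connected vertex sets, generated by attaching one vertex at a time so that
  boundary edges can be counted by induction.\<close>

inductive grown :: "nat set \<Rightarrow> bool" where
  start: "x \<in> verts G \<Longrightarrow> grown {x}"
| step: "grown A \<Longrightarrow> u \<in> A \<Longrightarrow> v \<in> N u \<Longrightarrow> v \<notin> A \<Longrightarrow> grown (insert v A)"

lemma grown_finite: "grown A \<Longrightarrow> finite A"
  by (induction rule: grown.induct) auto

definition inside :: "nat set \<Rightarrow> nat rel" where
  "inside A = {(a, b). a \<in> A \<and> b \<in> A \<and> b \<in> N a}"

lemma grown_connected: "grown A \<Longrightarrow> a \<in> A \<Longrightarrow> b \<in> A \<Longrightarrow> (a, b) \<in> (inside A)\<^sup>*"
proof (induction arbitrary: a b rule: grown.induct)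
  case (step A u v)
  have mono: "(inside A)\<^sup>* \<subseteq> (inside (insert v A))\<^sup>*"
    by (rule rtrancl_mono) (auto simp: inside_def)
  have uv: "(u, v) \<in> inside (insert v A)" "(v, u) \<in> inside (insert v A)"
    using step.hyps nbr_sym by (auto simp: inside_def)
  have to_u: "(a, u) \<in> (inside (insert v A))\<^sup>*" "(u, a) \<in> (inside (insert v A))\<^sup>*" if "a \<in> insert v A" for a
    using that step.IH[of a u] step.IH[of u a] step.hyps mono uv by auto
  show ?case using to_u(1)[OF step.prems(1)] to_u(2)[OF step.prems(2)] by (rule rtrancl_trans)
qed (auto simp: inside_def)

text \<open>\<open>A\<close> is connected and avoids \<open>v\<close>, so it lies in the branch of
  \<open>u\<close>; the edge to \<open>u\<close> is the only way from \<open>v\<close> into that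
  branch.\<close>

lemma grown_attach:
  assumes "grown A" "u \<in> A" "v \<in> N u" "v \<notin> A"
  shows "N v \<inter> A = {u}"
proof -
  have uN: "u \<in> N v" using assms nbr_sym by blast
  have sub: "A \<subseteq> branch u v"
  proof
    fix a assume "a \<in> A"
    then have "(u, a) \<in> (inside A)\<^sup>*" using grown_connected assms by blast
    moreover have "inside A \<subseteq> {(a, b). b \<in> N a \<and> {a, b} \<noteq> {u, v}}"
      using assms(4) by (auto simp: inside_def doubleton_eq_iff)
    ultimately show "a \<in> branch u v" unfolding branch_def using rtrancl_mono by blast
  qed
  have "w = u" if "w \<in> N v" "w \<in> A" for w
    using branch_step[OF uN, of w v] that sub not_in_branch[OF uN] nbr_sym by blast
  then show ?thesis using uN assms(2) by blast
qed

text \<open>Attaching \<open>v\<close> removes the edge from \<open>u\<close> and adds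
  \<open>deg v - 1\<close> new boundary edges, a gain of at least \<open>d - 2\<close>. The term
  \<open>2 * card A\<close> stands on the right to avoid subtraction of natural numbers.\<close>

lemma grown_boundary:
  assumes "grown A" and deg: "\<And>x. x \<in> verts G \<Longrightarrow> d \<le> vertex_degree G x"
  shows "d * card A + 2 \<le> (\<Sum>z\<in>A. card (N z - A)) + 2 * card A"
  using assms(1)
proof (induction rule: grown.induct)
  case (start x)
  have "N x - {x} = N x" using nbr_verts by blast
  then show ?case using deg[OF start] by (simp add: vertex_degree_def)
next
  case (step A u v)
  have fin: "finite A" using step grown_finite by blast
  have att: "N v \<inter> A = {u}" by (rule grown_attach[OF step.hyps])
  have "v \<notin> N v" using nbr_verts by blast
  then have "N v - insert v A = N v - {u}" using att by blast
  moreover have "u \<in> N v" using att by blast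
  ultimately have cv: "card (N v - insert v A) + 1 = vertex_degree G v"
    using card.remove[OF finite_N, of u v] by (simp add: vertex_degree_def)
  have cz: "card (N z - A) = card (N z - insert v A) + (if z = u then 1 else 0)" if "z \<in> A" for z
  proof (cases "z = u")
    case True
    have "N u - A = insert v (N u - insert v A)" using step.hyps by blast
    then have "card (N u - A) = card (insert v (N u - insert v A))" by (rule arg_cong)
    also have "\<dots> = Suc (card (N u - insert v A))" by (rule card_insert_disjoint) simp_all
    finally show ?thesis using True by simp
  next
    case False
    then have "v \<notin> N z" using att that nbr_sym by blast
    then have "N z - insert v A = N z - A" by blast
    then show ?thesis using False by simp
  qed
  have "(\<Sum>z\<in>A. card (N z - A)) = (\<Sum>z\<in>A. card (N z - insert v A)) + 1"
    using fin step.hyps(2) by (simp add: cz sum.distrib)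
  moreover have "d \<le> vertex_degree G v" using deg nbr_verts step.hyps by blast
  ultimately show ?case using step.IH cv fin step.hyps(4) by simp
qed

text \<open>A maximal grown subset containing \<open>x\<close> absorbs every step of a path inside
  the block.\<close>

lemma grown_block:
  assumes x: "x \<in> supp" and fin: "finite (K x)"
  shows "grown (K x)"
proof -
  define F where "F = {A. grown A \<and> x \<in> A \<and> A \<subseteq> K x}"
  have "finite F" unfolding F_def using fin by (auto intro: finite_subset[of _ "Pow (K x)"])
  moreover have "{x} \<in> F" using x block_root supp_verts by (auto simp: F_def intro: start)
  ultimately obtain A where A: "A \<in> F" "\<And>B. B \<in> F \<Longrightarrow> A \<subseteq> B \<Longrightarrow> A = B"
    using finite_has_maximal[of F] by blast
  have "K x \<subseteq> A"
  proof
    fix z assume "z \<in> K x"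
    then have "(x, z) \<in> {(a, b). a \<in> supp \<and> b \<in> supp \<and> b \<in> N a}\<^sup>*" by (simp add: block_def)
    then show "z \<in> A"
    proof (induction rule: rtrancl_induct)
      case base
      then show ?case using A by (simp add: F_def)
    next
      case (step y z)
      show ?case
      proof (rule ccontr)
        assume z: "z \<notin> A"
        have "y \<in> K x" "z \<in> N y" "z \<in> supp" using step A by (auto simp: F_def)
        then have "z \<in> K x" using block_step by blast
        then have "insert z A \<in> F" using A z step by (auto simp: F_def intro: grown.step)
        then show False using A(2)[of "insert z A"] z by blast
      qed
    qed
  qed
  then show ?thesis using A by (auto simp: F_def)
qed

lemma block_boundary:
  assumes "x \<in> supp" "finite (K x)" "\<And>x. x \<in> verts G \<Longrightarrow> d \<le> vertex_degree G x"
  shows "d * card (K x) + 2 \<le> (\<Sum>z\<in>K x. card (N z - supp)) + 2 * card (K x)"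
proof -
  have "N z - supp = N z - K x" if "z \<in> K x" for z
    using block_step[OF that] block_subset by blast
  then show ?thesis using grown_boundary[OF grown_block[OF assms(1,2)] assms(3)] by simp
qed

text \<open>The induced subgraph is relabelled by an initial segment of \<open>nat\<close>.
  \<open>P x\<close> vanishes on all outside neighbours of the block, so its restriction is an
  eigenvector, nonzero at \<open>x\<close>.\<close>

lemma tree_eigenvalue_block:
  assumes x: "x \<in> supp" and fin: "finite (K x)"
  shows "tree_eigenvalue (card (K x)) t"
proof -
  define n where "n = card (K x)"
  obtain \<phi> where \<phi>: "bij_betw \<phi> {..<n} (K x)"
    using ex_bij_betw_nat_finite[OF fin] by (auto simp: n_def atLeast0LessThan)
  have inj: "\<phi> i = \<phi> j \<longleftrightarrow> i = j" if "i < n" "j < n" for i j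
    using \<phi> that by (auto simp: bij_betw_def inj_on_def)
  have mem: "\<phi> i \<in> K x" if "i < n" for i using \<phi> that by (auto simp: bij_betw_def)
  define T where "T = Graph {..<n} {{i, j} | i j. i < n \<and> j < n \<and> \<phi> j \<in> N (\<phi> i)}"
  have edge: "{i, j} \<in> edges T \<longleftrightarrow> i < n \<and> j < n \<and> \<phi> j \<in> N (\<phi> i)" for i j
    using nbr_sym by (auto simp: T_def doubleton_eq_iff)
  have "simple_graph T"
    unfolding simple_graph_def
  proof
    fix e assume "e \<in> edges T"
    then obtain i j where e: "e = {i, j}" "i < n" "j < n" "\<phi> j \<in> N (\<phi> i)" by (auto simp: T_def)
    then have "i \<noteq> j" using nbr_verts by blast
    then show "\<exists>x\<in>verts T. \<exists>y\<in>verts T. x \<noteq> y \<and> e = {x, y}" using e by (auto simp: T_def)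
  qed
  moreover have "connected_graph T"
    unfolding connected_graph_def
  proof (intro conjI ballI)
    have "K x \<noteq> {}" using block_root[OF x] by blast
    then have "0 < n" using fin by (simp add: n_def card_gt_0_iff)
    then show "verts T \<noteq> {}" by (auto simp: T_def)
    fix i j assume ij: "i \<in> verts T" "j \<in> verts T"
    then have lt: "i < n" "j < n" by (auto simp: T_def)
    have "(\<phi> i, \<phi> j) \<in> (inside (K x))\<^sup>*"
      using grown_connected[OF grown_block[OF x fin]] mem lt by blast
    then have "\<forall>j. j < n \<longrightarrow> w = \<phi> j \<longrightarrow> (i, j) \<in> (adj_rel T)\<^sup>*" if "w = \<phi> j" for w
      unfolding that
    proof (induction rule: rtrancl_induct)
      case base
      then show ?case using inj lt by auto
    next
      case (step y z)
      show ?case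
      proof (intro allI impI)
        fix k assume k: "k < n" "z = \<phi> k"
        have "y \<in> K x" using step by (auto simp: inside_def)
        then obtain l where l: "l < n" "y = \<phi> l" using \<phi> by (auto simp: bij_betw_def)
        then have "(i, l) \<in> (adj_rel T)\<^sup>*" using step.IH by blast
        moreover have "(l, k) \<in> adj_rel T"
          using step.hyps k l by (auto simp: adj_rel_def edge inside_def)
        ultimately show "(i, k) \<in> (adj_rel T)\<^sup>*" by (rule rtrancl_into_rtrancl)
      qed
    qed
    then show "(i, j) \<in> (adj_rel T)\<^sup>*" using lt by blast
  qed
  moreover have "\<not> is_cycle T xs" for xs
  proof
    assume xs: "is_cycle T xs"
    have nth: "xs ! i < n \<and> xs ! (Suc i mod length xs) < n \<and> \<phi> (xs ! (Suc i mod length xs)) \<in> N (\<phi> (xs ! i))"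
      if "i < length xs" for i
      using xs that by (auto simp: is_cycle_def edge)
    have "is_cycle G (map \<phi> xs)"
      unfolding is_cycle_def
    proof (intro conjI allI impI)
      show "3 \<le> length (map \<phi> xs)" using xs by (simp add: is_cycle_def)
      have "distinct xs" using xs by (simp add: is_cycle_def)
      moreover have "inj_on \<phi> (set xs)"
        using nth inj by (auto simp: inj_on_def in_set_conv_nth)
      ultimately show "distinct (map \<phi> xs)" by (simp add: distinct_map)
      fix i assume i: "i < length (map \<phi> xs)"
      then have "Suc i mod length xs < length xs" by (metis length_map mod_less_divisor less_nat_zero_code not_gr0)
      then show "{map \<phi> xs ! i, map \<phi> xs ! (Suc i mod length (map \<phi> xs))} \<in> edges G"
        using nth[of i] i by (simp add: neighbours_def)
    qed
    then show False using tree by (auto simp: tree_graph_def)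
  qed
  moreover have "eigenvalue (adjacency_matrix n T) t"
  proof -
    define w where "w = vec n (\<lambda>i. coord (P x) (\<phi> i))"
    have van: "coord (P x) v = 0" if "v \<in> verts G" "v \<notin> supp" for v
      using kernel_vanishes[OF that M_P] .
    have "adjacency_matrix n T *\<^sub>v w = t \<cdot>\<^sub>v w"
    proof (rule eq_vecI)
      fix i assume "i < dim_vec (t \<cdot>\<^sub>v w)"
      then have i: "i < n" by (simp add: w_def)
      have "(adjacency_matrix n T *\<^sub>v w) $ i = (\<Sum>j<n. adj_entry T i j * coord (P x) (\<phi> j))"
        using i by (simp add: adjacency_matrix_def w_def scalar_prod_def atLeast0LessThan)
      also have "\<dots> = (\<Sum>j<n. if \<phi> j \<in> N (\<phi> i) then coord (P x) (\<phi> j) else 0)"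
        using i by (intro sum.cong) (auto simp: adj_entry_def edge)
      also have "\<dots> = (\<Sum>v\<in>K x. if v \<in> N (\<phi> i) then coord (P x) v else 0)"
        by (rule sum.reindex_bij_betw[OF \<phi>])
      also have "\<dots> = (\<Sum>v\<in>K x \<inter> N (\<phi> i). coord (P x) v)"
        by (rule sum.inter_restrict[OF fin, symmetric])
      also have "\<dots> = (\<Sum>v\<in>N (\<phi> i). coord (P x) v)"
      proof (rule sum.mono_neutral_left)
        show "\<forall>v\<in>N (\<phi> i) - K x \<inter> N (\<phi> i). coord (P x) v = 0"
        proof
          fix v assume v: "v \<in> N (\<phi> i) - K x \<inter> N (\<phi> i)"
          then have "v \<notin> supp" using block_step[OF mem[OF i]] by blast
          then show "coord (P x) v = 0" using v van nbr_verts by blast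
        qed
      qed auto
      also have "\<dots> = t * coord (P x) (\<phi> i)"
        using arg_cong[OF M_P[of x], of "\<lambda>u. coord u (\<phi> i)"] by (simp add: coord_adj)
      finally show "(adjacency_matrix n T *\<^sub>v w) $ i = (t \<cdot>\<^sub>v w) $ i" using i by (simp add: w_def)
    qed (simp add: adjacency_matrix_def w_def)
    moreover have "w \<noteq> 0\<^sub>v n"
    proof -
      have "x \<in> \<phi> ` {..<n}" using \<phi> block_root[OF x] by (simp add: bij_betw_def)
      then obtain i where i: "i < n" "\<phi> i = x" by blast
      have "coord (P x) x \<noteq> 0" using x by (simp add: eigen_support_def pk_eq)
      then have "w $ i \<noteq> 0" using i by (simp add: w_def)
      then show ?thesis using i by auto
    qed
    ultimately show ?thesis
      unfolding eigenvalue_def eigenvector_def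
      by (intro exI[of _ w]) (simp add: adjacency_matrix_def w_def)
  qed
  ultimately show ?thesis unfolding tree_eigenvalue_def tree_graph_def n_def[symmetric]
    by (intro exI[of _ T]) (auto simp: T_def)
qed

end

section \<open>Borel functions of rooted graphs\<close>

text \<open>Cylinder sets: membership is decided by the ball of some fixed radius around the roots.
  They live on graphs rather than on classes, so that functions of a graph and several vertices can
  be treated directly.\<close>

definition local_set :: "nat \<Rightarrow> nat rooted set \<Rightarrow> bool" where
  "local_set k A \<longleftrightarrow> A \<subseteq> rooted_graphs k \<and> (\<exists>n::nat. \<forall>P\<in>rooted_graphs k. \<forall>Q\<in>rooted_graphs k.
     P \<in> A \<longrightarrow> rooted_iso (rooted_ball (real n) P) (rooted_ball (real n) Q) \<longrightarrow> Q \<in> A)"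

definition graph_space :: "nat \<Rightarrow> nat rooted measure" where
  "graph_space k = sigma (rooted_graphs k) {A. local_set k A}"

lemma local_set_subset: "{A. local_set k A} \<subseteq> Pow (rooted_graphs k)"
  by (auto simp: local_set_def)

lemma space_graph_space [simp]: "space (graph_space k) = rooted_graphs k"
  unfolding graph_space_def using local_set_subset by (simp add: space_measure_of_conv)

lemma sets_graph_space: "sets (graph_space k) = sigma_sets (rooted_graphs k) {A. local_set k A}"
  unfolding graph_space_def using local_set_subset by (rule sets_measure_of)

lemma local_set_measurable: "local_set k A \<Longrightarrow> A \<in> sets (graph_space k)"
  unfolding sets_graph_space by (rule sigma_sets.Basic) simp

lemma local_setI:
  assumes "A \<subseteq> rooted_graphs k"
    and "\<And>P Q. P \<in> rooted_graphs k \<Longrightarrow> Q \<in> rooted_graphs k \<Longrightarrow> P \<in> A \<Longrightarrow>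
      rooted_iso (rooted_ball (real n) P) (rooted_ball (real n) Q) \<Longrightarrow> Q \<in> A"
  shows "local_set k A"
  using assms unfolding local_set_def by blast

lemma ball_iso_le:
  assumes "P \<in> rooted_graphs k" "Q \<in> rooted_graphs k" "n \<le> (m::nat)"
    "rooted_iso (rooted_ball (real m) P) (rooted_ball (real m) Q)"
  shows "rooted_iso (rooted_ball (real n) P) (rooted_ball (real n) Q)"
  by (rule ball_iso_mono[OF wf_rooted_graphs[OF assms(1)] wf_rooted_graphs[OF assms(2)] _ _ assms(4)])
    (use assms(3) in simp_all)

lemma Int_stable_local_set: "Int_stable {A. local_set k A}"
proof (rule Int_stableI)
  fix A B assume AB: "A \<in> {A. local_set k A}" "B \<in> {A. local_set k A}"
  then obtain n where n: "\<And>P Q. P \<in> rooted_graphs k \<Longrightarrow> Q \<in> rooted_graphs k \<Longrightarrow> P \<in> A \<Longrightarrow>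
      rooted_iso (rooted_ball (real n) P) (rooted_ball (real n) Q) \<Longrightarrow> Q \<in> A"
    by (auto simp: local_set_def)
  from AB have "local_set k B" by simp
  then obtain m where m: "\<And>P Q. P \<in> rooted_graphs k \<Longrightarrow> Q \<in> rooted_graphs k \<Longrightarrow> P \<in> B \<Longrightarrow>
      rooted_iso (rooted_ball (real m) P) (rooted_ball (real m) Q) \<Longrightarrow> Q \<in> B"
    unfolding local_set_def by blast
  have "local_set k (A \<inter> B)"
  proof (rule local_setI[where n = "max n m"])
    show "A \<inter> B \<subseteq> rooted_graphs k" using AB by (auto simp: local_set_def)
    fix P Q assume PQ: "P \<in> rooted_graphs k" "Q \<in> rooted_graphs k" "P \<in> A \<inter> B"
      and iso: "rooted_iso (rooted_ball (real (max n m)) P) (rooted_ball (real (max n m)) Q)"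
    have "rooted_iso (rooted_ball (real n) P) (rooted_ball (real n) Q)"
      "rooted_iso (rooted_ball (real m) P) (rooted_ball (real m) Q)"
      by (rule ball_iso_le[OF PQ(1,2) max.cobounded1 iso], rule ball_iso_le[OF PQ(1,2) max.cobounded2 iso])
    then show "Q \<in> A \<inter> B" using n[OF PQ(1,2)] m[OF PQ(1,2)] PQ(3) by blast
  qed
  then show "A \<inter> B \<in> {A. local_set k A}" by simp
qed

lemma local_function_measurable:
  assumes "\<And>P. P \<in> rooted_graphs k \<Longrightarrow> F P \<in> space M"
    and "\<And>P Q. P \<in> rooted_graphs k \<Longrightarrow> Q \<in> rooted_graphs k \<Longrightarrow>
      rooted_iso (rooted_ball (real n) P) (rooted_ball (real n) Q) \<Longrightarrow> F P = F Q"
  shows "F \<in> measurable (graph_space k) M"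
proof (rule measurableI)
  fix A
  have "local_set k (F -` A \<inter> rooted_graphs k)"
    by (rule local_setI[where n = n]) (use assms(2) in auto)
  then show "F -` A \<inter> space (graph_space k) \<in> sets (graph_space k)"
    using local_set_measurable by simp
qed (use assms(1) in simp)

text \<open>Distance below \<open>1 / (1 + n)\<close> means agreement on the ball of radius
  \<open>n\<close>, so local sets pull back to open sets. This transfers measurability from graphs
  to the space of classes.\<close>

lemma representative_measurable:
  assumes k: "0 < k"
  shows "representative \<in> measurable (rooted_borel k) (graph_space k)"
  unfolding graph_space_def
proof (rule measurable_measure_of[OF local_set_subset])
  interpret Metric_space "rooted_classes k" class_dist using k by (rule Metric_space_rooted_classes)
  show "representative \<in> space (rooted_borel k) \<rightarrow> rooted_graphs k"
    using representative_props(2) by (auto simp: space_rooted_borel[OF k])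
  fix A assume "A \<in> {A. local_set k A}"
  then obtain n where n: "\<And>P Q. P \<in> rooted_graphs k \<Longrightarrow> Q \<in> rooted_graphs k \<Longrightarrow> P \<in> A \<Longrightarrow>
      rooted_iso (rooted_ball (real n) P) (rooted_ball (real n) Q) \<Longrightarrow> Q \<in> A"
    by (auto simp: local_set_def)
  let ?U = "representative -` A \<inter> rooted_classes k"
  have "openin mtopology ?U"
    unfolding openin_mtopology
  proof (intro conjI allI impI)
    fix c assume c: "c \<in> ?U"
    have "mball c (1 / (1 + real n)) \<subseteq> ?U"
    proof
      fix d assume "d \<in> mball c (1 / (1 + real n))"
      then have d: "d \<in> rooted_classes k" and lt: "class_dist c d < 1 / (1 + real n)" by auto
      define a where "a = agreement_radius (representative c) (representative d)"
      have "ennreal (real n) < a"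
      proof (rule ccontr)
        assume "\<not> ennreal (real n) < a"
        then have "a \<le> ennreal (real n)" by simp
        then obtain x where x: "a = ennreal x" "0 \<le> x" "x \<le> real n"
          by (cases a) (auto simp: top_unique)
        have "1 / (1 + ennreal x) = ennreal 1 / ennreal (1 + x)" using x by (simp add: ennreal_plus)
        also have "\<dots> = ennreal (1 / (1 + x))" by (rule divide_ennreal) (use x in auto)
        finally have "class_dist c d = 1 / (1 + x)" using x unfolding class_dist_def a_def[symmetric] by simp
        moreover have "1 / (1 + real n) \<le> 1 / (1 + x)" using x by (intro divide_left_mono) auto
        ultimately show False using lt by simp
      qed
      then obtain r where r: "ennreal (real n) < ennreal r" "0 \<le> r"
        "rooted_iso (rooted_ball r (representative c)) (rooted_ball r (representative d))"
        unfolding a_def agreement_radius_def less_SUP_iff by blast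
      have cg: "representative c \<in> rooted_graphs k" "representative d \<in> rooted_graphs k"
        using c d representative_props(2) by auto
      have "rooted_iso (rooted_ball (real n) (representative c)) (rooted_ball (real n) (representative d))"
        using ball_iso_mono[OF wf_rooted_graphs[OF cg(1)] wf_rooted_graphs[OF cg(2)] _ _ r(3), of "real n"] r(1,2)
        by (simp add: ennreal_less_iff)
      then show "d \<in> ?U" using n[OF cg] c d by auto
    qed
    then show "\<exists>r>0. mball c r \<subseteq> ?U" by (intro exI[of _ "1 / (1 + real n)"]) simp
  qed auto
  then show "representative -` A \<inter> space (rooted_borel k) \<in> sets (rooted_borel k)"
    unfolding space_rooted_borel[OF k] by (intro sigma_sets.Basic) simp
qed

text \<open>Isomorphic graphs are not separated by any local set, hence by no set of the generated
  sigma-algebra; measurable functions thus descend to isomorphism classes.\<close>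

lemma measurable_iso_invariant:
  fixes F :: "nat rooted \<Rightarrow> 'b :: t1_space"
  assumes F: "F \<in> borel_measurable (graph_space k)"
    and PQ: "P \<in> rooted_graphs k" "Q \<in> rooted_graphs k" "rooted_iso P Q"
  shows "F P = F Q"
proof -
  have inv: "P \<in> A \<longleftrightarrow> Q \<in> A" if "A \<in> sigma_sets (rooted_graphs k) {A. local_set k A}" for A
    using that
  proof (induction rule: sigma_sets.induct)
    case (Basic A)
    then obtain n where n: "\<And>P Q. P \<in> rooted_graphs k \<Longrightarrow> Q \<in> rooted_graphs k \<Longrightarrow> P \<in> A \<Longrightarrow>
      rooted_iso (rooted_ball (real n) P) (rooted_ball (real n) Q) \<Longrightarrow> Q \<in> A"
      by (auto simp: local_set_def)
    have "rooted_iso (rooted_ball (real n) P) (rooted_ball (real n) Q)"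
      by (rule rooted_iso_ball[OF PQ(3) wf_rooted_graphs[OF PQ(1)] wf_rooted_graphs[OF PQ(2)]]) simp
    then show ?case using n PQ rooted_iso_sym by blast
  qed (use PQ in auto)
  have "F -` {F P} \<inter> rooted_graphs k \<in> sets (graph_space k)"
    using measurable_sets[OF F, of "{F P}"] by simp
  then have "P \<in> F -` {F P} \<inter> rooted_graphs k \<longleftrightarrow> Q \<in> F -` {F P} \<inter> rooted_graphs k"
    by (intro inv) (simp add: sets_graph_space)
  then show ?thesis using PQ by simp
qed

text \<open>Roots within distance \<open>n\<close> of the old ones see their \<open>r\<close>-ball
  already inside the ball of radius \<open>n + r\<close>.\<close>

lemma ball_at_inner_roots:
  fixes n r m :: nat
  assumes wf: "wf_rooted P" and os: "set os \<subseteq> ball_verts (real n) P" and m: "n + r \<le> m"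
  shows "rooted_ball (real r) (fst (rooted_ball (real m) P), os) = rooted_ball (real r) (fst P, os)"
proof -
  let ?G = "fst P" and ?H = "fst (rooted_ball (real m) P)"
  have walk: "v \<in> ball_verts (real m) P \<and> (u, v) \<in> adj_rel ?H ^^ i"
    if u: "u \<in> set os" and "i \<le> r" "(u, v) \<in> adj_rel ?G ^^ i" for u v i
    using that(2,3)
  proof (induction i arbitrary: v)
    case 0
    then show ?case using u os m ball_verts_mono[of "real n" "real m" P] by auto
  next
    case (Suc i)
    then obtain w where w: "(u, w) \<in> adj_rel ?G ^^ i" "{w, v} \<in> edges ?G" by (auto simp: adj_rel_def)
    have IH: "w \<in> ball_verts (real m) P" "(u, w) \<in> adj_rel ?H ^^ i" using Suc w by auto
    have v: "v \<in> verts ?G" using w(2) wf by (auto simp: wf_rooted_def)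
    obtain o' j where j: "o' \<in> set (snd P)" "real j \<le> real n" "(o', u) \<in> adj_rel ?G ^^ j"
      using os u unfolding ball_verts_def by blast
    have "(o', v) \<in> adj_rel ?G ^^ (j + Suc i)"
      using j(3) Suc.prems(2) by (auto simp: relpow_add)
    moreover have "real (j + Suc i) \<le> real m" using j(2) Suc.prems(1) m by simp
    ultimately have vb: "v \<in> ball_verts (real m) P" using j(1) v unfolding ball_verts_def by blast
    then have "(w, v) \<in> adj_rel ?H" using w IH by (auto simp: adj_rel_def)
    then show ?case using IH vb by auto
  qed
  have mono: "adj_rel ?H \<subseteq> adj_rel ?G" by (auto simp: adj_rel_def)
  have eq: "ball_verts (real r) (?H, os) = ball_verts (real r) (?G, os)"
  proof (intro equalityI subsetI)
    fix v assume "v \<in> ball_verts (real r) (?H, os)"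
    then show "v \<in> ball_verts (real r) (?G, os)"
      using relpow_mono_rel[OF mono] ball_verts_subset[of "real m" P] unfolding ball_verts_def[of "real r"] by fastforce
  next
    fix v assume "v \<in> ball_verts (real r) (?G, os)"
    then obtain u i where ui: "u \<in> set os" "real i \<le> real r" "(u, v) \<in> adj_rel ?G ^^ i"
      unfolding ball_verts_def by auto
    from walk[OF ui(1) _ ui(3)] ui(2) have "v \<in> ball_verts (real m) P" "(u, v) \<in> adj_rel ?H ^^ i" by auto
    then show "v \<in> ball_verts (real r) (?H, os)" using ui unfolding ball_verts_def[of "real r"] by auto
  qed
  moreover have "ball_verts (real r) (?H, os) \<subseteq> ball_verts (real m) P"
    using ball_verts_subset[of "real r" "(?H, os)"] by simp
  ultimately show ?thesis by (auto simp: rooted_ball_def)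
qed

lemma ball_iso_inner_roots:
  fixes n r m :: nat
  assumes PQ: "P \<in> rooted_graphs k" "Q \<in> rooted_graphs k"
    and \<phi>: "iso_map \<phi> (rooted_ball (real m) P) (rooted_ball (real m) Q)"
    and os: "set os \<subseteq> ball_verts (real n) P" and m: "n + r \<le> m"
  shows "rooted_iso (rooted_ball (real r) (fst P, os)) (rooted_ball (real r) (fst Q, map \<phi> os))"
    and "\<phi> ` ball_verts (real n) P = ball_verts (real n) Q"
proof -
  have wf: "wf_rooted P" "wf_rooted Q" using PQ wf_rooted_graphs by blast+
  have wfb: "wf_rooted (rooted_ball (real m) P)" "wf_rooted (rooted_ball (real m) Q)"
    using wf by (auto intro: wf_rooted_ball)
  have "\<phi> ` ball_verts (real n) (rooted_ball (real m) P) = ball_verts (real n) (rooted_ball (real m) Q)"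
    by (rule ball_verts_image[OF \<phi> wfb])
  moreover have "ball_verts (real n) (rooted_ball (real m) P') = ball_verts (real n) P'" if "wf_rooted P'" for P' :: "nat rooted"
    using arg_cong[OF ball_of_ball[OF that, of "real n" "real m"], of "\<lambda>R. verts (fst R)"] m by simp
  ultimately show im: "\<phi> ` ball_verts (real n) P = ball_verts (real n) Q" using wf by simp
  have sub: "ball_verts (real n) P' \<subseteq> ball_verts (real m) P'" for P' :: "nat rooted"
    using m by (intro ball_verts_mono) simp
  let ?P = "(fst (rooted_ball (real m) P), os)" and ?Q = "(fst (rooted_ball (real m) Q), map \<phi> os)"
  have os': "set (map \<phi> os) \<subseteq> ball_verts (real n) Q" using os im by auto
  have wf': "wf_rooted ?P" using wfb(1) order_trans[OF os sub] by (simp add: wf_rooted_def)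
  have wf'': "wf_rooted ?Q" using wfb(2) order_trans[OF os' sub] by (simp add: wf_rooted_def)
  have "iso_map \<phi> ?P ?Q" using \<phi> by (simp add: iso_map_def)
  from iso_map_ball[OF this wf' wf'', of "real r"]
  have "iso_map \<phi> (rooted_ball (real r) (fst P, os)) (rooted_ball (real r) (fst Q, map \<phi> os))"
    unfolding ball_at_inner_roots[OF wf(1) os m] ball_at_inner_roots[OF wf(2) os' m] .
  moreover have "set os \<subseteq> ball_verts (real r) (fst P, os)"
  proof -
    have "wf_rooted (fst P, os)" using wf os ball_verts_subset[of "real n" P] by (auto simp: wf_rooted_def)
    from roots_in_ball[OF this, of "real r"] show ?thesis by simp
  qed
  ultimately show "rooted_iso (rooted_ball (real r) (fst P, os)) (rooted_ball (real r) (fst Q, map \<phi> os))"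
    unfolding rooted_iso_iff by auto
qed

lemma select_roots_measurable:
  assumes "length is = j" "\<And>i. i \<in> set is \<Longrightarrow> i < k"
  shows "(\<lambda>P. (fst P, map (\<lambda>i. snd P ! i) is)) \<in> measurable (graph_space k) (graph_space j)"
  unfolding graph_space_def[of j]
proof (rule measurable_measure_of[OF local_set_subset])
  let ?s = "\<lambda>P :: nat rooted. (fst P, map (\<lambda>i. snd P ! i) is)"
  have sp: "?s P \<in> rooted_graphs j" "set (snd (?s P)) \<subseteq> set (snd P)" if "P \<in> rooted_graphs k" for P
  proof -
    have "length (snd P) = k" "set (snd P) \<subseteq> verts (fst P)" using that by (auto simp: rooted_graphs_def)
    then show *: "set (snd (?s P)) \<subseteq> set (snd P)" using assms(2) by (auto intro!: nth_mem)
    then have "set (snd (?s P)) \<subseteq> verts (fst P)" using \<open>set (snd P) \<subseteq> verts (fst P)\<close> by (rule order_trans)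
    then show "?s P \<in> rooted_graphs j" using that assms(1) by (cases P) (simp add: rooted_graphs_def)
  qed
  then show "?s \<in> space (graph_space k) \<rightarrow> rooted_graphs j" by simp
  fix A assume "A \<in> {A. local_set j A}"
  then obtain n where n: "\<And>P Q. P \<in> rooted_graphs j \<Longrightarrow> Q \<in> rooted_graphs j \<Longrightarrow> P \<in> A \<Longrightarrow>
      rooted_iso (rooted_ball (real n) P) (rooted_ball (real n) Q) \<Longrightarrow> Q \<in> A"
    by (auto simp: local_set_def)
  have "local_set k (?s -` A \<inter> rooted_graphs k)"
  proof (rule local_setI[where n = n])
    fix P Q assume PQ: "P \<in> rooted_graphs k" "Q \<in> rooted_graphs k" "P \<in> ?s -` A \<inter> rooted_graphs k"
      and iso: "rooted_iso (rooted_ball (real n) P) (rooted_ball (real n) Q)"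
    obtain \<phi> where \<phi>: "iso_map \<phi> (rooted_ball (real n) P) (rooted_ball (real n) Q)"
      using iso by (auto simp: rooted_iso_iff)
    have "set (snd (?s P)) \<subseteq> ball_verts (real 0) P"
      using sp(2)[OF PQ(1)] roots_in_ball[OF wf_rooted_graphs[OF PQ(1)], of "real 0"] by auto
    from ball_iso_inner_roots(1)[OF PQ(1,2) \<phi> this, of n]
    have "rooted_iso (rooted_ball (real n) (?s P)) (rooted_ball (real n) (fst Q, map \<phi> (snd (?s P))))" by simp
    moreover have eq: "map \<phi> (snd (?s P)) = snd (?s Q)"
    proof -
      have "snd Q = map \<phi> (snd P)" using \<phi> by (simp add: iso_map_def)
      moreover have "length (snd P) = k" using PQ(1) by (auto simp: rooted_graphs_def)
      ultimately show ?thesis using assms(2) by simp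
    qed
    ultimately have "rooted_iso (rooted_ball (real n) (?s P)) (rooted_ball (real n) (?s Q))"
      by (simp only: eq snd_conv)
    then have "?s Q \<in> A" using n[OF sp(1)[OF PQ(1)] sp(1)[OF PQ(2)]] PQ(3) by simp
    then show "Q \<in> ?s -` A \<inter> rooted_graphs k" using PQ(2) by simp
  qed simp
  then show "?s -` A \<inter> space (graph_space k) \<in> sets (graph_space k)"
    using local_set_measurable by simp
qed

section \<open>Summing over an additional root\<close>

lemma add_root: "P \<in> rooted_graphs k \<Longrightarrow> z \<in> verts (fst P) \<Longrightarrow> (fst P, z # snd P) \<in> rooted_graphs (Suc k)"
  by (auto simp: rooted_graphs_def)

text \<open>For a local set of radius \<open>r\<close>, the count over the \<open>n\<close>-ball is
  determined by the ball of radius \<open>n + r\<close>. The pi-lambda principle extends this to the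
  generated sigma-algebra.\<close>

lemma count_ball_measurable:
  fixes n :: nat
  assumes "A \<in> sets (graph_space (Suc k))"
  shows "(\<lambda>P. \<Sum>z\<in>ball_verts (real n) P. indicator A (fst P, z # snd P) :: real) \<in> borel_measurable (graph_space k)"
proof -
  let ?S = "\<lambda>A P. \<Sum>z\<in>ball_verts (real n) P. indicator A (fst P, z # snd P) :: real"
  have mem: "(fst P, z # snd P) \<in> rooted_graphs (Suc k)" if "P \<in> rooted_graphs k" "z \<in> ball_verts (real n) P" for P z
    using that by (intro add_root) (auto simp: ball_verts_def)
  have local: "?S A \<in> borel_measurable (graph_space k)" if "local_set (Suc k) A" for A
  proof -
    from that obtain r where r: "\<And>P Q. P \<in> rooted_graphs (Suc k) \<Longrightarrow> Q \<in> rooted_graphs (Suc k) \<Longrightarrow> P \<in> A \<Longrightarrow>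
      rooted_iso (rooted_ball (real r) P) (rooted_ball (real r) Q) \<Longrightarrow> Q \<in> A"
      by (auto simp: local_set_def)
    show ?thesis
    proof (rule local_function_measurable[where n = "n + r"])
      fix P Q assume PQ: "P \<in> rooted_graphs k" "Q \<in> rooted_graphs k"
        and iso: "rooted_iso (rooted_ball (real (n + r)) P) (rooted_ball (real (n + r)) Q)"
      obtain \<phi> where \<phi>: "iso_map \<phi> (rooted_ball (real (n + r)) P) (rooted_ball (real (n + r)) Q)"
        using iso by (auto simp: rooted_iso_iff)
      have im: "\<phi> ` ball_verts (real n) P = ball_verts (real n) Q"
        by (rule ball_iso_inner_roots(2)[OF PQ \<phi>, of "[]" n r]) simp_all
      have "inj_on \<phi> (ball_verts (real (n + r)) P)" using \<phi> by (simp add: iso_map_def bij_betw_def)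
      moreover have "ball_verts (real n) P \<subseteq> ball_verts (real (n + r)) P" by (rule ball_verts_mono) simp
      ultimately have bij: "bij_betw \<phi> (ball_verts (real n) P) (ball_verts (real n) Q)"
        using im by (auto simp: bij_betw_def inj_on_subset)
      have ind: "indicator A (fst Q, \<phi> z # snd Q) = (indicator A (fst P, z # snd P) :: real)"
        if z: "z \<in> ball_verts (real n) P" for z
      proof -
        have roots: "snd Q = map \<phi> (snd P)" using \<phi> by (simp add: iso_map_def)
        have "set (z # snd P) \<subseteq> ball_verts (real n) P"
          using z roots_in_ball[OF wf_rooted_graphs[OF PQ(1)], of "real n"] by simp
        from ball_iso_inner_roots(1)[OF PQ \<phi> this, of r]
        have iso': "rooted_iso (rooted_ball (real r) (fst P, z # snd P)) (rooted_ball (real r) (fst Q, \<phi> z # snd Q))"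
          using roots by simp
        have "\<phi> z \<in> ball_verts (real n) Q" using im z by blast
        from r[OF mem[OF PQ(1) z] mem[OF PQ(2) this] _ iso'] r[OF mem[OF PQ(2) this] mem[OF PQ(1) z] _ rooted_iso_sym[OF iso']]
        have "(fst P, z # snd P) \<in> A \<longleftrightarrow> (fst Q, \<phi> z # snd Q) \<in> A" by (rule iffI)
        then show ?thesis by (simp add: indicator_def)
      qed
      show "?S A P = ?S A Q"
        unfolding sum.reindex_bij_betw[OF bij, symmetric] by (rule sum.cong) (simp_all add: ind)
    qed simp
  qed
  have "A \<in> sigma_sets (rooted_graphs (Suc k)) {A. local_set (Suc k) A}" using assms by (simp add: sets_graph_space)
  with Int_stable_local_set[of "Suc k"] local_set_subset[of "Suc k"] show ?thesis
  proof (induction A rule: sigma_sets_induct_disjoint)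
    case (basic A)
    then show ?case using local by simp
  next
    case empty
    then show ?case by simp
  next
    case (compl A)
    have "local_set (Suc k) (rooted_graphs (Suc k))" by (rule local_setI) auto
    then have "(\<lambda>P. ?S (rooted_graphs (Suc k)) P - ?S A P) \<in> borel_measurable (graph_space k)"
      using compl local by (intro borel_measurable_diff)
    moreover have "?S (rooted_graphs (Suc k)) P - ?S A P = ?S (rooted_graphs (Suc k) - A) P"
      if "P \<in> rooted_graphs k" for P
      unfolding sum_subtractf[symmetric] by (rule sum.cong) (auto simp: indicator_def mem[OF that])
    ultimately show ?case by (subst measurable_cong[where g = "\<lambda>P. ?S (rooted_graphs (Suc k)) P - ?S A P"]) simp_all
  next
    case (union A)
    have sums: "(\<lambda>i. indicator (A i) x :: real) sums indicator (\<Union>i. A i) x" for x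
      by (rule indicator_sums) (use union(1) in \<open>auto simp: disjoint_family_on_def\<close>)
    have "?S (\<Union>i. A i) = (\<lambda>P. \<Sum>i. ?S (A i) P)"
    proof
      fix P
      have "(\<lambda>i. ?S (A i) P) sums ?S (\<Union>i. A i) P" by (intro sums_sum sums)
      then show "?S (\<Union>i. A i) P = (\<Sum>i. ?S (A i) P)" by (rule sums_unique)
    qed
    then show ?case using union(3) by (simp add: borel_measurable_suminf)
  qed
qed

lemma sum_ball_measurable:
  fixes F :: "nat rooted \<Rightarrow> ennreal" and n :: nat
  assumes "F \<in> borel_measurable (graph_space (Suc k))"
  shows "(\<lambda>P. \<Sum>z\<in>ball_verts (real n) P. F (fst P, z # snd P)) \<in> borel_measurable (graph_space k)"
  using assms
proof (induction rule: borel_measurable_induct)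
  case (cong f g)
  have "(\<Sum>z\<in>ball_verts (real n) P. g (fst P, z # snd P)) = (\<Sum>z\<in>ball_verts (real n) P. f (fst P, z # snd P))"
    if "P \<in> rooted_graphs k" for P
    using cong(3) add_root[OF that] ball_verts_subset by (intro sum.cong) fastforce+
  then show ?case using cong(4) by (subst (asm) measurable_cong) simp_all
next
  case (set A)
  have "(\<lambda>P. \<Sum>z\<in>ball_verts (real n) P. indicator A (fst P, z # snd P)) =
    (\<lambda>P. ennreal (\<Sum>z\<in>ball_verts (real n) P. indicator A (fst P, z # snd P)))"
    by (simp add: sum_ennreal[symmetric] ennreal_indicator)
  then show ?case using count_ball_measurable[OF set] by simp
next
  case (mult u c)
  then show ?case by (simp add: sum_distrib_left[symmetric])
next
  case (add u v)
  then show ?case by (simp add: sum.distrib)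
next
  case (seq U)
  have "(\<Sum>z\<in>ball_verts (real n) P. (SUP i. U i) (fst P, z # snd P)) =
    (SUP i. \<Sum>z\<in>ball_verts (real n) P. U i (fst P, z # snd P))" for P
  proof -
    have "incseq (\<lambda>i. U i (fst P, z # snd P))" for z
      using seq(3) by (auto simp: incseq_def le_fun_def)
    then show ?thesis unfolding SUP_apply by (subst ennreal_SUP_sum) simp_all
  qed
  then show ?case by (simp only:) (intro borel_measurable_SUP seq(5), simp)
qed

text \<open>Connectedness lets the balls around at least one root exhaust the graph, and monotone
  convergence reduces the sum to finite balls.\<close>

lemma nn_integral_root_measurable:
  fixes F :: "nat rooted \<Rightarrow> ennreal"
  assumes F: "F \<in> borel_measurable (graph_space (Suc k))" and k: "0 < k"
  shows "(\<lambda>P. \<integral>\<^sup>+z. F (fst P, z # snd P) \<partial>count_space (verts (fst P))) \<in> borel_measurable (graph_space k)"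
proof -
  have "(\<integral>\<^sup>+z. F (fst P, z # snd P) \<partial>count_space (verts (fst P))) =
      (SUP n. \<Sum>z\<in>ball_verts (real n) P. F (fst P, z # snd P))" if P: "P \<in> rooted_graphs k" for P
  proof -
    define B where "B n = ball_verts (real n) P" for n :: nat
    define f where "f n z = F (fst P, z # snd P) * indicator (B n) z" for n z
    have B_mono: "B n \<subseteq> B m" if "n \<le> m" for n m
      unfolding B_def using that by (intro ball_verts_mono) simp
    have fin: "(\<integral>\<^sup>+z. f n z \<partial>count_space (verts (fst P))) = (\<Sum>z\<in>B n. F (fst P, z # snd P))" for n
    proof -
      have "(\<integral>\<^sup>+z. f n z \<partial>count_space (verts (fst P))) = (\<Sum>z\<in>B n. f n z)"
      proof (rule nn_integral_count_space')
        show "finite (B n)" unfolding B_def by (rule finite_ball[OF P])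
        show "B n \<subseteq> verts (fst P)" unfolding B_def by (rule ball_verts_subset)
      qed (simp add: f_def)
      then show ?thesis by (simp add: f_def)
    qed
    have "(SUP n. f n z) = F (fst P, z # snd P)" if z: "z \<in> verts (fst P)" for z
    proof (rule antisym)
      obtain n where "z \<in> B n" using balls_exhaust[OF P k z] by (auto simp: B_def)
      then show "F (fst P, z # snd P) \<le> (SUP n. f n z)" by (intro SUP_upper2[of n]) (simp_all add: f_def)
    qed (auto intro!: SUP_least simp: f_def indicator_def)
    then have "(\<integral>\<^sup>+z. F (fst P, z # snd P) \<partial>count_space (verts (fst P))) = (\<integral>\<^sup>+z. (SUP n. f n z) \<partial>count_space (verts (fst P)))"
      by (intro nn_integral_cong) simp
    also have "\<dots> = (SUP n. \<integral>\<^sup>+z. f n z \<partial>count_space (verts (fst P)))"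
    proof (rule nn_integral_monotone_convergence_SUP)
      show "incseq f"
        using B_mono by (fastforce simp: incseq_def le_fun_def f_def indicator_def)
    qed simp
    finally show ?thesis unfolding fin by (simp add: B_def)
  qed
  then show ?thesis
    by (subst measurable_cong[where g = "\<lambda>P. SUP n. \<Sum>z\<in>ball_verts (real n) P. F (fst P, z # snd P)"])
      (simp_all add: borel_measurable_SUP sum_ball_measurable[OF F])
qed

text \<open>
  A function of a graph and several vertices is identified with a function of rooted graphs by
  reading off the roots in order.
\<close>

lemma roots_cases:
  "P \<in> rooted_graphs 1 \<Longrightarrow> \<exists>G x. P = (G, [x]) \<and> x \<in> verts G"
  "P \<in> rooted_graphs 2 \<Longrightarrow> \<exists>G x y. P = (G, [x, y]) \<and> x \<in> verts G \<and> y \<in> verts G"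
  "P \<in> rooted_graphs 3 \<Longrightarrow> \<exists>G x y z. P = (G, [x, y, z]) \<and> x \<in> verts G \<and> y \<in> verts G \<and> z \<in> verts G"
  by (auto simp: rooted_graphs_def length_Suc_conv numeral_2_eq_2 numeral_3_eq_3)

definition meas1 :: "'b measure \<Rightarrow> (nat graph \<Rightarrow> nat \<Rightarrow> 'b) \<Rightarrow> bool" where
  "meas1 M \<Phi> \<longleftrightarrow> (\<lambda>P. \<Phi> (fst P) (snd P ! 0)) \<in> measurable (graph_space 1) M"

definition meas2 :: "'b measure \<Rightarrow> (nat graph \<Rightarrow> nat \<Rightarrow> nat \<Rightarrow> 'b) \<Rightarrow> bool" where
  "meas2 M \<Phi> \<longleftrightarrow> (\<lambda>P. \<Phi> (fst P) (snd P ! 0) (snd P ! 1)) \<in> measurable (graph_space 2) M"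

definition meas3 :: "'b measure \<Rightarrow> (nat graph \<Rightarrow> nat \<Rightarrow> nat \<Rightarrow> nat \<Rightarrow> 'b) \<Rightarrow> bool" where
  "meas3 M \<Phi> \<longleftrightarrow> (\<lambda>P. \<Phi> (fst P) (snd P ! 0) (snd P ! 1) (snd P ! 2)) \<in> measurable (graph_space 3) M"

lemma meas1_to_2:
  assumes "meas1 M \<Phi>"
  shows "meas2 M (\<lambda>G x y. \<Phi> G x)" "meas2 M (\<lambda>G x y. \<Phi> G y)"
  using measurable_compose[OF select_roots_measurable[of "[0]" 1 2] assms[unfolded meas1_def]]
    measurable_compose[OF select_roots_measurable[of "[1]" 1 2] assms[unfolded meas1_def]]
  unfolding meas2_def by simp_all

lemma meas2_swap:
  assumes "meas2 M \<Phi>"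
  shows "meas2 M (\<lambda>G x y. \<Phi> G y x)"
proof -
  have "(\<lambda>P. (fst P, map (\<lambda>i. snd P ! i) [1, 0])) \<in> measurable (graph_space 2) (graph_space 2)"
    by (rule select_roots_measurable) auto
  from measurable_compose[OF this assms[unfolded meas2_def]] show ?thesis unfolding meas2_def by simp
qed

lemma meas2_diag: "meas2 M \<Phi> \<Longrightarrow> meas1 M (\<lambda>G x. \<Phi> G x x)"
  using measurable_compose[OF select_roots_measurable[of "[0, 0]" 2 1], of "\<lambda>P. \<Phi> (fst P) (snd P ! 0) (snd P ! 1)" M]
  unfolding meas2_def meas1_def by simp

lemma meas2_to_3:
  assumes "meas2 M \<Phi>"
  shows "meas3 M (\<lambda>G x y z. \<Phi> G x y)" "meas3 M (\<lambda>G x y z. \<Phi> G x z)" "meas3 M (\<lambda>G x y z. \<Phi> G y z)"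
proof -
  have "(\<lambda>P. \<Phi> (fst P) (snd P ! i) (snd P ! j)) \<in> measurable (graph_space 3) M" if "i < 3" "j < 3" for i j
  proof -
    have "(\<lambda>P. (fst P, map (\<lambda>i. snd P ! i) [i, j])) \<in> measurable (graph_space 3) (graph_space 2)"
      by (rule select_roots_measurable) (use that in auto)
    from measurable_compose[OF this assms[unfolded meas2_def]] show ?thesis by simp
  qed
  then show "meas3 M (\<lambda>G x y z. \<Phi> G x y)" "meas3 M (\<lambda>G x y z. \<Phi> G x z)" "meas3 M (\<lambda>G x y z. \<Phi> G y z)"
    unfolding meas3_def by simp_all
qed

lemma meas2_root_local:
  assumes "\<And>G x y H x' y' \<phi>. iso_map \<phi> (rooted_ball 0 (G, [x, y])) (rooted_ball 0 (H, [x', y'])) \<Longrightarrow>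
      (G, [x, y]) \<in> rooted_graphs 2 \<Longrightarrow> (H, [x', y']) \<in> rooted_graphs 2 \<Longrightarrow> \<Phi> G x y \<longleftrightarrow> \<Phi> H x' y'"
  shows "meas2 (count_space UNIV) \<Phi>"
  unfolding meas2_def
proof (rule local_function_measurable[where n = 0])
  fix P Q assume PQ: "P \<in> rooted_graphs 2" "Q \<in> rooted_graphs 2"
    and iso: "rooted_iso (rooted_ball (real 0) P) (rooted_ball (real 0) Q)"
  obtain G x y H x' y' where "P = (G, [x, y])" "Q = (H, [x', y'])"
    using roots_cases(2)[OF PQ(1)] roots_cases(2)[OF PQ(2)] by blast
  then show "\<Phi> (fst P) (snd P ! 0) (snd P ! 1) = \<Phi> (fst Q) (snd Q ! 0) (snd Q ! 1)"
    using assms PQ iso by (auto simp: rooted_iso_iff)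
qed simp

lemma meas2_eq: "meas2 (count_space UNIV) (\<lambda>G x y. x = y)"
proof (rule meas2_root_local)
  fix G x y H x' y' \<phi>
  assume \<phi>: "iso_map \<phi> (rooted_ball 0 (G, [x, y])) (rooted_ball 0 (H, [x', y']))"
    and "(G, [x, y]) \<in> rooted_graphs 2"
  then have "{x, y} \<subseteq> ball_verts 0 (G, [x, y])"
    using roots_in_ball[OF wf_rooted_graphs, of "(G, [x, y])" 2 0] by simp
  moreover have "inj_on \<phi> (ball_verts 0 (G, [x, y]))" "x' = \<phi> x" "y' = \<phi> y"
    using \<phi> by (auto simp: iso_map_def bij_betw_def)
  ultimately show "x = y \<longleftrightarrow> x' = y'" by (auto simp: inj_on_def)
qed

lemma meas2_adj: "meas2 (count_space UNIV) (\<lambda>G x y. x \<in> neighbours G y)"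
proof (rule meas2_root_local)
  fix G x y H x' y' \<phi>
  assume \<phi>: "iso_map \<phi> (rooted_ball 0 (G, [x, y])) (rooted_ball 0 (H, [x', y']))"
    and GH: "(G, [x, y]) \<in> rooted_graphs 2" "(H, [x', y']) \<in> rooted_graphs 2"
  have 1: "{x, y} \<subseteq> ball_verts 0 (G, [x, y])" "{x', y'} \<subseteq> ball_verts 0 (H, [x', y'])"
    using roots_in_ball[OF wf_rooted_graphs[OF GH(1)], of 0] roots_in_ball[OF wf_rooted_graphs[OF GH(2)], of 0] by simp_all
  have 2: "x' = \<phi> x" "y' = \<phi> y" using \<phi> by (auto simp: iso_map_def)
  have "{y, x} \<in> edges (fst (rooted_ball 0 (G, [x, y]))) \<longleftrightarrow> {\<phi> y, \<phi> x} \<in> edges (fst (rooted_ball 0 (H, [x', y'])))"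
    using \<phi> 1(1) unfolding iso_map_def by simp
  then show "x \<in> neighbours G y \<longleftrightarrow> x' \<in> neighbours H y'"
    using 1 2 by (simp add: neighbours_def)
qed

text \<open>The added root comes first, so the summed vertex is the first argument of
  \<open>\<Phi>\<close>; sums over the second go through \<open>meas2_swap\<close>.\<close>

lemma meas1_root_sum:
  fixes \<Phi> :: "nat graph \<Rightarrow> nat \<Rightarrow> nat \<Rightarrow> ennreal"
  assumes "meas2 borel \<Phi>"
  shows "meas1 borel (\<lambda>G x. \<integral>\<^sup>+z. \<Phi> G z x \<partial>count_space (verts G))"
  using nn_integral_root_measurable[of "\<lambda>P. \<Phi> (fst P) (snd P ! 0) (snd P ! 1)" 1] assms
  unfolding meas1_def meas2_def by (simp add: numeral_2_eq_2)

lemma meas2_neighbour_sum: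
  fixes \<Phi> :: "nat graph \<Rightarrow> nat \<Rightarrow> nat \<Rightarrow> nat \<Rightarrow> real"
  assumes "meas3 borel \<Phi>"
  shows "meas2 borel (\<lambda>G x y. \<Sum>z\<in>neighbours G x. \<Phi> G z x y)"
proof -
  have adj: "meas3 (count_space UNIV) (\<lambda>G x y z. x \<in> neighbours G y)" by (rule meas2_to_3(1)[OF meas2_adj])
  \<comment> \<open>Root sums are available for nonnegative functions; \<open>f\<close> will be the
    positive and the negative part.\<close>
  have pos: "(\<lambda>P. enn2real (\<integral>\<^sup>+z. ennreal (if z \<in> neighbours (fst P) (snd P ! 0) then f (\<Phi> (fst P) z (snd P ! 0) (snd P ! 1)) else 0)
      \<partial>count_space (verts (fst P)))) \<in> borel_measurable (graph_space 2)"
    if f[measurable]: "f \<in> borel_measurable borel" for f :: "real \<Rightarrow> real"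
  proof -
    have [measurable]: "Measurable.pred (graph_space 3) (\<lambda>P. snd P ! 0 \<in> neighbours (fst P) (snd P ! 1))"
      using adj unfolding meas3_def .
    have [measurable]: "(\<lambda>P. \<Phi> (fst P) (snd P ! 0) (snd P ! 1) (snd P ! 2)) \<in> borel_measurable (graph_space 3)"
      using assms unfolding meas3_def .
    have "Suc 2 = (3 :: nat)" by simp
    then have m: "(\<lambda>P. ennreal (if snd P ! 0 \<in> neighbours (fst P) (snd P ! 1) then f (\<Phi> (fst P) (snd P ! 0) (snd P ! 1) (snd P ! 2)) else 0))
        \<in> borel_measurable (graph_space (Suc 2))"
      by (simp only:) measurable
    have nth: "(z # xs) ! 1 = xs ! 0" "(z # xs) ! 2 = xs ! 1" for z :: nat and xs by simp_all
    have [measurable]: "(\<lambda>P. \<integral>\<^sup>+z. ennreal (if z \<in> neighbours (fst P) (snd P ! 0) then f (\<Phi> (fst P) z (snd P ! 0) (snd P ! 1)) else 0)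
      \<partial>count_space (verts (fst P))) \<in> borel_measurable (graph_space 2)"
      using nn_integral_root_measurable[OF m] by (simp only: fst_conv snd_conv nth_Cons_0 nth zero_less_numeral)
    show ?thesis by measurable
  qed
  have eq: "(\<Sum>z\<in>neighbours (fst P) (snd P ! 0). \<Phi> (fst P) z (snd P ! 0) (snd P ! 1)) =
     enn2real (\<integral>\<^sup>+z. ennreal (if z \<in> neighbours (fst P) (snd P ! 0) then max 0 (\<Phi> (fst P) z (snd P ! 0) (snd P ! 1)) else 0)
      \<partial>count_space (verts (fst P))) -
     enn2real (\<integral>\<^sup>+z. ennreal (if z \<in> neighbours (fst P) (snd P ! 0) then max 0 (- \<Phi> (fst P) z (snd P ! 0) (snd P ! 1)) else 0)
      \<partial>count_space (verts (fst P)))" if P: "P \<in> rooted_graphs 2" for P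
  proof -
    define X where "X = neighbours (fst P) (snd P ! 0)"
    obtain G x y where Pxy: "P = (G, [x, y])" "x \<in> verts G" using roots_cases(2)[OF P] by blast
    have fin: "finite X" using P Pxy by (auto simp: X_def rooted_graphs_def locally_finite_graph_def)
    have sub: "X \<subseteq> verts (fst P)"
      using wf_rooted_graphs[OF P] by (auto simp: X_def neighbours_def wf_rooted_def)
    have "(\<integral>\<^sup>+z. ennreal (if z \<in> X then max 0 (g z) else 0) \<partial>count_space (verts (fst P))) = ennreal (\<Sum>z\<in>X. max 0 (g z))" for g
    proof -
      have "(\<integral>\<^sup>+z. ennreal (if z \<in> X then max 0 (g z) else 0) \<partial>count_space (verts (fst P))) =
          (\<Sum>z\<in>X. ennreal (if z \<in> X then max 0 (g z) else 0))"
        by (rule nn_integral_count_space'[OF fin _ sub]) simp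
      also have "\<dots> = ennreal (\<Sum>z\<in>X. max 0 (g z))"
        by (subst sum_ennreal[symmetric]) (auto intro: sum.cong)
      finally show ?thesis .
    qed
    then show ?thesis
      unfolding X_def[symmetric] by (simp add: sum_nonneg sum_subtractf[symmetric]) (rule sum.cong, auto simp: max_def)
  qed
  show ?thesis
    unfolding meas2_def
  proof (subst measurable_cong[OF eq])
    have "(\<lambda>x :: real. max 0 x) \<in> borel_measurable borel" "(\<lambda>x :: real. max 0 (- x)) \<in> borel_measurable borel"
      by measurable
    from borel_measurable_diff[OF pos[OF this(1)] pos[OF this(2)]]
    show "(\<lambda>P. enn2real (\<integral>\<^sup>+z. ennreal (if z \<in> neighbours (fst P) (snd P ! 0) then max 0 (\<Phi> (fst P) z (snd P ! 0) (snd P ! 1)) else 0)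
        \<partial>count_space (verts (fst P))) -
      enn2real (\<integral>\<^sup>+z. ennreal (if z \<in> neighbours (fst P) (snd P ! 0) then max 0 (- \<Phi> (fst P) z (snd P ! 0) (snd P ! 1)) else 0)
        \<partial>count_space (verts (fst P)))) \<in> borel_measurable (graph_space 2)" .
  qed simp
qed

section \<open>Measurability of the kernels, the support and the blocks\<close>

lemma meas2_neighbour_sum':
  fixes \<Phi> :: "nat graph \<Rightarrow> nat \<Rightarrow> nat \<Rightarrow> real"
  assumes "meas2 borel \<Phi>"
  shows "meas2 borel (\<lambda>G x y. \<Sum>z\<in>neighbours G x. \<Phi> G z y)"
  using meas2_neighbour_sum[OF meas2_to_3(2)[OF assms]] .

lemma meas2_shift:
  assumes "meas2 borel \<Phi>"
  shows "meas2 borel (\<lambda>G x y. shift_fun G t (\<lambda>z. \<Phi> G z y) x)"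
  using meas2_neighbour_sum'[OF assms] assms unfolding shift_fun_def adj_fun_def meas2_def by measurable

lemma meas2_contract_iterate:
  "meas2 borel (\<lambda>G x y. (contract_fun G D t ^^ n) (\<lambda>z. if z = y then 1 else 0) x)"
proof (induction n)
  case 0
  have "Measurable.pred (graph_space 2) (\<lambda>P. snd P ! 0 = snd P ! 1)" using meas2_eq unfolding meas2_def .
  then show ?case unfolding meas2_def by simp
next
  case (Suc n)
  then show ?case
    using meas2_shift[OF meas2_shift[OF Suc, of t], of t]
    unfolding funpow.simps o_apply contract_fun_def[of _ _ _ "_ _"] meas2_def by measurable
qed

lemma meas2_proj_kernel: "meas2 borel (\<lambda>G. proj_kernel G D t)"
  using meas2_contract_iterate[where D = D and t = t] unfolding meas2_def proj_kernel_def by (intro borel_measurable_lim_metric)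

lemma meas2_green_kernel: "meas2 borel (\<lambda>G. green_kernel G D t)"
proof -
  have "meas2 borel (\<lambda>G x y. shift_fun G t ((contract_fun G D t ^^ k) (\<lambda>z. if z = y then 1 else 0)) x)" for k
    using meas2_shift[OF meas2_contract_iterate[where D = D and t = t and n = k], of t] by simp
  then show ?thesis
    unfolding meas2_def green_kernel_def by (intro borel_measurable_lim_metric borel_measurable_sum borel_measurable_divide) simp_all
qed

lemma meas1_proj_kernel: "meas1 borel (\<lambda>G x. proj_kernel G D t x x)"
  by (rule meas2_diag[OF meas2_proj_kernel])

lemma meas1_eigen_support: "meas1 (count_space UNIV) (\<lambda>G x. x \<in> eigen_support G D t)"
proof -
  have [measurable]: "(\<lambda>P. proj_kernel (fst P) D t (snd P ! 0) (snd P ! 0)) \<in> borel_measurable (graph_space 1)"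
    using meas1_proj_kernel unfolding meas1_def .
  have "Measurable.pred (graph_space 1) (\<lambda>P. 0 < proj_kernel (fst P) D t (snd P ! 0) (snd P ! 0))" by measurable
  then show ?thesis
    unfolding meas1_def by (subst measurable_cong[where g = "\<lambda>P. 0 < proj_kernel (fst P) D t (snd P ! 0) (snd P ! 0)"])
      (use roots_cases(1) in \<open>fastforce simp: eigen_support_def\<close>)+
qed

text \<open>Walks of length \<open>n\<close> inside the support, unfolded at the end
  \<open>z\<close> so that a step becomes a sum over the neighbours of the first root. Membership in
  a block is then a countable union.\<close>

fun reach :: "nat graph \<Rightarrow> nat \<Rightarrow> real \<Rightarrow> nat \<Rightarrow> nat \<Rightarrow> nat \<Rightarrow> bool" where
  "reach G D t 0 z x \<longleftrightarrow> z = x \<and> x \<in> eigen_support G D t"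
| "reach G D t (Suc n) z x \<longleftrightarrow> z \<in> eigen_support G D t \<and> (\<exists>w\<in>neighbours G z. reach G D t n w x)"

lemma reach_iff:
  "reach G D t n z x \<longleftrightarrow> x \<in> eigen_support G D t \<and>
    (x, z) \<in> {(a, b). a \<in> eigen_support G D t \<and> b \<in> eigen_support G D t \<and> b \<in> neighbours G a} ^^ n"
proof (induction n arbitrary: z)
  case (Suc n)
  have supp: "w \<in> eigen_support G D t" if "reach G D t n w x" for w
    using that by (cases n) auto
  have sym: "w \<in> neighbours G z \<longleftrightarrow> z \<in> neighbours G w" for w
    by (simp add: neighbours_def insert_commute)
  have "reach G D t (Suc n) z x \<longleftrightarrow>
      (\<exists>w. reach G D t n w x \<and> w \<in> eigen_support G D t \<and> z \<in> eigen_support G D t \<and> z \<in> neighbours G w)"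
    using supp sym by (simp only: reach.simps) blast
  also have "\<dots> \<longleftrightarrow> x \<in> eigen_support G D t \<and>
    (x, z) \<in> {(a, b). a \<in> eigen_support G D t \<and> b \<in> eigen_support G D t \<and> b \<in> neighbours G a} ^^ Suc n"
    unfolding Suc.IH relpow.simps by blast
  finally show ?case .
qed auto

lemma block_iff_reach: "z \<in> block G D t x \<longleftrightarrow> (\<exists>n. reach G D t n z x)"
  unfolding block_def reach_iff rtrancl_power by blast

lemma meas2_block: "meas2 (count_space UNIV) (\<lambda>G z x. z \<in> block G D t x)"
proof -
  have supp: "Measurable.pred (graph_space 2) (\<lambda>P. snd P ! 0 \<in> eigen_support (fst P) D t)"
    "Measurable.pred (graph_space 2) (\<lambda>P. snd P ! 1 \<in> eigen_support (fst P) D t)"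
    using meas1_to_2[OF meas1_eigen_support, of D t] unfolding meas2_def by auto
  have "meas2 (count_space UNIV) (\<lambda>G z x. reach G D t n z x)" for n
  proof (induction n)
    case 0
    then show ?case using supp meas2_eq unfolding meas2_def by simp
  next
    case (Suc n)
    \<comment> \<open>Existence of a suitable neighbour is expressed as positivity of a neighbour
      sum of 0-1 values.\<close>
    then have "meas2 borel (\<lambda>G z x. if reach G D t n z x then 1 else 0 :: real)" unfolding meas2_def by measurable
    from meas2_neighbour_sum'[OF this]
    have "Measurable.pred (graph_space 2) (\<lambda>P. 0 < (\<Sum>w\<in>neighbours (fst P) (snd P ! 0). if reach (fst P) D t n w (snd P ! 1) then 1 else 0 :: real))"
      unfolding meas2_def by measurable
    then have pred: "Measurable.pred (graph_space 2) (\<lambda>P. snd P ! 0 \<in> eigen_support (fst P) D t \<and>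
       0 < (\<Sum>w\<in>neighbours (fst P) (snd P ! 0). if reach (fst P) D t n w (snd P ! 1) then 1 else 0 :: real))"
      using supp(1) by measurable
    have "(0 < (\<Sum>w\<in>neighbours (fst P) (snd P ! 0). if reach (fst P) D t n w (snd P ! 1) then 1 else 0 :: real)) \<longleftrightarrow>
        (\<exists>w\<in>neighbours (fst P) (snd P ! 0). reach (fst P) D t n w (snd P ! 1))" if P: "P \<in> rooted_graphs 2" for P
    proof -
      obtain G x y where Pxy: "P = (G, [x, y])" "x \<in> verts G" using roots_cases(2)[OF P] by blast
      have fin: "finite (neighbours (fst P) (snd P ! 0))" using P Pxy by (auto simp: rooted_graphs_def locally_finite_graph_def)
      show ?thesis
      proof
        assume "0 < (\<Sum>w\<in>neighbours (fst P) (snd P ! 0). if reach (fst P) D t n w (snd P ! 1) then 1 else 0 :: real)"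
        then show "\<exists>w\<in>neighbours (fst P) (snd P ! 0). reach (fst P) D t n w (snd P ! 1)"
          by (rule contrapos_pp) (simp cong: sum.cong)
      next
        assume "\<exists>w\<in>neighbours (fst P) (snd P ! 0). reach (fst P) D t n w (snd P ! 1)"
        then obtain w where "w \<in> neighbours (fst P) (snd P ! 0)" "reach (fst P) D t n w (snd P ! 1)" by blast
        then show "0 < (\<Sum>w\<in>neighbours (fst P) (snd P ! 0). if reach (fst P) D t n w (snd P ! 1) then 1 else 0 :: real)"
          using fin by (intro sum_pos2[of _ w]) auto
      qed
    qed
    then show ?case
      using pred unfolding meas2_def by (subst measurable_cong) auto
  qed
  then show ?thesis unfolding block_iff_reach meas2_def by measurable
qed

section \<open>Mass transport\<close>

text \<open>Unimodularity is stated for functions of classes. Measurability on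
  \<open>graph_space 2\<close> makes \<open>\<Phi>\<close> isomorphism invariant, so evaluating it
  at the representative of a class recovers its value at the given vertices.\<close>

lemma mass_transport:
  fixes \<Phi> :: "nat graph \<Rightarrow> nat \<Rightarrow> nat \<Rightarrow> ennreal"
  assumes L: "unimodular_network L" and \<Phi>: "meas2 borel \<Phi>"
  shows "(\<integral>\<^sup>+c. (\<integral>\<^sup>+z. \<Phi> (fst (representative c)) (hd (snd (representative c))) z \<partial>count_space (verts (fst (representative c)))) \<partial>L) =
    (\<integral>\<^sup>+c. (\<integral>\<^sup>+z. \<Phi> (fst (representative c)) z (hd (snd (representative c))) \<partial>count_space (verts (fst (representative c)))) \<partial>L)"
proof -
  define F where "F P = \<Phi> (fst P) (snd P ! 0) (snd P ! 1)" for P :: "nat rooted"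
  have F: "F \<in> borel_measurable (graph_space 2)" using \<Phi> unfolding meas2_def F_def .
  have f: "(\<lambda>c. F (representative c)) \<in> borel_measurable (rooted_borel 2)"
    by (rule measurable_compose[OF representative_measurable F]) simp
  have val: "F (representative (iso_class P)) = F P" if "P \<in> rooted_graphs 2" for P
    using measurable_iso_invariant[OF F that _ iso_class_props(2)[OF that]]
      representative_props(2)[OF iso_class_props(1)[OF that]] by simp
  have space: "space L = rooted_classes 1"
  proof -
    have "sets L = sets (rooted_borel 1)" using L by (simp add: unimodular_network_def)
    then have "space L = space (rooted_borel 1)" by (rule sets_eq_imp_space_eq)
    then show ?thesis by (simp add: space_rooted_borel)
  qed
  have two: "(fst P, [hd (snd P), x]) \<in> rooted_graphs 2" "(fst P, [x, hd (snd P)]) \<in> rooted_graphs 2"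
    if "P \<in> rooted_graphs 1" "x \<in> verts (fst P)" for P x
    using that roots_cases(1)[OF that(1)] by (auto simp: rooted_graphs_def)
  have rep: "representative c \<in> rooted_graphs 1" if "c \<in> space L" for c
    using that representative_props(2) by (simp add: space)
  have "(\<integral>\<^sup>+c. mass_sent (\<lambda>c. F (representative c)) (representative c) \<partial>L) =
    (\<integral>\<^sup>+c. mass_received (\<lambda>c. F (representative c)) (representative c) \<partial>L)"
    using L f unfolding unimodular_network_def by blast
  moreover have "mass_sent (\<lambda>c. F (representative c)) P = (\<integral>\<^sup>+z. \<Phi> (fst P) (hd (snd P)) z \<partial>count_space (verts (fst P)))"
    if "P \<in> rooted_graphs 1" for P
    unfolding mass_sent_def by (rule nn_integral_cong) (simp add: val two[OF that], simp add: F_def)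
  moreover have "mass_received (\<lambda>c. F (representative c)) P = (\<integral>\<^sup>+z. \<Phi> (fst P) z (hd (snd P)) \<partial>count_space (verts (fst P)))"
    if "P \<in> rooted_graphs 1" for P
    unfolding mass_received_def by (rule nn_integral_cong) (simp add: val two[OF that], simp add: F_def)
  ultimately show ?thesis using rep by (simp cong: nn_integral_cong)
qed

section \<open>The transports and their balance on a fixed tree\<close>

definition proj_mass :: "nat graph \<Rightarrow> nat \<Rightarrow> real \<Rightarrow> nat \<Rightarrow> ennreal" where
  "proj_mass G D t x = ennreal (proj_kernel G D t x x)"

definition block_mass :: "nat graph \<Rightarrow> nat \<Rightarrow> real \<Rightarrow> nat \<Rightarrow> ennreal" where
  "block_mass G D t x =
     (\<integral>\<^sup>+z. (if z \<in> block G D t x then proj_mass G D t z else 0) \<partial>count_space (verts G))"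

text \<open>A probability distribution on each block, by which the block acts through its vertices;
  it needs no choice of a vertex and makes sense on infinite blocks, where \<open>block_mass\<close>
  is still at most 1.\<close>

definition weight :: "nat graph \<Rightarrow> nat \<Rightarrow> real \<Rightarrow> nat \<Rightarrow> ennreal" where
  "weight G D t x = proj_mass G D t x / block_mass G D t x"

definition boundary_sum :: "(nat graph \<Rightarrow> nat \<Rightarrow> nat \<Rightarrow> real) \<Rightarrow> nat graph \<Rightarrow> nat \<Rightarrow> real \<Rightarrow> nat \<Rightarrow> nat \<Rightarrow> ennreal" where
  "boundary_sum g G D t x y = (if y \<in> eigen_support G D t then 0
     else ennreal (\<Sum>z\<in>neighbours G y. if z \<in> block G D t x then g G z y else 0))"

definition count_transport :: "nat graph \<Rightarrow> nat \<Rightarrow> real \<Rightarrow> nat \<Rightarrow> nat \<Rightarrow> ennreal" where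
  "count_transport G D t x y = weight G D t x * boundary_sum (\<lambda>G z y. 1) G D t x y"

text \<open>The mass kept at \<open>x\<close> and the mass sent out correspond to the two sums in
  \<open>block_identity\<close>; in a finite block, \<open>x\<close> thus gives away exactly its
  weight.\<close>

definition green_transport :: "nat graph \<Rightarrow> nat \<Rightarrow> real \<Rightarrow> nat \<Rightarrow> nat \<Rightarrow> ennreal" where
  "green_transport G D t x y = (if y = x then proj_mass G D t x else 0) +
     weight G D t x * boundary_sum (\<lambda>G. green_kernel G D t) G D t x y"

definition boundary_vertex :: "nat graph \<Rightarrow> nat \<Rightarrow> real \<Rightarrow> nat \<Rightarrow> bool" where
  "boundary_vertex G D t y \<longleftrightarrow> y \<notin> eigen_support G D t \<and> neighbours G y \<inter> eigen_support G D t \<noteq> {}"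

context bounded_tree
begin

abbreviation "pm \<equiv> proj_mass G D t"
abbreviation "T \<equiv> block_mass G D t"
abbreviation "w \<equiv> weight G D t"

lemma pm_outside: "x \<in> verts G \<Longrightarrow> x \<notin> supp \<Longrightarrow> pm x = 0"
  using pk_nonneg[of x] by (simp add: proj_mass_def eigen_support_def ennreal_eq_0_iff)

text \<open>The limit of \<open>sum_pk_block_le\<close> over finite parts, hence valid for infinite
  blocks too.\<close>

lemma block_mass_le: "T x \<le> 1"
proof (cases "x \<in> supp")
  case True
  define f where "f z = (if z \<in> K x then pm z else 0)" for z
  have "T x = (\<integral>\<^sup>+z. f z * indicator (verts G) z \<partial>count_space UNIV)"
    unfolding block_mass_def f_def by (rule nn_integral_count_space_indicator) simp
  also have "\<dots> = (\<Sum>z. f z * indicator (verts G) z)" by (rule nn_integral_count_space_nat)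
  also have "\<dots> \<le> 1"
  proof (rule suminf_le_const)
    fix n
    have "(\<Sum>z<n. f z * indicator (verts G) z) \<le> (\<Sum>z<n. f z)"
      by (rule sum_mono) (simp add: indicator_def)
    also have "\<dots> = (\<Sum>z\<in>{..<n} \<inter> K x. pm z)"
      by (simp add: f_def sum.inter_restrict)
    also have "\<dots> = ennreal (\<Sum>z\<in>{..<n} \<inter> K x. pk z z)"
      unfolding proj_mass_def by (rule sum_ennreal) (rule pk_nonneg)
    also have "\<dots> \<le> 1" using sum_pk_block_le[OF True, of "{..<n} \<inter> K x"] by simp
    finally show "(\<Sum>z<n. f z * indicator (verts G) z) \<le> 1" .
  qed simp
  finally show ?thesis .
next
  case False
  then show ?thesis by (simp add: block_mass_def block_def)
qed

lemma block_mass_nz: "x \<in> supp \<Longrightarrow> T x \<noteq> 0"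
proof -
  assume x: "x \<in> supp"
  have "(if x \<in> K x then pm x else 0) \<le> T x"
    unfolding block_mass_def by (rule nn_integral_ge_point) (use x supp_verts in blast)
  moreover have "0 < pm x" using x by (simp add: proj_mass_def eigen_support_def)
  ultimately show ?thesis using block_root[OF x] by auto
qed

lemma block_mass_finite: "T x < top_class.top"
  using block_mass_le[of x] ennreal_one_less_top by (rule le_less_trans)

lemma weight_outside: "x \<in> verts G \<Longrightarrow> x \<notin> supp \<Longrightarrow> w x = 0"
  by (simp add: weight_def pm_outside)

lemma weight_block_mass: "x \<in> supp \<Longrightarrow> w x * T x = pm x"
  unfolding weight_def ennreal_divide_times using block_mass_nz block_mass_finite
  by (simp add: ennreal_divide_self)

lemma sum_weight:
  "(\<integral>\<^sup>+x. w x * (if z \<in> K x then 1 else 0) \<partial>count_space (verts G)) = (if z \<in> supp then 1 else 0)"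
proof (cases "z \<in> supp")
  case True
  have "(\<integral>\<^sup>+x. w x * (if z \<in> K x then 1 else 0) \<partial>count_space (verts G)) =
      (\<integral>\<^sup>+x. (if x \<in> K z then pm x else 0) / T z \<partial>count_space (verts G))"
  proof (rule nn_integral_cong)
    fix x
    have "T x = T z" if "x \<in> K z" unfolding block_mass_def block_eq[OF that] ..
    then show "w x * (if z \<in> K x then 1 else 0) = (if x \<in> K z then pm x else 0) / T z"
      using block_sym by (simp add: weight_def)
  qed
  also have "\<dots> = T z / T z" unfolding block_mass_def by (rule nn_integral_divide) simp
  also have "\<dots> = 1" using block_mass_nz[OF True] block_mass_finite[of z]
    by (simp add: ennreal_divide_self)
  finally show ?thesis using True by simp
next
  case False
  then have "z \<notin> K x" for x using block_subset by blast
  then show ?thesis using False by simp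
qed

text \<open>After exchanging the sums, each neighbour \<open>z\<close> of \<open>y\<close> in the
  support collects the weights of its own block, which add up to 1.\<close>

lemma received_boundary:
  assumes y: "y \<in> verts G" "y \<notin> supp" and g: "\<And>z. z \<in> N y \<Longrightarrow> z \<in> supp \<Longrightarrow> 0 \<le> g G z y"
  shows "(\<integral>\<^sup>+x. w x * boundary_sum g G D t x y \<partial>count_space (verts G)) = ennreal (\<Sum>z\<in>N y \<inter> supp. g G z y)"
proof -
  have "w x * boundary_sum g G D t x y = (\<Sum>z\<in>N y \<inter> supp. ennreal (g G z y) * (w x * (if z \<in> K x then 1 else 0)))" for x
  proof -
    have "(\<Sum>z\<in>N y. if z \<in> K x then g G z y else 0) = (\<Sum>z\<in>N y \<inter> supp. if z \<in> K x then g G z y else 0)"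
      by (rule sum.mono_neutral_right) (use block_subset[of x] in auto)
    then have "boundary_sum g G D t x y = ennreal (\<Sum>z\<in>N y \<inter> supp. if z \<in> K x then g G z y else 0)"
      using y by (simp add: boundary_sum_def)
    also have "\<dots> = (\<Sum>z\<in>N y \<inter> supp. ennreal (if z \<in> K x then g G z y else 0))"
      by (rule sum_ennreal[symmetric]) (use g in auto)
    finally show ?thesis by (simp only: sum_distrib_left) (rule sum.cong, auto simp: mult.commute)
  qed
  then have "(\<integral>\<^sup>+x. w x * boundary_sum g G D t x y \<partial>count_space (verts G)) =
      (\<integral>\<^sup>+x. (\<Sum>z\<in>N y \<inter> supp. ennreal (g G z y) * (w x * (if z \<in> K x then 1 else 0))) \<partial>count_space (verts G))"
    by simp
  also have "\<dots> = (\<Sum>z\<in>N y \<inter> supp. \<integral>\<^sup>+x. ennreal (g G z y) * (w x * (if z \<in> K x then 1 else 0)) \<partial>count_space (verts G))"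
    by (rule nn_integral_sum) simp
  also have "\<dots> = (\<Sum>z\<in>N y \<inter> supp. ennreal (g G z y))"
    by (rule sum.cong) (simp_all add: nn_integral_cmult sum_weight)
  also have "\<dots> = ennreal (\<Sum>z\<in>N y \<inter> supp. g G z y)" by (rule sum_ennreal) (use g in auto)
  finally show ?thesis .
qed

lemma sent_boundary:
  assumes x: "x \<in> supp" and fin: "finite (K x)"
    and g: "\<And>z y. z \<in> K x \<Longrightarrow> y \<in> N z \<Longrightarrow> y \<notin> supp \<Longrightarrow> 0 \<le> g G z y"
  shows "(\<integral>\<^sup>+y. boundary_sum g G D t x y \<partial>count_space (verts G)) = ennreal (\<Sum>z\<in>K x. \<Sum>y\<in>N z - supp. g G z y)"
proof -
  define Y where "Y = (\<Union>z\<in>K x. N z) - supp"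
  have finY: "finite Y" using fin by (simp add: Y_def)
  have eq: "boundary_sum g G D t x y = ennreal (\<Sum>z\<in>{z\<in>K x. y \<in> N z}. g G z y)" if "y \<notin> supp" for y
  proof -
    have "(\<Sum>z\<in>N y. if z \<in> K x then g G z y else 0) = (\<Sum>z\<in>N y \<inter> K x. g G z y)" by (simp add: sum.inter_restrict)
    also have "N y \<inter> K x = {z\<in>K x. y \<in> N z}" using nbr_sym by auto
    finally show ?thesis using that by (simp add: boundary_sum_def)
  qed
  have "(\<integral>\<^sup>+y. boundary_sum g G D t x y \<partial>count_space (verts G)) = (\<Sum>y\<in>Y. boundary_sum g G D t x y)"
  proof (rule nn_integral_count_space'[OF finY])
    show "Y \<subseteq> verts G" using nbr_verts by (auto simp: Y_def)
    fix y assume y: "y \<notin> Y"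
    show "boundary_sum g G D t x y = 0"
    proof (cases "y \<in> supp")
      case False
      then have "{z\<in>K x. y \<in> N z} = {}" using y by (auto simp: Y_def)
      then show ?thesis unfolding eq[OF False] by (simp only: sum.empty ennreal_0)
    qed (simp add: boundary_sum_def)
  qed
  also have "\<dots> = (\<Sum>y\<in>Y. ennreal (\<Sum>z\<in>{z\<in>K x. y \<in> N z}. g G z y))"
    by (rule sum.cong) (auto simp: eq Y_def)
  also have "\<dots> = ennreal (\<Sum>y\<in>Y. \<Sum>z\<in>{z\<in>K x. y \<in> N z}. g G z y)"
    by (rule sum_ennreal) (auto intro!: sum_nonneg g simp: Y_def)
  also have "(\<Sum>y\<in>Y. \<Sum>z\<in>{z\<in>K x. y \<in> N z}. g G z y) = (\<Sum>z\<in>K x. \<Sum>y\<in>{y\<in>Y. y \<in> N z}. g G z y)"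
    by (rule sum.swap_restrict[OF finY fin])
  also have "\<dots> = (\<Sum>z\<in>K x. \<Sum>y\<in>N z - supp. g G z y)"
    by (intro sum.cong) (auto simp: Y_def)
  finally show ?thesis .
qed

lemma count_received:
  assumes y: "y \<in> verts G"
  shows "(\<integral>\<^sup>+x. count_transport G D t x y \<partial>count_space (verts G)) \<le> of_nat D * (if boundary_vertex G D t y then 1 else 0)"
proof (cases "y \<in> supp")
  case True
  then show ?thesis by (simp add: count_transport_def boundary_sum_def)
next
  case False
  have "(\<integral>\<^sup>+x. count_transport G D t x y \<partial>count_space (verts G)) = ennreal (real (card (N y \<inter> supp)))"
    unfolding count_transport_def using received_boundary[OF y False, of "\<lambda>G z y. 1"] by simp
  moreover have "card (N y \<inter> supp) \<le> D"
    using card_mono[of "N y" "N y \<inter> supp"] card_N[of y] by simp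
  ultimately show ?thesis
    using False by (auto simp: boundary_vertex_def ennreal_of_nat_eq_real_of_nat)
qed

lemma green_received:
  assumes y: "y \<in> verts G"
  shows "(\<integral>\<^sup>+x. green_transport G D t x y \<partial>count_space (verts G)) = pm y + (if boundary_vertex G D t y then 1 else 0)"
proof -
  have "(\<integral>\<^sup>+x. (if y = x then pm x else 0) \<partial>count_space (verts G)) = pm y"
    using nn_integral_count_space'[of "{y}" "verts G" "\<lambda>x. if y = x then pm x else 0"] y by simp
  moreover have "(\<integral>\<^sup>+x. w x * boundary_sum (\<lambda>G. green_kernel G D t) G D t x y \<partial>count_space (verts G)) =
      (if boundary_vertex G D t y then 1 else 0)"
  proof (cases "y \<in> supp")
    case True
    then show ?thesis by (simp add: boundary_sum_def boundary_vertex_def)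
  next
    case False
    have "(\<integral>\<^sup>+x. w x * boundary_sum (\<lambda>G. green_kernel G D t) G D t x y \<partial>count_space (verts G)) =
        ennreal (\<Sum>z\<in>N y \<inter> supp. sk z y)"
      by (rule received_boundary[OF y False]) (rule green_nonneg[OF y False])
    then show ?thesis
      using sum_green_boundary[OF y False] False by (cases "N y \<inter> supp = {}") (simp_all add: boundary_vertex_def)
  qed
  ultimately show ?thesis unfolding green_transport_def by (subst nn_integral_add) simp_all
qed

text \<open>By \<open>block_identity\<close> the Green transport sends exactly the weight of
  \<open>x\<close>, while the counting transport sends this weight times the number of boundary
  edges of the block.\<close>

lemma green_sent_le_count_sent:
  assumes x: "x \<in> verts G" and fin: "x \<in> supp \<Longrightarrow> finite (K x)"
    and many: "x \<in> supp \<Longrightarrow> D \<le> (\<Sum>z\<in>K x. card (N z - supp))"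
  shows "of_nat D * (\<integral>\<^sup>+y. green_transport G D t x y \<partial>count_space (verts G)) \<le>
    (\<integral>\<^sup>+y. count_transport G D t x y \<partial>count_space (verts G))"
proof (cases "x \<in> supp")
  case False
  then have "green_transport G D t x y = 0" for y
    using x by (simp add: green_transport_def weight_outside pm_outside)
  then show ?thesis by simp
next
  case True
  have T: "T x = ennreal (\<Sum>z\<in>K x. pk z z)"
  proof -
    have "T x = (\<Sum>z\<in>K x. if z \<in> K x then pm z else 0)"
      unfolding block_mass_def
      by (rule nn_integral_count_space'[OF fin[OF True]]) (use block_subset[of x] supp_verts in auto)
    then show ?thesis by (simp add: proj_mass_def sum_ennreal pk_nonneg)
  qed
  have nonneg: "0 \<le> sk z y" if "z \<in> K x" "y \<in> N z" "y \<notin> supp" for z y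
    using that block_subset[of x] nbr_verts nbr_sym by (intro green_nonneg) blast+
  define s where "s = (\<Sum>z\<in>K x. \<Sum>y\<in>N z - supp. sk z y)"
  have s0: "0 \<le> s" unfolding s_def by (intro sum_nonneg nonneg) auto
  have "(\<integral>\<^sup>+y. (if y = x then pm x else 0) \<partial>count_space (verts G)) = pm x"
    using nn_integral_count_space'[of "{x}" "verts G" "\<lambda>y. if y = x then pm x else 0"] x by simp
  then have "(\<integral>\<^sup>+y. green_transport G D t x y \<partial>count_space (verts G)) = pm x + w x * ennreal s"
    unfolding green_transport_def s_def
    using sent_boundary[OF True fin[OF True], of "\<lambda>G. green_kernel G D t"] nonneg
    by (subst nn_integral_add) (simp_all add: nn_integral_cmult)
  also have "\<dots> = w x * (T x + ennreal s)"
    unfolding weight_block_mass[OF True, symmetric] by (simp add: distrib_left)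
  also have "T x + ennreal s = ennreal ((\<Sum>z\<in>K x. pk z z) + s)"
    unfolding T by (rule ennreal_plus[symmetric]) (auto intro!: sum_nonneg pk_nonneg s0)
  also have "(\<Sum>z\<in>K x. pk z z) + s = 1" unfolding s_def by (rule block_identity[OF True fin[OF True]])
  finally have green: "(\<integral>\<^sup>+y. green_transport G D t x y \<partial>count_space (verts G)) = w x" by simp
  have "(\<integral>\<^sup>+y. count_transport G D t x y \<partial>count_space (verts G)) =
      w x * ennreal (\<Sum>z\<in>K x. \<Sum>y\<in>N z - supp. 1)"
    unfolding count_transport_def
    using sent_boundary[OF True fin[OF True], of "\<lambda>G z y. 1"] by (simp add: nn_integral_cmult)
  also have "ennreal (\<Sum>z\<in>K x. \<Sum>y\<in>N z - supp. 1) = of_nat (\<Sum>z\<in>K x. card (N z - supp))"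
    by (simp add: ennreal_of_nat_eq_real_of_nat)
  finally have count: "(\<integral>\<^sup>+y. count_transport G D t x y \<partial>count_space (verts G)) =
      w x * of_nat (\<Sum>z\<in>K x. card (N z - supp))" .
  show ?thesis
    unfolding green count by (subst mult.commute, rule mult_left_mono[OF of_nat_mono[OF many[OF True]]]) simp
qed

text \<open>All vertices of the block of \<open>y\<close> send the same positive amount, which is
  incompatible with a finite expected mass.\<close>

lemma received_infinite:
  assumes "y \<in> supp" "infinite (K y)"
  shows "(\<integral>\<^sup>+x. (if y \<in> K x then pm y else 0) \<partial>count_space (verts G)) = top_class.top"
proof -
  have "(\<integral>\<^sup>+x. (if y \<in> K x then pm y else 0) \<partial>count_space (verts G)) =
      (\<integral>\<^sup>+x. pm y * indicator (K y) x \<partial>count_space (verts G))"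
    by (rule nn_integral_cong) (simp add: indicator_def block_sym[of y])
  also have "\<dots> = pm y * emeasure (count_space (verts G)) (K y)"
    by (rule nn_integral_cmult_indicator) (use block_subset[of y] supp_verts in auto)
  also have "emeasure (count_space (verts G)) (K y) = top_class.top"
    using assms(2) block_subset[of y] supp_verts by (subst emeasure_count_space_infinite) auto
  finally show ?thesis using assms(1) by (simp add: proj_mass_def eigen_support_def ennreal_mult_top)
qed

end

lemma meas1_proj_mass: "meas1 borel (\<lambda>G. proj_mass G D t)"
  using meas1_proj_kernel[of D t] unfolding meas1_def proj_mass_def by measurable

lemma meas2_block_part:
  fixes \<Phi> :: "nat graph \<Rightarrow> nat \<Rightarrow> nat \<Rightarrow> ennreal"
  assumes "meas2 borel \<Phi>"
  shows "meas2 borel (\<lambda>G z x. if z \<in> block G D t x then \<Phi> G z x else 0)"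
  using assms meas2_block[of D t] unfolding meas2_def by measurable

lemma meas1_weight: "meas1 borel (\<lambda>G. weight G D t)"
proof -
  have "meas1 borel (\<lambda>G. block_mass G D t)"
    unfolding block_mass_def
    by (intro meas1_root_sum meas2_block_part meas1_to_2 meas1_proj_mass)
  then show ?thesis using meas1_proj_mass[of D t] unfolding meas1_def weight_def by measurable
qed

lemma meas2_boundary_sum:
  assumes "meas2 borel g"
  shows "meas2 borel (\<lambda>G x y. boundary_sum g G D t x y)"
proof -
  have "meas3 borel (\<lambda>G z y x. if z \<in> block G D t x then g G z y else 0)"
    using meas2_to_3(1)[OF assms] meas2_to_3(2)[OF meas2_block[of D t]] unfolding meas3_def by measurable
  from meas2_neighbour_sum[OF this]
  have "meas2 borel (\<lambda>G y x. if y \<in> eigen_support G D t then 0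
     else ennreal (\<Sum>z\<in>neighbours G y. if z \<in> block G D t x then g G z y else 0))"
    using meas1_to_2(1)[OF meas1_eigen_support[of D t]] unfolding meas2_def by measurable
  from meas2_swap[OF this] show ?thesis unfolding boundary_sum_def .
qed

lemma meas2_count_transport: "meas2 borel (\<lambda>G. count_transport G D t)"
proof -
  have "meas2 borel (\<lambda>G x y. 1 :: real)" unfolding meas2_def by simp
  from meas2_boundary_sum[OF this, of D t] meas1_to_2(1)[OF meas1_weight[of D t]] show ?thesis
    unfolding count_transport_def meas2_def by measurable
qed

lemma meas2_green_transport: "meas2 borel (\<lambda>G. green_transport G D t)"
  using meas2_boundary_sum[OF meas2_green_kernel[of D t], of D t] meas1_to_2(1)[OF meas1_weight[of D t]]
    meas1_to_2(1)[OF meas1_proj_mass[of D t]] meas2_swap[OF meas2_eq]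
  unfolding green_transport_def meas2_def by measurable

lemma meas1_boundary_vertex: "meas1 (count_space UNIV) (\<lambda>G. boundary_vertex G D t)"
proof -
  have "meas2 borel (\<lambda>G x y. if x \<in> eigen_support G D t then 1 else 0 :: real)"
    using meas1_to_2(1)[OF meas1_eigen_support[of D t]] unfolding meas2_def by measurable
  from meas2_diag[OF meas2_neighbour_sum'[OF this]]
  have "Measurable.pred (graph_space 1) (\<lambda>P. snd P ! 0 \<notin> eigen_support (fst P) D t \<and>
      (\<Sum>z\<in>neighbours (fst P) (snd P ! 0). if z \<in> eigen_support (fst P) D t then 1 else 0 :: real) \<noteq> 0)"
    using meas1_eigen_support[of D t] unfolding meas1_def by measurable
  moreover have "((\<Sum>z\<in>neighbours (fst P) (snd P ! 0). if z \<in> eigen_support (fst P) D t then 1 else 0 :: real) \<noteq> 0) \<longleftrightarrow>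
      neighbours (fst P) (snd P ! 0) \<inter> eigen_support (fst P) D t \<noteq> {}" if P: "P \<in> rooted_graphs 1" for P
  proof -
    obtain G x where Pxy: "P = (G, [x])" "x \<in> verts G" using roots_cases(1)[OF P] by blast
    have "finite (neighbours (fst P) (snd P ! 0))" using P Pxy by (auto simp: rooted_graphs_def locally_finite_graph_def)
    then show ?thesis by (subst sum_nonneg_eq_0_iff) auto
  qed
  ultimately show ?thesis
    unfolding meas1_def boundary_vertex_def by (subst measurable_cong) auto
qed

text \<open>
  The mass transport principle for the two transports gives \<open>D \<E>[P\<^sub>o\<^sub>o + 1\<^sub>\<partial>] \<le> D \<E>[1\<^sub>\<partial>]\<close>
  when every finite block has at least \<open>D\<close> boundary edges.
\<close>

lemma eigenspace_trivial:
  assumes L: "unimodular_network L"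
    and good: "AE c in L. bounded_tree (fst (representative c)) D"
    and many: "AE c in L. \<forall>x\<in>eigen_support (fst (representative c)) D t. finite (block (fst (representative c)) D t x) \<longrightarrow>
      D \<le> (\<Sum>z\<in>block (fst (representative c)) D t x. card (neighbours (fst (representative c)) z - eigen_support (fst (representative c)) D t))"
    and D: "0 < D"
  shows "AE c in L. proj_kernel (fst (representative c)) D t (hd (snd (representative c))) (hd (snd (representative c))) = 0"
proof -
  interpret L: prob_space L using L by (simp add: unimodular_network_def)
  define R where "R c = fst (representative c)" for c
  define r where "r c = hd (snd (representative c))" for c
  have sets: "sets L = sets (rooted_borel 1)" using L by (simp add: unimodular_network_def)
  then have space: "space L = rooted_classes 1"
    using sets_eq_imp_space_eq[OF sets] by (simp add: space_rooted_borel)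
  have rep: "representative c \<in> rooted_graphs 1" if "c \<in> space L" for c
    using that representative_props(2) by (simp add: space)
  have root: "r c \<in> verts (R c)" "snd (representative c) ! 0 = r c" if "c \<in> space L" for c
    using roots_cases(1)[OF rep[OF that]] by (auto simp: R_def r_def)
  have meas: "(\<lambda>c. \<Phi> (R c) (r c)) \<in> measurable L M" if "meas1 M \<Phi>" for \<Phi> and M :: "'z measure"
  proof -
    have "representative \<in> measurable L (graph_space 1)"
      using representative_measurable[of 1] measurable_cong_sets[OF sets refl] by auto
    from measurable_compose[OF this that[unfolded meas1_def]]
    have "(\<lambda>c. \<Phi> (R c) (snd (representative c) ! 0)) \<in> measurable L M" by (simp add: R_def)
    then show ?thesis by (subst measurable_cong[where g = "\<lambda>c. \<Phi> (R c) (snd (representative c) ! 0)"]) (simp_all add: root)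
  qed
  define sent where "sent \<Phi> c = (\<integral>\<^sup>+z. \<Phi> (R c) (r c) z \<partial>count_space (verts (R c)))" for \<Phi> :: "nat graph \<Rightarrow> nat \<Rightarrow> nat \<Rightarrow> ennreal" and c
  define recv where "recv \<Phi> c = (\<integral>\<^sup>+z. \<Phi> (R c) z (r c) \<partial>count_space (verts (R c)))" for \<Phi> :: "nat graph \<Rightarrow> nat \<Rightarrow> nat \<Rightarrow> ennreal" and c
  have mtp: "(\<integral>\<^sup>+c. sent \<Phi> c \<partial>L) = (\<integral>\<^sup>+c. recv \<Phi> c \<partial>L)" if "meas2 borel \<Phi>" for \<Phi>
    using mass_transport[OF L that] unfolding sent_def recv_def R_def r_def .
  have good': "AE c in L. c \<in> space L \<and> bounded_tree (R c) D"
    using good AE_space[of L] unfolding R_def by eventually_elim simp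
  \<comment> \<open>Each vertex sends to every \<open>z\<close> of its block the mass of
    \<open>z\<close>. At most 1 is sent, so almost surely a finite mass is received, and the block
    of the root is finite.\<close>
  define f0 where "f0 G x z = (if z \<in> block G D t x then proj_mass G D t z else 0)" for G x z
  have f0: "meas2 borel f0"
    using meas2_swap[OF meas2_block_part[OF meas1_to_2(1)[OF meas1_proj_mass[of D t]], of D t]] unfolding f0_def .
  have "(\<integral>\<^sup>+c. recv f0 c \<partial>L) = (\<integral>\<^sup>+c. sent f0 c \<partial>L)" by (rule mtp[OF f0, symmetric])
  also have "\<dots> \<le> (\<integral>\<^sup>+c. 1 \<partial>L)"
  proof (rule nn_integral_mono_AE)
    show "AE c in L. sent f0 c \<le> 1"
      using good'
    proof eventually_elim
      case (elim c)
      then interpret bounded_tree "R c" D t by simp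
      show ?case using block_mass_le[of "r c"] unfolding sent_def f0_def block_mass_def .
    qed
  qed
  finally have "(\<integral>\<^sup>+c. recv f0 c \<partial>L) \<noteq> \<infinity>" by (auto simp: L.emeasure_space_1 top_unique)
  moreover have "recv f0 \<in> borel_measurable L"
    unfolding recv_def[abs_def] by (rule meas[OF meas1_root_sum[OF f0]])
  ultimately have "AE c in L. recv f0 c \<noteq> \<infinity>" by (intro nn_integral_PInf_AE)
  then have fin: "AE c in L. r c \<in> eigen_support (R c) D t \<longrightarrow> finite (block (R c) D t (r c))"
    using good'
  proof eventually_elim
    case (elim c)
    then interpret bounded_tree "R c" D t by simp
    show ?case using elim(1) received_infinite[of "r c"] unfolding recv_def f0_def by auto
  qed
  define b where "b c = (if boundary_vertex (R c) D t (r c) then 1 else 0 :: ennreal)" for c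
  define p where "p c = proj_mass (R c) D t (r c)" for c
  have b: "b \<in> borel_measurable L"
    using meas[OF meas1_boundary_vertex[of D t]] unfolding b_def[abs_def] by measurable
  have p: "p \<in> borel_measurable L" unfolding p_def[abs_def] by (rule meas[OF meas1_proj_mass])
  let ?f = "\<lambda>G. green_transport G D t" and ?h = "\<lambda>G. count_transport G D t"
  have "of_nat D * (\<integral>\<^sup>+c. p c + b c \<partial>L) = of_nat D * (\<integral>\<^sup>+c. recv ?f c \<partial>L)"
  proof (rule arg_cong[where f = "\<lambda>x. of_nat D * x"], rule nn_integral_cong_AE)
    show "AE c in L. p c + b c = recv ?f c"
      using good'
    proof eventually_elim
      case (elim c)
      then interpret bounded_tree "R c" D t by simp
      show ?case using green_received[OF root(1)] elim unfolding recv_def p_def b_def by simp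
    qed
  qed
  also have "\<dots> = of_nat D * (\<integral>\<^sup>+c. sent ?f c \<partial>L)" by (simp only: mtp[OF meas2_green_transport])
  also have "\<dots> \<le> (\<integral>\<^sup>+c. of_nat D * sent ?f c \<partial>L)"
  proof -
    have "sent ?f \<in> borel_measurable L"
      unfolding sent_def[abs_def] by (rule meas[OF meas1_root_sum[OF meas2_swap[OF meas2_green_transport]]])
    then show ?thesis by (simp add: nn_integral_cmult)
  qed
  also have "\<dots> \<le> (\<integral>\<^sup>+c. sent ?h c \<partial>L)"
  proof (rule nn_integral_mono_AE)
    show "AE c in L. of_nat D * sent ?f c \<le> sent ?h c"
      using good' fin many
    proof eventually_elim
      case (elim c)
      then interpret bounded_tree "R c" D t by simp
      show ?case
        unfolding sent_def
        by (rule green_sent_le_count_sent) (use elim root(1) in \<open>auto simp: R_def\<close>)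
    qed
  qed
  also have "\<dots> = (\<integral>\<^sup>+c. recv ?h c \<partial>L)" by (rule mtp[OF meas2_count_transport])
  also have "\<dots> \<le> (\<integral>\<^sup>+c. of_nat D * b c \<partial>L)"
  proof (rule nn_integral_mono_AE)
    show "AE c in L. recv ?h c \<le> of_nat D * b c"
      using good'
    proof eventually_elim
      case (elim c)
      then interpret bounded_tree "R c" D t by simp
      show ?case using count_received[OF root(1)] elim unfolding recv_def b_def by simp
    qed
  qed
  also have "\<dots> = of_nat D * (\<integral>\<^sup>+c. b c \<partial>L)" using b by (rule nn_integral_cmult)
  finally have le: "of_nat D * (\<integral>\<^sup>+c. p c + b c \<partial>L) \<le> of_nat D * (\<integral>\<^sup>+c. b c \<partial>L)" .
  have "(\<integral>\<^sup>+c. b c \<partial>L) \<le> (\<integral>\<^sup>+c. 1 \<partial>L)" by (rule nn_integral_mono) (simp add: b_def)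
  then have bfin: "(\<integral>\<^sup>+c. b c \<partial>L) < top_class.top" by (simp add: L.emeasure_space_1 order_le_less_trans[OF _ ennreal_one_less_top])
  \<comment> \<open>Cancelling the positive factor \<open>D\<close>, and then the finite integral of
    \<open>b\<close>, leaves no room for \<open>p\<close>.\<close>
  have "(\<integral>\<^sup>+c. p c \<partial>L) + (\<integral>\<^sup>+c. b c \<partial>L) \<le> (\<integral>\<^sup>+c. b c \<partial>L)"
    using le D unfolding nn_integral_add[OF p b]
    by (subst (asm) ennreal_mult_le_mult_iff) (simp_all add: ennreal_of_nat_eq_real_of_nat)
  then have "(\<integral>\<^sup>+c. p c \<partial>L) = 0"
    using bfin by (cases "\<integral>\<^sup>+c. p c \<partial>L"; cases "\<integral>\<^sup>+c. b c \<partial>L") (auto simp: ennreal_plus[symmetric] top_unique simp del: ennreal_plus)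
  then have "AE c in L. p c = 0" using p by (simp add: nn_integral_0_iff_AE)
  then show ?thesis
    using good'
  proof eventually_elim
    case (elim c)
    then interpret bounded_tree "R c" D t by simp
    show ?case using elim(1) pk_nonneg[of "r c"] by (simp add: p_def proj_mass_def R_def r_def ennreal_eq_0_iff)
  qed
qed

text \<open>If no tree with eigenvalue \<open>t\<close> were this small, every finite block would
  have at least \<open>\<Delta>\<close> boundary edges by \<open>block_boundary\<close>; then the
  projection would vanish at the root almost surely, and \<open>t\<close> would carry no
  mass.\<close>

lemma pp_support_block:
  assumes "3 \<le> \<delta>" and L: "unimodular_network L"
    and trees: "concentrated_on_trees {\<delta>..\<Delta>} L"
    and t: "t \<in> pp_support L"
  shows "\<exists>n. tree_eigenvalue n t \<and> \<delta> * n + 2 < \<Delta> + 2 * n"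
proof (rule ccontr)
  assume none: "\<not> ?thesis"
  have space: "c \<in> space L \<Longrightarrow> representative c \<in> rooted_graphs 1" for c
  proof -
    have "sets L = sets (rooted_borel 1)" using L by (simp add: unimodular_network_def)
    from sets_eq_imp_space_eq[OF this] have "space L = rooted_classes 1" by (simp add: space_rooted_borel)
    then show "c \<in> space L \<Longrightarrow> representative c \<in> rooted_graphs 1" using representative_props(2) by simp
  qed
  have good: "AE c in L. representative c \<in> rooted_graphs 1 \<and> bounded_tree (fst (representative c)) \<Delta> \<and>
      (\<forall>x\<in>verts (fst (representative c)). \<delta> \<le> vertex_degree (fst (representative c)) x)"
    using trees[unfolded concentrated_on_trees_def] AE_space[of L]
  proof eventually_elim
    case (elim c)
    then have "representative c \<in> rooted_graphs 1" using space by blast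
    then show ?case using elim
      by (auto simp: bounded_tree_def bounded_tree_axioms_def bounded_graph_def rooted_graphs_def locally_finite_graph_def)
  qed
  \<comment> \<open>Almost surely the degree of the root lies in the range, which is therefore not
    empty.\<close>
  have "\<delta> \<le> \<Delta>"
  proof -
    interpret L: prob_space L using L by (simp add: unimodular_network_def)
    have "AE c in L. \<delta> \<le> \<Delta>"
      using trees[unfolded concentrated_on_trees_def] AE_space[of L]
    proof eventually_elim
      case (elim c)
      obtain G x where "representative c = (G, [x])" "x \<in> verts G" using roots_cases(1)[OF space[OF elim(2)]] by blast
      then show ?case using elim(1) by force
    qed
    then show ?thesis by simp
  qed
  have "AE c in L. proj_kernel (fst (representative c)) \<Delta> t (hd (snd (representative c))) (hd (snd (representative c))) = 0"
  proof (rule eigenspace_trivial[OF L])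
    show "AE c in L. bounded_tree (fst (representative c)) \<Delta>" using good by eventually_elim simp
    show "0 < \<Delta>" using assms(1) \<open>\<delta> \<le> \<Delta>\<close> by simp
    show "AE c in L. \<forall>x\<in>eigen_support (fst (representative c)) \<Delta> t. finite (block (fst (representative c)) \<Delta> t x) \<longrightarrow>
      \<Delta> \<le> (\<Sum>z\<in>block (fst (representative c)) \<Delta> t x. card (neighbours (fst (representative c)) z - eigen_support (fst (representative c)) \<Delta> t))"
      using good
    proof eventually_elim
      case (elim c)
      then interpret bounded_tree "fst (representative c)" \<Delta> t by simp
      show ?case
      proof (intro ballI impI)
        fix x assume x: "x \<in> supp" "finite (K x)"
        have "\<not> \<delta> * card (K x) + 2 < \<Delta> + 2 * card (K x)" using tree_eigenvalue_block[OF x] none by blast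
        moreover have "\<delta> * card (K x) + 2 \<le> (\<Sum>z\<in>K x. card (N z - supp)) + 2 * card (K x)"
          by (rule block_boundary[OF x]) (use elim in blast)
        ultimately show "\<Delta> \<le> (\<Sum>z\<in>K x. card (N z - supp))" by linarith
      qed
    qed
  qed
  then have "AE c in L. emeasure (spectral_measure (fst (representative c)) (hd (snd (representative c)))) {t} = 0"
    using good
  proof eventually_elim
    case (elim c)
    then interpret bounded_tree "fst (representative c)" \<Delta> t by simp
    define x where "x = hd (snd (representative c))"
    have x: "x \<in> verts (fst (representative c))" using roots_cases(1) elim(2) by (fastforce simp: x_def)
    have "(norm (P x))\<^sup>2 = 0" using elim(1) unfolding norm_P x_def .
    then have "S.proj (delta_vec x) = 0" unfolding P_def by simp
    then show ?case using no_atom[OF x] unfolding x_def by blast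
  qed
  then have "mean_spectral_measure L {t} = (\<integral>\<^sup>+c. 0 \<partial>L)"
    unfolding mean_spectral_measure_def by (rule nn_integral_cong_AE)
  then show False using t by (simp add: pp_support_def)
qed

theorem corollary4:
  fixes \<delta> \<Delta> :: nat and L :: "nat rooted set measure"
  assumes "3 \<le> \<delta>" and "\<delta> \<le> \<Delta>"
    and "unimodular_network L"
    and "concentrated_on_trees {\<delta>..\<Delta>} L"
  shows "finite (pp_support L) \<and>
         pp_support L \<subseteq> {t \<in> totally_real_algebraic_integers.
           real (tree_complexity t) < (real \<Delta> - 2) / (real \<delta> - 2)}"
proof
  have block: "\<exists>n. tree_eigenvalue n t \<and> real n < (real \<Delta> - 2) / (real \<delta> - 2)" if t: "t \<in> pp_support L" for t
  proof -
    obtain n where n: "tree_eigenvalue n t" "\<delta> * n + 2 < \<Delta> + 2 * n"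
      using pp_support_block[OF assms(1,3,4) t] by blast
    have "real (\<delta> * n + 2) < real (\<Delta> + 2 * n)" using n(2) by (simp only: of_nat_less_iff)
    then have "real n * (real \<delta> - 2) < real \<Delta> - 2" by (simp add: algebra_simps)
    then have "real n < (real \<Delta> - 2) / (real \<delta> - 2)" using assms(1) by (simp add: pos_less_divide_eq)
    then show ?thesis using n(1) by blast
  qed
  \<comment> \<open>For finiteness: the sizes are bounded, and each size contributes finitely many
    eigenvalues.\<close>
  have "n \<le> nat \<lceil>(real \<Delta> - 2) / (real \<delta> - 2)\<rceil>" if "real n < (real \<Delta> - 2) / (real \<delta> - 2)" for n
    using that by linarith
  then have "pp_support L \<subseteq> (\<Union>n\<le>nat \<lceil>(real \<Delta> - 2) / (real \<delta> - 2)\<rceil>. {t. tree_eigenvalue n t})"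
    using block by fastforce
  then show "finite (pp_support L)" by (rule finite_subset) (intro finite_UN_I finite_atMost finite_tree_eigenvalues)
  show "pp_support L \<subseteq> {t \<in> totally_real_algebraic_integers.
           real (tree_complexity t) < (real \<Delta> - 2) / (real \<delta> - 2)}"
  proof
    fix t assume "t \<in> pp_support L"
    then obtain n where n: "tree_eigenvalue n t" "real n < (real \<Delta> - 2) / (real \<delta> - 2)" using block by blast
    have "real (tree_complexity t) \<le> real n" using tree_complexity_le[OF n(1)] by simp
    then show "t \<in> {t \<in> totally_real_algebraic_integers. real (tree_complexity t) < (real \<Delta> - 2) / (real \<delta> - 2)}"
      using tree_eigenvalue_totally_real[OF n(1)] n(2) by simp
  qed
qed

end
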